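(* Let $\mu$ be an infinitely divisible distribution on $\mathbb{R}_+$ (with zero drift $\gamma_0=0$) with Lévy measure $\nu$ satisfying $\nu((c,\infty))>0$ for all $c>0$. Assume that $$\int_{-\infty}^{\infty}|\widehat\mu(z)|\,dz<\infty.$$ Let $p(x)$ be the continuous density of $\mu$. Then the following are equivalent: (1) $p\in\mathcal{S}_d$. (2) $\nu_{(1)}\in\mathcal{S}_{loc}$. (3) $\nu_{(1)}\in\mathcal{L}_{loc}$ and $p(x)\sim\nu((x,x+1])$. (4) $\nu_{(1)}\in\mathcal{L}_{loc}$ and there is $C\in(0,\infty)$ such that $p(x)\sim C\,\nu((x,x+1])$.
   Context: $\mathbb{R}_+=[0,\infty)$. For functions $f,h$ that are positive on some half line $[A,\infty)$, $f(x)\sim h(x)$ means $\lim_{x\to\infty}f(x)/h(x)=1$. A nonnegative measurable function $h$ on $\mathbb{R}$ belongs to the class $\mathbf{L}$ (long-tailed) if $h(x+a)\sim h(x)$ for every $a\in\mathbb{R}$. For probability densities $f,h$ on $\mathbb{R}$, $f\otimes h(x)=\int_{-\infty}^{\infty} f(x-u)h(u)\,du$ and $f^{2\otimes}=f\otimes f$; $\rho^{2*}=\rho*\rho$ is the convolution square of a distribution $\rho$. A probability density $h$ on $\mathbb{R}$ belongs to $\mathcal{L}_d$ if $h\in\mathbf{L}$; it belongs to $\mathcal{S}_d$ (subexponential density) if $h\in\mathcal{L}_d$ and $h^{2\otimes}(x)\sim 2h(x)$. A distribution $\rho$ on $\mathbb{R}$ belongs to $\mathcal{L}_{loc}$ if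 for every $c>0$ the function $x\mapsto\rho((x,x+c])$ is in $\mathbf{L}$; it belongs to $\mathcal{S}_{loc}$ (locally subexponential) if for every $c>0$ the function $x\mapsto\rho((x,x+c])$ is in $\mathbf{L}$ and $\rho^{2*}((x,x+c])\sim 2\rho((x,x+c])$. An infinitely divisible distribution $\mu$ on $\mathbb{R}_+$ has characteristic function $\widehat\mu(z)=\int e^{izx}\mu(dx)=\exp\left(\int_0^\infty(e^{izx}-1)\nu(dx)+i\gamma_0z\right)$, where $\gamma_0\in\mathbb{R}_+$ is the drift and the Lévy measure $\nu$ is a measure on $\mathbb{R}_+$ with $\nu(\{0\})=0$ and $\int_0^\infty(1\wedge x)\nu(dx)<\infty$. The normalized Lévy measure is the probability distribution $\nu_{(1)}(dx):=1_{(1,\infty)}(x)\,\nu(dx)/\nu((1,\infty))$. Integrability of $\widehat\mu$ implies that $\mu$ has a bounded continuous density on $\mathbb{R}$. *)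

theory Defs
  imports "HOL-Probability.Probability"
begin

text \<open>
  Asymptotic equivalence at infinity of functions that are positive on some half line. The
  positivity conditions rule out the convention \<open>0 / 0 = 1\<close> of the library relation
  \<^const>\<open>asymp_equiv\<close>, so that the limit is that of the plain quotient.
\<close>

definition asymp_pos :: "(real \<Rightarrow> real) \<Rightarrow> (real \<Rightarrow> real) \<Rightarrow> bool"  (infix \<open>\<simeq>\<close> 50) where
  "f \<simeq> h \<longleftrightarrow> (\<forall>\<^sub>F x in at_top. 0 < f x) \<and> (\<forall>\<^sub>F x in at_top. 0 < h x) \<and> f \<sim>[at_top] h"

definition long_tailed :: "(real \<Rightarrow> real) set" where
  "long_tailed =
     {h. h \<in> borel_measurable borel \<and> (\<forall>x. 0 \<le> h x) \<and> (\<forall>a. (\<lambda>x. h (x + a)) \<simeq> h)}"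

definition prob_densities :: "(real \<Rightarrow> real) set" where
  "prob_densities =
     {h. h \<in> borel_measurable borel \<and> (\<forall>x. 0 \<le> h x) \<and> (\<integral>\<^sup>+x. ennreal (h x) \<partial>lborel) = 1}"

definition density_conv :: "(real \<Rightarrow> real) \<Rightarrow> (real \<Rightarrow> real) \<Rightarrow> real \<Rightarrow> real" where
  "density_conv f h x = (\<integral>u. f (x - u) * h u \<partial>lborel)"

definition long_tailed_densities :: "(real \<Rightarrow> real) set" where
  "long_tailed_densities = {h \<in> prob_densities. h \<in> long_tailed}"

definition subexp_densities :: "(real \<Rightarrow> real) set" where
  "subexp_densities = {h \<in> long_tailed_densities. density_conv h h \<simeq> (\<lambda>x. 2 * h x)}"

definition loc_long_tailed :: "real measure set" where
  "loc_long_tailed =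
     {\<rho>. real_distribution \<rho> \<and> (\<forall>c>0. (\<lambda>x. measure \<rho> {x<..x + c}) \<in> long_tailed)}"

definition loc_subexp :: "real measure set" where
  "loc_subexp =
     {\<rho>. real_distribution \<rho> \<and>
         (\<forall>c>0. (\<lambda>x. measure \<rho> {x<..x + c}) \<in> long_tailed \<and>
                (\<lambda>x. measure (\<rho> \<star> \<rho>) {x<..x + c}) \<simeq> (\<lambda>x. 2 * measure \<rho> {x<..x + c}))}"

primrec conv_power :: "real measure \<Rightarrow> nat \<Rightarrow> real measure" where
  "conv_power \<rho> 0 = return borel 0"
| "conv_power \<rho> (Suc n) = (\<rho> \<star> conv_power \<rho> n)"

definition infinitely_divisible :: "real measure \<Rightarrow> bool" where
  "infinitely_divisible \<mu> \<longleftrightarrow>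
     real_distribution \<mu> \<and> (\<forall>n\<ge>1. \<exists>\<rho>. real_distribution \<rho> \<and> \<mu> = conv_power \<rho> n)"

text \<open>Measures on the half line are Borel measures on the real line not charging \<open>(-\<infinity>, 0)\<close>.\<close>

definition on_half_line :: "real measure \<Rightarrow> bool" where
  "on_half_line M \<longleftrightarrow> sets M = sets borel \<and> emeasure M {..<0} = 0"

definition levy_measure_half_line :: "real measure \<Rightarrow> bool" where
  "levy_measure_half_line \<nu> \<longleftrightarrow>
     on_half_line \<nu> \<and> emeasure \<nu> {0} = 0 \<and> (\<integral>\<^sup>+x\<in>{0<..}. ennreal (min 1 x) \<partial>\<nu>) < \<infinity>"

text \<open>\<open>\<mu>\<close> is infinitely divisible on the half line, with Levy measure \<open>\<nu>\<close> and drift \<open>\<gamma>\<close>.\<close>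

definition inf_div_half_line :: "real measure \<Rightarrow> real measure \<Rightarrow> real \<Rightarrow> bool" where
  "inf_div_half_line \<mu> \<nu> \<gamma> \<longleftrightarrow>
     infinitely_divisible \<mu> \<and> on_half_line \<mu> \<and> levy_measure_half_line \<nu> \<and> 0 \<le> \<gamma> \<and>
     (\<forall>z. char \<mu> z =
        exp ((CLINT x:{0<..}|\<nu>. iexp (z * x) - 1) + \<i> * complex_of_real (\<gamma> * z)))"

definition normalized_levy :: "real measure \<Rightarrow> real measure" where
  "normalized_levy \<nu> = density \<nu> (\<lambda>x. indicator {1<..} x / emeasure \<nu> {1<..})"

end

theory Submission
  imports Defs
begin

text \<open>
  Let \<open>\<sigma>(dy) = y \<nu>(dy)\<close>. The proof rests on Steutel's size-bias identity
  \<open>x p(x) = \<integral> p(x - y) \<sigma>(dy)\<close> (\<open>steutel_identity\<close>), a linear equation between the density and the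
  Levy measure which replaces the exponential series of compound Poisson laws. It is proved for
  compound Poisson approximations of \<open>\<mu>\<close>, passed to the weak limit and then made pointwise by
  continuity of \<open>p\<close>. The integral is cut at \<open>A\<close> and \<open>x - A\<close>. The near part is of order \<open>p(x)\<close>,
  negligible against \<open>x p(x)\<close>. In the far part \<open>y\<close> is about \<open>x\<close>, so that the factor \<open>y\<close> cancels \<open>x\<close> and,
  for locally long-tailed \<open>\<nu>\<close>, what remains is \<open>\<nu>((x, x + 1]) \<integral> p\<close> (\<open>far_part_window\<close>). Everything then depends
  on the middle part. Integrals against a measure and integrals against its unit windows are
  exchanged by the smoothing lemmas, and long-tailed functions vary slowly uniformly on bounded shifts
  (\<open>long_tailed_uniform\<close>).

  From (2) to (3): local subexponentiality makes the middle part of \<open>\<nu>((x, x + 1])\<close> against \<open>\<nu>\<close>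
  negligible. Inserting this in Steutel's identity first bounds \<open>p(x)\<close> by a multiple of
  \<open>\<nu>((x, x + 1])\<close>, since the supremum of the ratio reappears on the right with a factor below one
  (\<open>density_window_bound\<close>), and with this bound the far part alone gives the asymptotics.

  From (4) to (1): the far part alone shows \<open>C \<ge> 1\<close>. For \<open>C \<le> 1\<close> the identity is integrated against
  submultiplicative weights that make the far tail dominate although \<open>\<integral> w p\<close> stays near one
  (\<open>window_ratio_ge_one\<close>); this is the device that Foss and Korshunov use for convolution tails. With \<open>C = 1\<close> the far
  part exhausts \<open>x p(x)\<close>, so the middle part is negligible, and by smoothing so is that of \<open>p\<close> against
  itself.

  From (1) to (3): now \<open>p * \<sigma>\<close> is known and \<open>\<sigma>\<close> is wanted, which in general calls for a Tauberian theorem of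
  Wiener type. Infinite divisibility gives a direct way: \<open>\<mu>\<close> is the convolution of a law
  \<open>M\<close> that has only small jumps, hence is close to the unit mass at \<open>0\<close>, with finitely many copies of a
  compound Poisson law \<open>\<pi>\<close> with \<open>\<pi>({0}) > 1/2\<close> (\<open>levy_factorization\<close>). A factor \<open>\<pi>\<close> can be removed from an
  asymptotic relation because the relative error is reproduced with the factor
  \<open>(1 - \<pi>({0})) / \<pi>({0}) < 1\<close> (\<open>deconvolution\<close>); finally \<open>M\<close> is removed by letting its jumps shrink.
  Then (1) and (3) give (2) by comparing the three parts of the convolution square of the normalized
  Levy measure with those of \<open>p\<close>.
\<close>

section \<open>Compound Poisson laws on the half line\<close>

definition half_line_distribution :: "real measure \<Rightarrow> bool" where
  "half_line_distribution M \<longleftrightarrow> real_distribution M \<and> emeasure M {..<0} = 0"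

lemma half_line_distributionD:
  assumes "half_line_distribution M"
  shows "real_distribution M" "prob_space M" "finite_measure M" "sigma_finite_measure M"
    "sets M = sets borel" "space M = UNIV" "AE x in M. 0 \<le> x" "emeasure M {..<0} = 0"
proof -
  show 1: "real_distribution M" and e: "emeasure M {..<0} = 0"
    using assms by (auto simp: half_line_distribution_def)
  interpret real_distribution M by fact
  show "prob_space M" "finite_measure M" "sigma_finite_measure M" by unfold_locales
  show "sets M = sets borel" "space M = UNIV" by simp_all
  show "AE x in M. 0 \<le> x"
    by (rule AE_I[of _ _ "{..<0}"]) (use e in auto)
qed

lemma half_line_distributionI:
  assumes "real_distribution M" "AE x in M. 0 \<le> x"
  shows "half_line_distribution M"
proof -
  interpret real_distribution M by fact
  have "emeasure M {..<0} = 0"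
    using assms(2) by (subst (asm) AE_iff_measurable[OF _ refl]) (auto simp: not_le lessThan_def)
  then show ?thesis using assms(1) by (simp add: half_line_distribution_def)
qed

lemma real_distributionI:
  assumes "prob_space M" "sets M = sets borel"
  shows "real_distribution M"
  using assms sets_eq_imp_space_eq[OF assms(2)]
  by (simp add: real_distribution_def real_distribution_axioms_def)

lemma nn_integral_convolution_half_line:
  assumes "half_line_distribution M" "half_line_distribution N" "f \<in> borel_measurable borel"
  shows "(\<integral>\<^sup>+x. f x \<partial>(M \<star> N)) = (\<integral>\<^sup>+x. \<integral>\<^sup>+y. f (x + y) \<partial>N \<partial>M)"
  using assms by (intro nn_integral_convolution) (auto simp: half_line_distributionD)

lemma half_line_distribution_convolution:
  assumes M: "half_line_distribution M" and N: "half_line_distribution N"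
  shows "half_line_distribution (M \<star> N)"
proof -
  note D = half_line_distributionD[OF M] half_line_distributionD[OF N]
  interpret M: real_distribution M by (rule D)
  interpret N: real_distribution N by (rule D)
  interpret pair_prob_space M N ..
  have "prob_space (M \<star> N)"
    unfolding convolution_def by (intro prob_space_distr) measurable
  moreover have "emeasure (M \<star> N) {..<0} = 0"
  proof -
    have "emeasure (M \<star> N) {..<0} = (\<integral>\<^sup>+x. \<integral>\<^sup>+y. indicator {..<0} (x + y) \<partial>N \<partial>M)"
      by (subst convolution_emeasure') (auto intro: D)
    also have "\<dots> = (\<integral>\<^sup>+x. \<integral>\<^sup>+y. 0 \<partial>N \<partial>M)"
    proof (intro nn_integral_cong_AE)
      have "(\<integral>\<^sup>+y. indicator {..<0} (x + y) \<partial>N) = (\<integral>\<^sup>+y. 0 \<partial>N)" if "0 \<le> x" for x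
        by (intro nn_integral_cong_AE) (use D(15) that in \<open>auto elim!: eventually_mono\<close>)
      then show "AE x in M. (\<integral>\<^sup>+y. indicator {..<0} (x + y) \<partial>N) = (\<integral>\<^sup>+y. 0 \<partial>N)"
        using D(7) by (auto elim!: eventually_mono)
    qed
    finally show ?thesis by simp
  qed
  ultimately show ?thesis
    unfolding half_line_distribution_def by (auto intro!: real_distributionI)
qed

lemma half_line_distribution_return: "half_line_distribution (return borel 0)"
  unfolding half_line_distribution_def
  by (auto intro!: real_distributionI prob_space_return simp: indicator_def)

lemma char_convolution:
  assumes M: "real_distribution M" and N: "real_distribution N"
  shows "char (M \<star> N) t = char M t * char N t"
proof -
  interpret M: real_distribution M by (rule M)
  interpret N: real_distribution N by (rule N)
  interpret pair_prob_space M N ..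
  have int: "integrable (M \<Otimes>\<^sub>M N) (\<lambda>(x, y). iexp (t * (x + y)))"
    by (intro integrable_const_bound[where B=1] AE_I2) (auto simp: split_beta)
  have "char (M \<star> N) t = (CLINT z|(M \<Otimes>\<^sub>M N). case z of (x, y) \<Rightarrow> iexp (t * (x + y)))"
    unfolding char_def convolution_def by (subst integral_distr) (auto simp: split_beta intro!: Bochner_Integration.integral_cong)
  also have "\<dots> = (CLINT x|M. CLINT y|N. iexp (t * (x + y)))"
    using integral_fst'[OF int] by simp
  also have "\<dots> = (CLINT x|M. CLINT y|N. iexp (t * x) * iexp (t * y))"
    by (intro Bochner_Integration.integral_cong refl) (simp add: algebra_simps exp_add)
  also have "\<dots> = char M t * char N t"
    by (simp add: char_def)
  finally show ?thesis .
qed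

lemma char_return_0: "char (return borel 0) t = 1"
  unfolding char_def by (subst integral_return) auto

lemma half_line_distribution_conv_power:
  "half_line_distribution \<rho> \<Longrightarrow> half_line_distribution (conv_power \<rho> n)"
  by (induction n) (auto intro: half_line_distribution_return half_line_distribution_convolution)

lemma char_conv_power:
  assumes "half_line_distribution \<rho>"
  shows "char (conv_power \<rho> n) t = char \<rho> t ^ n"
  by (induction n) (use assms half_line_distribution_conv_power[OF assms] in
    \<open>auto simp: char_return_0 char_convolution half_line_distributionD\<close>)

text \<open>
  In \<open>E f(S) S\<close> with \<open>S\<close> a sum of \<open>n + 1\<close> independent summands, each summand contributes the same amount by
  exchangeability; singling one out leaves a sum of \<open>n\<close> summands.
\<close>

lemma nn_integral_conv_power_size_bias:
  assumes \<rho>: "half_line_distribution \<rho>" and f: "f \<in> borel_measurable borel"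
  shows "(\<integral>\<^sup>+x. f x * ennreal x \<partial>conv_power \<rho> (Suc n)) =
    of_nat (Suc n) * (\<integral>\<^sup>+x. \<integral>\<^sup>+y. f (x + y) * ennreal y \<partial>\<rho> \<partial>conv_power \<rho> n)"
  using f
proof (induction n arbitrary: f)
  case (0 f)
  note [measurable] = \<open>f \<in> borel_measurable borel\<close>
  note D = half_line_distributionD[OF \<rho>]
  have [measurable_cong]: "sets \<rho> = sets borel" by (rule D)
  interpret R: real_distribution \<rho> by (rule D)
  show ?case
    using half_line_distribution_return
    by (simp add: nn_integral_convolution_half_line[OF \<rho>] nn_integral_return)
next
  case (Suc n f)
  note [measurable] = \<open>f \<in> borel_measurable borel\<close>
  define P where "P = conv_power \<rho> (Suc n)"
  have P: "half_line_distribution P"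
    unfolding P_def by (rule half_line_distribution_conv_power[OF \<rho>])
  define Q where "Q = conv_power \<rho> n"
  have Q: "half_line_distribution Q"
    unfolding Q_def by (rule half_line_distribution_conv_power[OF \<rho>])
  have PQ: "P = (\<rho> \<star> Q)" by (simp add: P_def Q_def)
  note D = half_line_distributionD[OF \<rho>] half_line_distributionD[OF P] half_line_distributionD[OF Q]
  interpret R: real_distribution \<rho> by (rule D)
  interpret P: real_distribution P by (rule D)
  interpret Q: real_distribution Q by (rule D)
  interpret PR: pair_sigma_finite \<rho> P ..
  have "(\<integral>\<^sup>+x. f x * ennreal x \<partial>conv_power \<rho> (Suc (Suc n)))
      = (\<integral>\<^sup>+x. \<integral>\<^sup>+y. f (x + y) * ennreal (x + y) \<partial>P \<partial>\<rho>)"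
    unfolding P_def conv_power.simps(2)[of \<rho> "Suc n"]
    by (subst nn_integral_convolution_half_line[OF \<rho>])
      (auto intro: half_line_distribution_conv_power[OF \<rho>, of "Suc n", simplified])
  also have "\<dots> = (\<integral>\<^sup>+x. (\<integral>\<^sup>+y. f (x + y) * ennreal x + f (x + y) * ennreal y \<partial>P) \<partial>\<rho>)"
  proof (rule nn_integral_cong_AE)
    have "(\<integral>\<^sup>+y. f (x + y) * ennreal (x + y) \<partial>P)
        = (\<integral>\<^sup>+y. f (x + y) * ennreal x + f (x + y) * ennreal y \<partial>P)" if "0 \<le> x" for x
      by (rule nn_integral_cong_AE)
        (use D(15) that in \<open>auto elim!: eventually_mono simp: distrib_left\<close>)
    then show "AE x in \<rho>. (\<integral>\<^sup>+y. f (x + y) * ennreal (x + y) \<partial>P)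
        = (\<integral>\<^sup>+y. f (x + y) * ennreal x + f (x + y) * ennreal y \<partial>P)"
      using D(7) by (auto elim!: eventually_mono)
  qed
  also have "\<dots> = (\<integral>\<^sup>+x. (\<integral>\<^sup>+y. f (x + y) * ennreal x \<partial>P) + (\<integral>\<^sup>+y. f (x + y) * ennreal y \<partial>P) \<partial>\<rho>)"
    by (intro nn_integral_cong nn_integral_add) auto
  also have "\<dots> = (\<integral>\<^sup>+x. (\<integral>\<^sup>+y. f (x + y) * ennreal x \<partial>P) \<partial>\<rho>)
      + (\<integral>\<^sup>+x. (\<integral>\<^sup>+y. f (x + y) * ennreal y \<partial>P) \<partial>\<rho>)"
    by (intro nn_integral_add) auto
  also have "(\<integral>\<^sup>+x. (\<integral>\<^sup>+y. f (x + y) * ennreal x \<partial>P) \<partial>\<rho>)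
      = (\<integral>\<^sup>+x. \<integral>\<^sup>+y. f (x + y) * ennreal y \<partial>\<rho> \<partial>P)"
    by (subst PR.Fubini'[symmetric]) (auto simp: add.commute)
  also have "(\<integral>\<^sup>+x. (\<integral>\<^sup>+y. f (x + y) * ennreal y \<partial>P) \<partial>\<rho>)
      = (\<integral>\<^sup>+x. of_nat (Suc n) * (\<integral>\<^sup>+y. \<integral>\<^sup>+z. f (x + (y + z)) * ennreal z \<partial>\<rho> \<partial>Q) \<partial>\<rho>)"
    unfolding P_def Q_def by (intro nn_integral_cong Suc.IH) auto
  also have "\<dots> = of_nat (Suc n) * (\<integral>\<^sup>+x. (\<integral>\<^sup>+y. \<integral>\<^sup>+z. f (x + (y + z)) * ennreal z \<partial>\<rho> \<partial>Q) \<partial>\<rho>)"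
    by (rule nn_integral_cmult) auto
  also have "(\<integral>\<^sup>+x. (\<integral>\<^sup>+y. \<integral>\<^sup>+z. f (x + (y + z)) * ennreal z \<partial>\<rho> \<partial>Q) \<partial>\<rho>)
      = (\<integral>\<^sup>+x. \<integral>\<^sup>+y. f (x + y) * ennreal y \<partial>\<rho> \<partial>P)"
    unfolding PQ by (subst nn_integral_convolution_half_line[OF \<rho> Q]) (auto simp: add.assoc)
  finally show ?case
    by (simp add: P_def distrib_right)
qed

definition compound_poisson :: "real \<Rightarrow> real measure \<Rightarrow> real measure" where
  "compound_poisson \<kappa> \<rho> = measure_pmf (poisson_pmf \<kappa>) \<bind> conv_power \<rho>"

context
  fixes \<kappa> :: real and \<rho> :: "real measure"
  assumes \<kappa>: "0 < \<kappa>" and \<rho>: "half_line_distribution \<rho>"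
begin

lemma conv_power_in_subprob_algebra: "conv_power \<rho> n \<in> space (subprob_algebra borel)"
  using half_line_distributionD[OF half_line_distribution_conv_power[OF \<rho>]]
  by (auto simp: space_subprob_algebra intro!: prob_space_imp_subprob_space)

lemma measurable_conv_power:
  "conv_power \<rho> \<in> measurable (measure_pmf N) (subprob_algebra borel)"
  by (auto simp: conv_power_in_subprob_algebra)

lemma nn_integral_compound_poisson:
  assumes "f \<in> borel_measurable borel"
  shows "(\<integral>\<^sup>+x. f x \<partial>compound_poisson \<kappa> \<rho>) =
    (\<Sum>n. ennreal (\<kappa> ^ n / fact n * exp (- \<kappa>)) * (\<integral>\<^sup>+x. f x \<partial>conv_power \<rho> n))"
  unfolding compound_poisson_def
  by (subst nn_integral_bind[OF assms measurable_conv_power])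
    (simp add: nn_integral_measure_pmf nn_integral_count_space_nat pmf_poisson[OF \<kappa>])

lemma sets_compound_poisson: "sets (compound_poisson \<kappa> \<rho>) = sets borel"
  unfolding compound_poisson_def
  by (rule sets_bind[OF _ ]) (auto simp: half_line_distributionD[OF half_line_distribution_conv_power[OF \<rho>]])

lemma half_line_distribution_compound_poisson:
  "half_line_distribution (compound_poisson \<kappa> \<rho>)"
proof -
  have "prob_space (compound_poisson \<kappa> \<rho>)"
    unfolding compound_poisson_def
    by (rule prob_space_bind'[where M="count_space UNIV" and N=borel])
      (auto simp: space_prob_algebra measure_pmf.prob_space_axioms half_line_distributionD[OF half_line_distribution_conv_power[OF \<rho>]])
  moreover have "emeasure (compound_poisson \<kappa> \<rho>) {..<0} = 0"
    using nn_integral_compound_poisson[of "indicator {..<0}"] sets_compound_poisson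
      half_line_distributionD[OF half_line_distribution_conv_power[OF \<rho>]]
    by (simp)
  ultimately show ?thesis
    using sets_compound_poisson by (auto simp: half_line_distribution_def intro!: real_distributionI)
qed

text \<open>
  The event that there is no jump at all. It supplies the mass at zero that makes deconvolution possible.
\<close>

lemma compound_poisson_atom: "ennreal (exp (- \<kappa>)) \<le> emeasure (compound_poisson \<kappa> \<rho>) {0}"
proof -
  let ?g = "\<lambda>n. ennreal (\<kappa> ^ n / fact n * exp (- \<kappa>)) * (\<integral>\<^sup>+x. indicator {0} x \<partial>conv_power \<rho> n)"
  have "ennreal (exp (- \<kappa>)) = (\<Sum>n<Suc 0. ?g n)"
    by (simp)
  also have "\<dots> \<le> (\<Sum>n. ?g n)"
    by (rule sum_le_suminf) auto
  also have "\<dots> = emeasure (compound_poisson \<kappa> \<rho>) {0}"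
    using nn_integral_compound_poisson[of "indicator {0}"] sets_compound_poisson by simp
  finally show ?thesis .
qed

lemma char_compound_poisson:
  "char (compound_poisson \<kappa> \<rho>) t = exp (complex_of_real \<kappa> * (char \<rho> t - 1))"
proof -
  note D = half_line_distributionD[OF half_line_distribution_conv_power[OF \<rho>]]
  have "char (compound_poisson \<kappa> \<rho>) t = (LINT n|measure_pmf (poisson_pmf \<kappa>). char (conv_power \<rho> n) t)"
  proof (rule complex_eqI)
    interpret C: real_distribution "compound_poisson \<kappa> \<rho>"
      by (rule half_line_distributionD[OF half_line_distribution_compound_poisson])
    interpret R: real_distribution "conv_power \<rho> n" for n by (rule D)
    have int: "integrable (measure_pmf (poisson_pmf \<kappa>)) (\<lambda>n. char (conv_power \<rho> n) t)"
      by (rule measure_pmf.integrable_const_bound[where B=1]) (auto simp: R.cmod_char_le_1)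
    have bind: "(LINT x|compound_poisson \<kappa> \<rho>. h x)
        = (LINT n|measure_pmf (poisson_pmf \<kappa>). LINT x|conv_power \<rho> n. h x)"
      if "h \<in> borel_measurable borel" "\<And>x. \<bar>h x\<bar> \<le> 1" for h :: "real \<Rightarrow> real"
      unfolding compound_poisson_def
      by (rule integral_bind[where K=borel and B=1 and B'=1])
        (use that in \<open>auto simp: measure_pmf.finite_measure_axioms conv_power_in_subprob_algebra
          R.emeasure_space_1[simplified]\<close>)
    have "Re (char (compound_poisson \<kappa> \<rho>) t) = (LINT x|compound_poisson \<kappa> \<rho>. cos (t * x))"
      unfolding char_def by (subst integral_Re[symmetric]) (auto simp: C.integrable_iexp Re_exp)
    also have "\<dots> = (LINT n|measure_pmf (poisson_pmf \<kappa>). LINT x|conv_power \<rho> n. cos (t * x))"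
      by (rule bind) auto
    also have "\<dots> = (LINT n|measure_pmf (poisson_pmf \<kappa>). Re (char (conv_power \<rho> n) t))"
      unfolding char_def by (subst integral_Re[symmetric]) (auto simp: R.integrable_iexp Re_exp)
    also have "\<dots> = Re (LINT n|measure_pmf (poisson_pmf \<kappa>). char (conv_power \<rho> n) t)"
      using int by (rule integral_Re)
    finally show "Re (char (compound_poisson \<kappa> \<rho>) t)
        = Re (LINT n|measure_pmf (poisson_pmf \<kappa>). char (conv_power \<rho> n) t)" .
    have "Im (char (compound_poisson \<kappa> \<rho>) t) = (LINT x|compound_poisson \<kappa> \<rho>. sin (t * x))"
      unfolding char_def by (subst integral_Im[symmetric]) (auto simp: C.integrable_iexp Im_exp)
    also have "\<dots> = (LINT n|measure_pmf (poisson_pmf \<kappa>). LINT x|conv_power \<rho> n. sin (t * x))"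
      by (rule bind) auto
    also have "\<dots> = (LINT n|measure_pmf (poisson_pmf \<kappa>). Im (char (conv_power \<rho> n) t))"
      unfolding char_def by (subst integral_Im[symmetric]) (auto simp: R.integrable_iexp Im_exp)
    also have "\<dots> = Im (LINT n|measure_pmf (poisson_pmf \<kappa>). char (conv_power \<rho> n) t)"
      using int by (rule integral_Im)
    finally show "Im (char (compound_poisson \<kappa> \<rho>) t)
        = Im (LINT n|measure_pmf (poisson_pmf \<kappa>). char (conv_power \<rho> n) t)" .
  qed
  also have "\<dots> = (LINT n|measure_pmf (poisson_pmf \<kappa>). char \<rho> t ^ n)"
    by (simp add: char_conv_power[OF \<rho>])
  also have "\<dots> = (LINT n|count_space UNIV. (\<kappa> ^ n / fact n * exp (- \<kappa>)) *\<^sub>R char \<rho> t ^ n)"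
    unfolding measure_pmf_eq_density
    by (subst integral_density) (use \<kappa> in \<open>auto simp: pmf_poisson[OF \<kappa>] intro!: AE_I2\<close>)
  also have "\<dots> = exp (- \<kappa>) * exp (complex_of_real \<kappa> * char \<rho> t)"
  proof -
    let ?z = "complex_of_real \<kappa> * char \<rho> t"
    have eq: "(\<kappa> ^ n / fact n * exp (- \<kappa>)) *\<^sub>R char \<rho> t ^ n = exp (- \<kappa>) *\<^sub>R (?z ^ n /\<^sub>R fact n)" for n
      by (simp add: scaleR_conv_of_real power_mult_distrib field_simps)
    have s: "summable (\<lambda>n. norm (exp (- \<kappa>) *\<^sub>R (?z ^ n /\<^sub>R fact n)))"
      using summable_mult[OF summable_norm_exp[of ?z], of "exp (- \<kappa>)"] by (simp add: mult.assoc)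
    have "(LINT n|count_space UNIV. exp (- \<kappa>) *\<^sub>R (?z ^ n /\<^sub>R fact n)) = (\<Sum>n. exp (- \<kappa>) *\<^sub>R (?z ^ n /\<^sub>R fact n))"
      using sums_integral_count_space_nat[of "\<lambda>n. exp (- \<kappa>) *\<^sub>R (?z ^ n /\<^sub>R fact n)"] s
      by (simp add: integrable_count_space_nat_iff sums_iff)
    also have "\<dots> = exp (- \<kappa>) *\<^sub>R exp ?z"
      by (simp add: exp_def suminf_scaleR_right[OF summable_exp_generic])
    finally show ?thesis
      unfolding eq by (simp add: scaleR_conv_of_real exp_of_real)
  qed
  also have "\<dots> = exp (complex_of_real \<kappa> * (char \<rho> t - 1))"
    by (simp add: exp_of_real[symmetric] exp_add[symmetric] algebra_simps)
  finally show ?thesis .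
qed

text \<open>
  The Poisson weights satisfy \<open>(n + 1) w(n + 1) = \<kappa> w(n)\<close>, which turns the identity for convolution
  powers into one between the law and itself.
\<close>

lemma compound_poisson_size_bias:
  assumes [measurable]: "f \<in> borel_measurable borel"
  shows "(\<integral>\<^sup>+x. f x * ennreal x \<partial>compound_poisson \<kappa> \<rho>) =
    ennreal \<kappa> * (\<integral>\<^sup>+x. \<integral>\<^sup>+y. f (x + y) * ennreal y \<partial>\<rho> \<partial>compound_poisson \<kappa> \<rho>)"
proof -
  note D = half_line_distributionD[OF \<rho>]
  interpret R: real_distribution \<rho> by (rule D)
  let ?P = "\<lambda>n. conv_power \<rho> n" and ?w = "\<lambda>n. \<kappa> ^ n / fact n * exp (- \<kappa>)"
  let ?I = "\<lambda>n. \<integral>\<^sup>+x. \<integral>\<^sup>+y. f (x + y) * ennreal y \<partial>\<rho> \<partial>?P n"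
  have w: "ennreal (?w (Suc n)) * of_nat (Suc n) = ennreal \<kappa> * ennreal (?w n)" for n
  proof -
    have "?w (Suc n) * real (Suc n) = \<kappa> * ?w n"
      by (simp add: field_simps del: of_nat_Suc)
    then show ?thesis
      using \<kappa> by (simp add: ennreal_of_nat_eq_real_of_nat ennreal_mult[symmetric] del: of_nat_Suc)
  qed
  have "(\<integral>\<^sup>+x. f x * ennreal x \<partial>compound_poisson \<kappa> \<rho>)
      = (\<Sum>n. ennreal (?w n) * (\<integral>\<^sup>+x. f x * ennreal x \<partial>?P n))"
    by (rule nn_integral_compound_poisson) simp
  also have "\<dots> = (\<Sum>n. ennreal (?w (n + 1)) * (\<integral>\<^sup>+x. f x * ennreal x \<partial>?P (n + 1)))
     + (\<Sum>n<1. ennreal (?w n) * (\<integral>\<^sup>+x. f x * ennreal x \<partial>?P n))"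
    by (rule suminf_offset) simp
  also have "(\<Sum>n<1. ennreal (?w n) * (\<integral>\<^sup>+x. f x * ennreal x \<partial>?P n)) = 0"
    by (simp add: nn_integral_return)
  also have "(\<Sum>n. ennreal (?w (n + 1)) * (\<integral>\<^sup>+x. f x * ennreal x \<partial>?P (n + 1)))
     = (\<Sum>n. ennreal \<kappa> * (ennreal (?w n) * ?I n))"
    unfolding Suc_eq_plus1[symmetric]
    by (subst nn_integral_conv_power_size_bias[OF \<rho>])
      (auto simp only: mult.assoc[symmetric] w assms)
  also have "\<dots> = ennreal \<kappa> * (\<Sum>n. ennreal (?w n) * ?I n)"
    by (rule ennreal_suminf_cmult)
  also have "(\<Sum>n. ennreal (?w n) * ?I n) = (\<integral>\<^sup>+x. \<integral>\<^sup>+y. f (x + y) * ennreal y \<partial>\<rho> \<partial>compound_poisson \<kappa> \<rho>)"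
    by (rule nn_integral_compound_poisson[symmetric]) measurable
  finally show ?thesis by simp
qed

end

text \<open>
  Jump measures of mass zero occur when a Levy measure is restricted to a set that it does not charge; then
  the law is the unit mass at zero.
\<close>

lemma compound_poisson_exists:
  assumes [measurable_cong]: "sets m = sets borel" and "finite_measure m" and m0: "emeasure m {..<0} = 0"
  shows "\<exists>N. half_line_distribution N \<and> (\<forall>t. char N t = exp (CLINT y|m. iexp (t * y) - 1)) \<and>
    ennreal (exp (- measure m UNIV)) \<le> emeasure N {0} \<and>
    (\<forall>f\<in>borel_measurable borel. (\<integral>\<^sup>+x. f x * ennreal x \<partial>N) =
      (\<integral>\<^sup>+x. \<integral>\<^sup>+y. f (x + y) * ennreal y \<partial>m \<partial>N))"
proof -
  interpret m: finite_measure m by fact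
  have [simp]: "space m = UNIV" using sets_eq_imp_space_eq[OF assms(1)] by simp
  define \<kappa> where "\<kappa> = measure m UNIV"
  have em: "emeasure m UNIV = ennreal \<kappa>"
    unfolding \<kappa>_def by (simp add: m.emeasure_eq_measure)
  show ?thesis
  proof (cases "\<kappa> = 0")
    case True
    then have "emeasure m (space m) = 0" using em by simp
    then have ae: "AE x in m. P x" for P
      by (intro AE_I[of _ _ "space m"]) auto
    have nn: "(\<integral>\<^sup>+y. h y \<partial>m) = 0" for h
      using nn_integral_cong_AE[OF ae, of h "\<lambda>_. 0"] by simp
    have li: "(CLINT y|m. h y) = 0" if [measurable]: "h \<in> borel_measurable borel" for h :: "real \<Rightarrow> complex"
      using integral_cong_AE[of h m "\<lambda>_. 0"] ae by simp
    show ?thesis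
      using True half_line_distribution_return
      by (intro exI[of _ "return borel 0"]) (auto simp: char_return_0 nn li \<kappa>_def[symmetric] nn_integral_return)
  next
    case False
    then have \<kappa>: "0 < \<kappa>" by (simp add: \<kappa>_def less_le)
    define \<rho> where "\<rho> = density m (\<lambda>_. ennreal (1 / \<kappa>))"
    have [measurable_cong]: "sets \<rho> = sets borel" by (simp add: \<rho>_def assms(1))
    have "emeasure \<rho> UNIV = 1"
      unfolding \<rho>_def by (subst emeasure_density) (use \<kappa> in \<open>auto simp: em nn_integral_cmult ennreal_mult[symmetric]\<close>)
    then have "prob_space \<rho>" by (intro prob_spaceI) (simp add: \<rho>_def)
    moreover have "emeasure \<rho> {..<0} = 0"
      unfolding \<rho>_def by (subst emeasure_density) (auto simp: nn_integral_cmult m0)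
    ultimately have \<rho>: "half_line_distribution \<rho>"
      by (auto simp: half_line_distribution_def \<open>sets \<rho> = _\<close> intro!: real_distributionI)
    interpret R: real_distribution \<rho> by (rule half_line_distributionD[OF \<rho>])
    have ch: "complex_of_real \<kappa> * (char \<rho> t - 1) = (CLINT y|m. iexp (t * y) - 1)" for t
    proof -
      have "char \<rho> t - 1 = (CLINT y|\<rho>. iexp (t * y) - 1)"
        unfolding char_def
        by (subst Bochner_Integration.integral_diff) (auto simp: R.integrable_iexp R.prob_space[simplified])
      also have "\<dots> = (CLINT y|m. (1 / \<kappa>) *\<^sub>R (iexp (t * y) - 1))"
        unfolding \<rho>_def by (rule integral_density) (use \<kappa> in auto)
      also have "\<dots> = (1 / \<kappa>) *\<^sub>R (CLINT y|m. (iexp (t * y) - 1))"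
        by (rule integral_scaleR_right)
      finally show ?thesis using \<kappa> by (simp add: scaleR_conv_of_real)
    qed
    have nn: "ennreal \<kappa> * (\<integral>\<^sup>+x. \<integral>\<^sup>+y. f (x + y) * ennreal y \<partial>\<rho> \<partial>compound_poisson \<kappa> \<rho>)
        = (\<integral>\<^sup>+x. \<integral>\<^sup>+y. f (x + y) * ennreal y \<partial>m \<partial>compound_poisson \<kappa> \<rho>)"
      if [measurable]: "f \<in> borel_measurable borel" for f :: "real \<Rightarrow> ennreal"
    proof -
      have [measurable_cong]: "sets (compound_poisson \<kappa> \<rho>) = sets borel"
        by (rule sets_compound_poisson[OF \<kappa> \<rho>])
      have "ennreal \<kappa> * (\<integral>\<^sup>+y. f (x + y) * ennreal y \<partial>\<rho>) = (\<integral>\<^sup>+y. f (x + y) * ennreal y \<partial>m)" for x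
        unfolding \<rho>_def using \<kappa>
        by (simp add: nn_integral_density nn_integral_cmult[symmetric])
          (simp add: mult.assoc[symmetric] ennreal_mult[symmetric])
      then show ?thesis
        by (subst nn_integral_cmult[symmetric]) auto
    qed
    show ?thesis
      unfolding \<kappa>_def[symmetric] using char_compound_poisson[OF \<kappa> \<rho>] compound_poisson_atom[OF \<kappa> \<rho>]
        half_line_distribution_compound_poisson[OF \<kappa> \<rho>] compound_poisson_size_bias[OF \<kappa> \<rho>]
      by (intro exI[of _ "compound_poisson \<kappa> \<rho>"]) (auto simp: ch nn)
  qed
qed

section \<open>Levy measures on the half line\<close>

locale levy_measure =
  fixes \<nu> :: "real measure"
  assumes levy: "levy_measure_half_line \<nu>"
begin

lemma sets_nu [simp, measurable_cong]: "sets \<nu> = sets borel"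
  using levy by (simp add: levy_measure_half_line_def on_half_line_def)

lemma space_nu [simp]: "space \<nu> = UNIV"
  using sets_eq_imp_space_eq[OF sets_nu] by simp

lemma nu_nonpos: "emeasure \<nu> {..0} = 0"
proof -
  have "{..0::real} = {..<0} \<union> {0}" by auto
  then have "emeasure \<nu> {..0} \<le> emeasure \<nu> {..<0} + emeasure \<nu> {0}"
    using emeasure_subadditive[of "{..<0}" \<nu> "{0}"] by simp
  then show ?thesis using levy by (simp add: levy_measure_half_line_def on_half_line_def)
qed

lemma AE_pos: "AE y in \<nu>. 0 < y"
  by (rule AE_I[of _ _ "{..0}"]) (auto simp: nu_nonpos)

lemma finite_min: "(\<integral>\<^sup>+y\<in>{0<..}. ennreal (min 1 y) \<partial>\<nu>) < \<infinity>"
  using levy by (simp add: levy_measure_half_line_def)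

lemma finite_small: "(\<integral>\<^sup>+y\<in>{0<..R}. ennreal y \<partial>\<nu>) < \<infinity>"
proof -
  have "(\<integral>\<^sup>+y\<in>{0<..R}. ennreal y \<partial>\<nu>) \<le> (\<integral>\<^sup>+y. ennreal (max 1 R) * (ennreal (min 1 y) * indicator {0<..} y) \<partial>\<nu>)"
  proof (rule nn_integral_mono)
    fix y
    have "y \<le> max 1 R * min 1 y" if "0 < y" "y \<le> R"
    proof (cases "y \<le> 1")
      case True
      then show ?thesis using that mult_right_mono[of 1 "max 1 R" y] by simp
    next
      case False
      then show ?thesis using that by simp
    qed
    then show "ennreal y * indicator {0<..R} y \<le> ennreal (max 1 R) * (ennreal (min 1 y) * indicator {0<..} y)"
      by (auto simp: indicator_def ennreal_mult[symmetric] intro!: ennreal_leI)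
  qed
  also have "\<dots> = ennreal (max 1 R) * (\<integral>\<^sup>+y\<in>{0<..}. ennreal (min 1 y) \<partial>\<nu>)"
    by (rule nn_integral_cmult) simp
  also have "\<dots> < \<infinity>" using finite_min by (simp add: ennreal_mult_less_top)
  finally show ?thesis .
qed

lemma finite_tail:
  assumes "0 < d" shows "emeasure \<nu> {d<..} < \<infinity>"
proof -
  have "ennreal (min 1 d) * emeasure \<nu> {d<..} = (\<integral>\<^sup>+y. ennreal (min 1 d) * indicator {d<..} y \<partial>\<nu>)"
    by (subst nn_integral_cmult) auto
  also have "\<dots> \<le> (\<integral>\<^sup>+y\<in>{0<..}. ennreal (min 1 y) \<partial>\<nu>)"
    by (intro nn_integral_mono) (use assms in \<open>auto simp: indicator_def intro!: ennreal_leI\<close>)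
  also have "\<dots> < \<infinity>" by (rule finite_min)
  finally show ?thesis using assms by (auto simp: ennreal_mult_less_top)
qed

lemma sigma_finite_nu: "sigma_finite_measure \<nu>"
proof
  let ?A = "insert {..0} (range (\<lambda>n. {inverse (real (Suc n))<..}))"
  have "\<Union> ?A = UNIV"
  proof (intro set_eqI iffI UNIV_I)
    fix x :: real
    show "x \<in> \<Union> ?A"
    proof (cases "x \<le> 0")
      case False
      then obtain n where "inverse (real (Suc n)) < x" using reals_Archimedean[of x] by auto
      then show ?thesis by auto
    qed auto
  qed
  then show "\<exists>A. countable A \<and> A \<subseteq> sets \<nu> \<and> \<Union> A = space \<nu> \<and> (\<forall>B\<in>A. emeasure \<nu> B \<noteq> \<infinity>)"
    using finite_tail by (intro exI[of _ ?A]) (auto simp: nu_nonpos less_top[symmetric])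
qed

sublocale nu: sigma_finite_measure \<nu> by (rule sigma_finite_nu)

lemma iexp_bound:
  assumes "0 < y" shows "cmod (iexp (z * y) - 1) \<le> (2 + \<bar>z\<bar>) * min 1 y"
proof (cases "y \<le> 1")
  case True
  have "cmod (iexp (z * y) - 1) \<le> \<bar>z * y\<bar>"
    using iexp_approx1[of "z * y" 0] by simp
  also have "\<dots> \<le> (2 + \<bar>z\<bar>) * y" using assms by (auto simp: abs_mult algebra_simps)
  finally show ?thesis using True by (simp add: min_def)
next
  case False
  have "cmod (iexp (z * y) - 1) \<le> cmod (iexp (z * y)) + cmod 1" by (rule norm_triangle_ineq4)
  also have "\<dots> \<le> 2 + \<bar>z\<bar>" by (simp)
  finally show ?thesis using False by (simp add: min_def)
qed

lemma integrable_min: "set_integrable \<nu> {0<..} (\<lambda>y. min 1 y)"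
  unfolding set_integrable_def
proof (rule integrableI_nonneg)
  have "(\<integral>\<^sup>+y. ennreal (indicat_real {0<..} y *\<^sub>R min 1 y) \<partial>\<nu>) = (\<integral>\<^sup>+y\<in>{0<..}. ennreal (min 1 y) \<partial>\<nu>)"
    by (intro nn_integral_cong) (auto simp: indicator_def)
  then show "(\<integral>\<^sup>+y. ennreal (indicat_real {0<..} y *\<^sub>R min 1 y) \<partial>\<nu>) < \<infinity>" using finite_min by simp
qed (auto simp: indicator_def intro!: AE_I2)

lemma integrable_levy_exponent:
  assumes [measurable]: "B \<in> sets borel" and "B \<subseteq> {0<..}"
  shows "set_integrable \<nu> B (\<lambda>y. iexp (z * y) - 1)"
proof -
  have "integrable \<nu> (\<lambda>y. (2 + \<bar>z\<bar>) * (indicat_real {0<..} y *\<^sub>R min 1 y))"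
    using integrable_min unfolding set_integrable_def by (rule integrable_mult_right)
  then show ?thesis
    unfolding set_integrable_def
  proof (rule Bochner_Integration.integrable_bound)
    show "AE y in \<nu>. norm (indicat_real B y *\<^sub>R (iexp (z * y) - 1)) \<le> norm ((2 + \<bar>z\<bar>) * (indicat_real {0<..} y *\<^sub>R min 1 y))"
      using iexp_bound[of _ z] assms(2) by (intro AE_I2) (auto simp: indicator_def abs_mult)
  qed measurable
qed

lemma levy_exponent_union:
  assumes "0 < e"
  shows "(CLINT y:{0<..}|\<nu>. iexp (z * y) - 1)
    = (CLINT y:{0<..e}|\<nu>. iexp (z * y) - 1) + (CLINT y:{e<..}|\<nu>. iexp (z * y) - 1)"
proof -
  have "{0<..} = {0<..e} \<union> {e<..}" using assms by auto
  moreover have "(CLINT y:({0<..e} \<union> {e<..})|\<nu>. iexp (z * y) - 1)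
    = (CLINT y:{0<..e}|\<nu>. iexp (z * y) - 1) + (CLINT y:{e<..}|\<nu>. iexp (z * y) - 1)"
    by (intro set_integral_Un integrable_levy_exponent) (use assms in auto)
  ultimately show ?thesis by simp
qed

text \<open>
  The exponent is absolutely convergent, so cutting off jumps below \<open>1 / (n + 1)\<close> is harmless in the
  limit; the sets \<open>B \<inter> {1 / (n + 1)<..}\<close> have finite mass and define compound Poisson laws.
\<close>

lemma levy_exponent_limit:
  assumes [measurable]: "B \<in> sets borel" and "B \<subseteq> {0<..}"
  shows "(\<lambda>n. CLINT y:(B \<inter> {inverse (real (Suc n))<..})|\<nu>. iexp (z * y) - 1)
    \<longlonglongrightarrow> (CLINT y:B|\<nu>. iexp (z * y) - 1)"
proof -
  let ?A = "\<lambda>n. B \<inter> {inverse (real (Suc n))<..}"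
  have U: "(\<Union>n. ?A n) = B"
  proof (intro set_eqI iffI)
    fix x assume "x \<in> B"
    then have "0 < x" using assms(2) by auto
    then obtain n where "inverse (real (Suc n)) < x" using reals_Archimedean[of x] by auto
    then show "x \<in> (\<Union>n. ?A n)" using \<open>x \<in> B\<close> by auto
  qed auto
  have "(\<lambda>n. CLINT y:?A n|\<nu>. iexp (z * y) - 1) \<longlonglongrightarrow> (CLINT y:(\<Union>n. ?A n)|\<nu>. iexp (z * y) - 1)"
  proof (rule set_integral_cont_up)
    show "incseq ?A"
    proof (intro monoI)
      fix i j :: nat assume "i \<le> j"
      then have "inverse (real (Suc j)) \<le> inverse (real (Suc i))" by (intro le_imp_inverse_le) auto
      then show "?A i \<subseteq> ?A j"
        by (intro Int_mono order_refl) (simp only: greaterThan_subset_iff)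
    qed
    show "set_integrable \<nu> (\<Union>n. ?A n) (\<lambda>y. iexp (z * y) - 1)"
      unfolding U by (rule integrable_levy_exponent) (use assms in auto)
  qed auto
  then show ?thesis unfolding U .
qed

text \<open>
  The factor \<open>c\<close> allows the intensity to be divided among several identical factors.
\<close>

lemma compound_poisson_part:
  assumes [measurable]: "B \<in> sets borel" and "B \<subseteq> {d<..}" "0 < d" "0 < c"
  shows "\<exists>N. half_line_distribution N \<and>
    (\<forall>t. char N t = exp (c *\<^sub>R (CLINT y:B|\<nu>. iexp (t * y) - 1))) \<and>
    ennreal (exp (- c * measure \<nu> B)) \<le> emeasure N {0} \<and>
    (\<forall>f\<in>borel_measurable borel. (\<integral>\<^sup>+x. f x * ennreal x \<partial>N) =
      (\<integral>\<^sup>+x. ennreal c * (\<integral>\<^sup>+y\<in>B. f (x + y) * ennreal y \<partial>\<nu>) \<partial>N))"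
proof -
  define m where "m = density \<nu> (\<lambda>y. ennreal (c * indicator B y))"
  have s[measurable_cong]: "sets m = sets borel" by (simp add: m_def)
  have em: "emeasure m A = ennreal c * emeasure \<nu> (B \<inter> A)" if [measurable]: "A \<in> sets borel" for A
  proof -
    have "emeasure m A = (\<integral>\<^sup>+y. ennreal c * indicator (B \<inter> A) y \<partial>\<nu>)"
      unfolding m_def by (subst emeasure_density) (auto intro!: nn_integral_cong simp: indicator_def)
    also have "\<dots> = ennreal c * emeasure \<nu> (B \<inter> A)" by (subst nn_integral_cmult) auto
    finally show ?thesis .
  qed
  have fB: "emeasure \<nu> B < \<infinity>"
    using finite_tail[OF assms(3)] emeasure_mono[OF assms(2), of \<nu>] by (auto intro: le_less_trans)
  have fin: "finite_measure m"
    by (rule finite_measureI) (use fB in \<open>auto simp: em m_def[THEN arg_cong, of space, simplified] ennreal_mult_eq_top_iff\<close>)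
  have m0: "emeasure m {..<0} = 0"
  proof -
    have "B \<inter> {..<0} = {}" using assms(2,3) by force
    then show ?thesis by (simp add: em)
  qed
  have meas: "measure m UNIV = c * measure \<nu> B"
    using em[of UNIV] assms(4) unfolding measure_def by (simp add: enn2real_mult)
  have li: "(CLINT y|m. iexp (t * y) - 1) = c *\<^sub>R (CLINT y:B|\<nu>. iexp (t * y) - 1)" for t
  proof -
    have "(CLINT y|m. iexp (t * y) - 1) = (CLINT y|\<nu>. (c * indicator B y) *\<^sub>R (iexp (t * y) - 1))"
      unfolding m_def by (rule integral_density) (use assms(4) in auto)
    also have "\<dots> = c *\<^sub>R (CLINT y:B|\<nu>. iexp (t * y) - 1)"
      unfolding set_lebesgue_integral_def by (subst integral_scaleR_right[symmetric]) simp
    finally show ?thesis .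
  qed
  have nn: "(\<integral>\<^sup>+y. f (x + y) * ennreal y \<partial>m) = ennreal c * (\<integral>\<^sup>+y\<in>B. f (x + y) * ennreal y \<partial>\<nu>)"
    if [measurable]: "f \<in> borel_measurable borel" for f x
  proof -
    have "(\<integral>\<^sup>+y. f (x + y) * ennreal y \<partial>m) = (\<integral>\<^sup>+y. ennreal (c * indicator B y) * (f (x + y) * ennreal y) \<partial>\<nu>)"
      unfolding m_def by (rule nn_integral_density) auto
    also have "\<dots> = (\<integral>\<^sup>+y. ennreal c * (f (x + y) * ennreal y * indicator B y) \<partial>\<nu>)"
      by (intro nn_integral_cong) (auto simp: indicator_def)
    also have "\<dots> = ennreal c * (\<integral>\<^sup>+y\<in>B. f (x + y) * ennreal y \<partial>\<nu>)"
      by (rule nn_integral_cmult) auto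
    finally show ?thesis .
  qed
  obtain N where N: "half_line_distribution N"
      "\<And>t. char N t = exp (CLINT y|m. iexp (t * y) - 1)"
      "ennreal (exp (- measure m UNIV)) \<le> emeasure N {0}"
      "\<And>f. f \<in> borel_measurable borel \<Longrightarrow> (\<integral>\<^sup>+x. f x * ennreal x \<partial>N) =
        (\<integral>\<^sup>+x. \<integral>\<^sup>+y. f (x + y) * ennreal y \<partial>m \<partial>N)"
    using compound_poisson_exists[OF s fin m0] by blast
  show ?thesis
  proof (intro exI[of _ N] conjI allI ballI N(1))
    show "char N t = exp (c *\<^sub>R (CLINT y:B|\<nu>. iexp (t * y) - 1))" for t
      unfolding N(2) li ..
    show "ennreal (exp (- c * measure \<nu> B)) \<le> emeasure N {0}"
      using N(3) by (simp add: meas)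
    show "(\<integral>\<^sup>+x. f x * ennreal x \<partial>N) =
      (\<integral>\<^sup>+x. ennreal c * (\<integral>\<^sup>+y\<in>B. f (x + y) * ennreal y \<partial>\<nu>) \<partial>N)"
      if "f \<in> borel_measurable borel" for f
      unfolding N(4)[OF that] nn[OF that] ..
  qed
qed

lemma truncated_compound_poisson:
  assumes [measurable]: "B \<in> sets borel"
  shows "\<exists>N. \<forall>n. half_line_distribution (N n) \<and>
    (\<forall>t. char (N n) t = exp (CLINT y:(B \<inter> {inverse (real (Suc n))<..})|\<nu>. iexp (t * y) - 1)) \<and>
    (\<forall>f\<in>borel_measurable borel. (\<integral>\<^sup>+x. f x * ennreal x \<partial>N n) =
      (\<integral>\<^sup>+x. (\<integral>\<^sup>+y\<in>(B \<inter> {inverse (real (Suc n))<..}). f (x + y) * ennreal y \<partial>\<nu>) \<partial>N n))"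
proof (rule choice, rule allI)
  fix n
  have "\<exists>N. half_line_distribution N \<and>
    (\<forall>t. char N t = exp (1 *\<^sub>R (CLINT y:(B \<inter> {inverse (real (Suc n))<..})|\<nu>. iexp (t * y) - 1))) \<and>
    ennreal (exp (- 1 * measure \<nu> (B \<inter> {inverse (real (Suc n))<..}))) \<le> emeasure N {0} \<and>
    (\<forall>f\<in>borel_measurable borel. (\<integral>\<^sup>+x. f x * ennreal x \<partial>N) =
      (\<integral>\<^sup>+x. ennreal 1 * (\<integral>\<^sup>+y\<in>(B \<inter> {inverse (real (Suc n))<..}). f (x + y) * ennreal y \<partial>\<nu>) \<partial>N))"
    by (rule compound_poisson_part[where d="inverse (real (Suc n))"]) auto
  then show "\<exists>N. half_line_distribution N \<and>
    (\<forall>t. char N t = exp (CLINT y:(B \<inter> {inverse (real (Suc n))<..})|\<nu>. iexp (t * y) - 1)) \<and>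
    (\<forall>f\<in>borel_measurable borel. (\<integral>\<^sup>+x. f x * ennreal x \<partial>N) =
      (\<integral>\<^sup>+x. (\<integral>\<^sup>+y\<in>(B \<inter> {inverse (real (Suc n))<..}). f (x + y) * ennreal y \<partial>\<nu>) \<partial>N))"
    by (simp only: scaleR_one ennreal_1 mult_1) blast
qed

text \<open>
  The compound Poisson laws with the jumps in \<open>(1 / (n + 1), \<epsilon>]\<close> have means bounded by
  \<open>\<integral> y \<nu>(dy)\<close> over \<open>(0, \<epsilon>]\<close>, by the size-bias identity with \<open>f = 1\<close>. They are therefore tight, and any weak limit
  point has the required characteristic function and inherits the Markov bound for its tail.
\<close>

lemma small_jumps_exists:
  assumes "0 < \<epsilon>"
  shows "\<exists>M. half_line_distribution M \<and> (\<forall>t. char M t = exp (CLINT y:{0<..\<epsilon>}|\<nu>. iexp (t * y) - 1)) \<and>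
    (\<forall>\<eta>>0. ennreal \<eta> * emeasure M {\<eta><..} \<le> (\<integral>\<^sup>+y\<in>{0<..\<epsilon>}. ennreal y \<partial>\<nu>))"
proof -
  define B where "B n = {0<..\<epsilon>} \<inter> {inverse (real (Suc n))<..}" for n
  have [measurable]: "B n \<in> sets borel" for n by (simp add: B_def)
  obtain N where N: "\<And>n. half_line_distribution (N n)"
      "\<And>n t. char (N n) t = exp (CLINT y:B n|\<nu>. iexp (t * y) - 1)"
      "\<And>n f. f \<in> borel_measurable borel \<Longrightarrow> (\<integral>\<^sup>+x. f x * ennreal x \<partial>N n) =
        (\<integral>\<^sup>+x. (\<integral>\<^sup>+y\<in>B n. f (x + y) * ennreal y \<partial>\<nu>) \<partial>N n)"
    using truncated_compound_poisson[of "{0<..\<epsilon>}"] unfolding B_def by auto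
  interpret N: real_distribution "N n" for n by (rule half_line_distributionD[OF N(1)])
  define J where "J = (\<integral>\<^sup>+y\<in>{0<..\<epsilon>}. ennreal y \<partial>\<nu>)"
  define j where "j = enn2real J"
  have J: "J = ennreal j" "0 \<le> j"
    using finite_small[of \<epsilon>] by (auto simp: J_def j_def)
  have mean: "(\<integral>\<^sup>+x. ennreal x \<partial>N n) \<le> J" for n
  proof -
    have "(\<integral>\<^sup>+x. ennreal x \<partial>N n) = (\<integral>\<^sup>+x. (\<integral>\<^sup>+y\<in>B n. ennreal y \<partial>\<nu>) \<partial>N n)"
      using N(3)[of "\<lambda>_. 1" n] by simp
    also have "\<dots> \<le> (\<integral>\<^sup>+x. J \<partial>N n)"
      unfolding J_def by (intro nn_integral_mono) (auto simp: B_def indicator_def)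
    also have "\<dots> = J" by (simp add: N.emeasure_space_1[simplified])
    finally show ?thesis .
  qed
  have tail: "measure (N n) {b<..} \<le> j / b" if "0 < b" for n b
  proof -
    have "ennreal b * emeasure (N n) {b<..} = (\<integral>\<^sup>+x. ennreal b * indicator {b<..} x \<partial>N n)"
      by (subst nn_integral_cmult_indicator) auto
    also have "\<dots> \<le> (\<integral>\<^sup>+x. ennreal x \<partial>N n)"
      by (intro nn_integral_mono) (auto simp: indicator_def intro!: ennreal_leI)
    also have "\<dots> \<le> ennreal j" using mean J by simp
    finally show ?thesis
      using that J(2) by (simp add: N.emeasure_eq_measure ennreal_mult[symmetric] field_simps)
  qed
  have "tight N"
    unfolding tight_def
  proof (intro conjI allI impI)
    show "real_distribution (N n)" for n by (rule half_line_distributionD[OF N(1)])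
    fix e :: real assume "0 < e"
    define b where "b = j / e + 1"
    have b: "0 < b" "j / b < e"
      using J(2) \<open>0 < e\<close> by (auto simp: b_def field_simps intro: add_nonneg_pos)
    have "1 - e < measure (N n) {-1<..b}" for n
    proof -
      have "AE x in N n. x \<in> {-1<..b} \<union> {b<..}"
        using half_line_distributionD(7)[OF N(1)[of n]] by (rule eventually_mono) auto
      then have "1 = measure (N n) ({-1<..b} \<union> {b<..})"
        by (subst N.prob_eq_1[THEN iffD2]) auto
      also have "\<dots> \<le> measure (N n) {-1<..b} + measure (N n) {b<..}"
        by (rule measure_subadditive) (auto simp: N.emeasure_eq_measure)
      finally show ?thesis using tail[OF b(1), of n] b(2) by linarith
    qed
    then show "\<exists>win b. win < b \<and> (\<forall>n. 1 - e < measure (N n) {win<..b})"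
      using b(1) by (intro exI[of _ "-1"] exI[of _ b]) auto
  qed
  then obtain r M where r: "strict_mono (r :: nat \<Rightarrow> nat)" and M: "real_distribution M" and weak: "weak_conv_m (N \<circ> id \<circ> r) M"
    using tight_imp_convergent_subsubsequence[of N id] by (auto simp: id_def strict_mono_def)
  interpret M: real_distribution M by (rule M)
  have real_N: "real_distribution ((N \<circ> id \<circ> r) n)" for n
    using half_line_distributionD(1)[OF N(1)] by simp
  have conv: "(\<lambda>n. LINT x|N (r n). f x) \<longlonglongrightarrow> (LINT x|M. f x)"
    if "\<And>x. isCont f x" "\<And>x. \<bar>f x\<bar> \<le> b" for f :: "real \<Rightarrow> real" and b
    using weak_conv_imp_integral_bdd_continuous_conv[OF real_N M weak, of f b] that by simp
  have "char M t = exp (CLINT y:{0<..\<epsilon>}|\<nu>. iexp (t * y) - 1)" for t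
  proof (rule LIMSEQ_unique)
    show "(\<lambda>n. char ((N \<circ> id \<circ> r) n) t) \<longlonglongrightarrow> char M t"
      by (rule levy_continuity1[OF real_N M weak])
    have "(\<lambda>n. CLINT y:B n|\<nu>. iexp (t * y) - 1) \<longlonglongrightarrow> (CLINT y:{0<..\<epsilon>}|\<nu>. iexp (t * y) - 1)"
      unfolding B_def by (rule levy_exponent_limit) auto
    from LIMSEQ_subseq_LIMSEQ[OF this r]
    have "(\<lambda>n. CLINT y:B (r n)|\<nu>. iexp (t * y) - 1) \<longlonglongrightarrow> (CLINT y:{0<..\<epsilon>}|\<nu>. iexp (t * y) - 1)"
      unfolding o_def .
    then show "(\<lambda>n. char ((N \<circ> id \<circ> r) n) t) \<longlonglongrightarrow> exp (CLINT y:{0<..\<epsilon>}|\<nu>. iexp (t * y) - 1)"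
      unfolding o_def id_def N(2) by (rule tendsto_exp)
  qed
  moreover have "half_line_distribution M"
  proof (rule half_line_distributionI[OF M])
    let ?f = "\<lambda>x::real. min 1 (max 0 (- x))"
    have "(\<lambda>n. LINT x|N (r n). ?f x) \<longlonglongrightarrow> (LINT x|M. ?f x)"
      by (rule conv[of _ 1]) (auto intro!: continuous_intros)
    moreover have "(LINT x|N (r n). ?f x) = 0" for n
    proof -
      have "(LINT x|N (r n). ?f x) = (LINT x|N (r n). 0)"
        by (rule integral_cong_AE)
          (use half_line_distributionD(7)[OF N(1)[of "r n"]] in \<open>auto elim!: eventually_mono\<close>)
      then show ?thesis by simp
    qed
    ultimately have "(LINT x|M. ?f x) = 0" by (simp add: LIMSEQ_const_iff)
    moreover have "integrable M ?f"
      by (rule M.integrable_const_bound[of _ 1]) auto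
    ultimately have "AE x in M. ?f x = 0"
      by (subst (asm) integral_nonneg_eq_0_iff_AE) auto
    then show "AE x in M. 0 \<le> x" by (rule eventually_mono) (auto simp: min_def max_def split: if_splits)
  qed
  moreover have "ennreal \<eta> * emeasure M {\<eta><..} \<le> J" if "0 < \<eta>" for \<eta>
  proof -
    let ?f = "\<lambda>x::real. min \<eta> (max 0 x)"
    have int: "integrable P ?f" if "real_distribution P" for P
    proof -
      interpret P: real_distribution P by fact
      show ?thesis by (rule P.integrable_const_bound[of _ \<eta>]) (use \<open>0 < \<eta>\<close> in auto)
    qed
    have "(\<lambda>n. LINT x|N (r n). ?f x) \<longlonglongrightarrow> (LINT x|M. ?f x)"
      by (rule conv[of _ \<eta>]) (use that in \<open>auto intro!: continuous_intros\<close>)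
    moreover have "(LINT x|N (r n). ?f x) \<le> j" for n
    proof -
      have "ennreal (LINT x|N (r n). ?f x) = (\<integral>\<^sup>+x. ennreal (?f x) \<partial>N (r n))"
        by (rule nn_integral_eq_integral[symmetric])
          (use int half_line_distributionD(1)[OF N(1)] that in auto)
      also have "\<dots> \<le> (\<integral>\<^sup>+x. ennreal x \<partial>N (r n))"
        by (intro nn_integral_mono) (metis ennreal_leI ennreal_max_0 max.commute min.cobounded2)
      also have "\<dots> \<le> ennreal j" using mean J by simp
      finally show ?thesis using J(2) by simp
    qed
    ultimately have le: "(LINT x|M. ?f x) \<le> j" by (intro LIMSEQ_le_const2) auto
    have "ennreal \<eta> * emeasure M {\<eta><..} = (\<integral>\<^sup>+x. ennreal \<eta> * indicator {\<eta><..} x \<partial>M)"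
      by (subst nn_integral_cmult_indicator) auto
    also have "\<dots> \<le> (\<integral>\<^sup>+x. ennreal (?f x) \<partial>M)"
      by (intro nn_integral_mono) (auto simp: indicator_def)
    also have "\<dots> = ennreal (LINT x|M. ?f x)"
      by (rule nn_integral_eq_integral) (use int[OF M] that in auto)
    also have "\<dots> \<le> J" unfolding J using le by (rule ennreal_leI)
    finally show ?thesis .
  qed
  ultimately show ?thesis unfolding J_def by blast
qed

section \<open>Steutel's size-bias identity\<close>

text \<open>
  The identity holds for the compound Poisson approximations of \<open>\<mu>\<close>. As \<open>f\<close> vanishes to the right of \<open>R\<close>,
  both sides are integrals of bounded continuous functions up to an error \<open>b \<integral> y \<nu>(dy)\<close> over the small jumps
  that were cut off, so that the identity passes to the weak limit.
\<close>

lemma size_bias_continuous: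
  assumes \<mu>: "half_line_distribution \<mu>" and ch: "\<And>t. char \<mu> t = exp (CLINT y:{0<..}|\<nu>. iexp (t * y) - 1)"
    and f: "\<And>x. isCont f x" "\<And>x. 0 \<le> f x" "\<And>x. f x \<le> b" "\<And>x. R < x \<Longrightarrow> f x = 0"
  shows "(\<integral>\<^sup>+x. ennreal (f x) * ennreal x \<partial>\<mu>) = (\<integral>\<^sup>+x. \<integral>\<^sup>+y. ennreal (f (x + y)) * ennreal y \<partial>\<nu> \<partial>\<mu>)"
proof -
  have f_meas [measurable]: "f \<in> borel_measurable borel"
    by (intro borel_measurable_continuous_onI continuous_at_imp_continuous_on) (use f in auto)
  have b: "0 \<le> b" using f(2,3)[of 0] by linarith
  define B where "B n = {0<..} \<inter> {inverse (real (Suc n))<..}" for n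
  have [measurable]: "B n \<in> sets borel" for n by (simp add: B_def)
  obtain N where N: "\<And>n. half_line_distribution (N n)"
      "\<And>n t. char (N n) t = exp (CLINT y:B n|\<nu>. iexp (t * y) - 1)"
      "\<And>n f. f \<in> borel_measurable borel \<Longrightarrow> (\<integral>\<^sup>+x. f x * ennreal x \<partial>N n) =
        (\<integral>\<^sup>+x. (\<integral>\<^sup>+y\<in>B n. f (x + y) * ennreal y \<partial>\<nu>) \<partial>N n)"
    using truncated_compound_poisson[of "{0<..}"] unfolding B_def by auto
  note D = half_line_distributionD[OF \<mu>]
  interpret N: real_distribution "N n" for n by (rule half_line_distributionD[OF N(1)])
  interpret \<mu>: real_distribution \<mu> by (rule D)
  have weak: "weak_conv_m N \<mu>"
  proof (rule levy_continuity)
    show "(\<lambda>n. char (N n) t) \<longlonglongrightarrow> char \<mu> t" for t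
      unfolding N(2) ch B_def by (intro tendsto_exp levy_exponent_limit) auto
  qed (use half_line_distributionD(1)[OF N(1)] D in auto)
  have conv: "(\<lambda>n. LINT x|N n. h x) \<longlonglongrightarrow> (LINT x|\<mu>. h x)"
    if "\<And>x. isCont h x" "\<And>x. \<bar>h x\<bar> \<le> c" for h :: "real \<Rightarrow> real" and c
    using weak_conv_imp_integral_bdd_continuous_conv[OF half_line_distributionD(1)[OF N(1)] D(1) weak, of h c] that by simp
  define w where "w y = indicator {0<..R} y * y" for y :: real
  have [measurable]: "w \<in> borel_measurable borel" by (simp add: w_def[abs_def])
  have w0: "0 \<le> w y" for y by (auto simp: w_def indicator_def)
  have int_w: "integrable \<nu> w"
  proof (rule integrableI_nonneg)
    have "(\<integral>\<^sup>+y. ennreal (w y) \<partial>\<nu>) = (\<integral>\<^sup>+y\<in>{0<..R}. ennreal y \<partial>\<nu>)"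
      by (intro nn_integral_cong) (auto simp: w_def indicator_def)
    then show "(\<integral>\<^sup>+y. ennreal (w y) \<partial>\<nu>) < \<infinity>" using finite_small by simp
  qed (auto simp: w0)
  define g where "g x = f x * max 0 x" for x
  (* The truncation max 0 x keeps F bounded: for negative x large jumps would matter. *)
  define F where "F x = (LINT y|\<nu>. f (max 0 x + y) * w y)" for x
  define wn where "wn n y = w y * indicator {..inverse (real (Suc n))} y" for n y
  define E where "E n = (LINT y|\<nu>. wn n y)" for n
  have [measurable]: "wn n \<in> borel_measurable borel" for n by (simp add: wn_def[abs_def])
  have wn0: "0 \<le> wn n y" "wn n y \<le> w y" for n y using w0 by (auto simp: wn_def indicator_def)
  have int_wn: "integrable \<nu> (wn n)" for n
    by (rule Bochner_Integration.integrable_bound[OF int_w]) (use w0 wn0 in \<open>auto intro!: AE_I2\<close>)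
  have int_f: "integrable \<nu> (\<lambda>y. f (x + y) * w y)" for x
    by (rule Bochner_Integration.integrable_bound[OF integrable_mult_right[OF int_w, of b]])
      (use f w0 b in \<open>auto intro!: AE_I2 mult_right_mono simp: abs_mult\<close>)
  have F_nn: "ennreal (F x) = (\<integral>\<^sup>+y. ennreal (f (x + y)) * ennreal y \<partial>\<nu>)" if "0 \<le> x" for x
  proof -
    have "ennreal (F x) = (\<integral>\<^sup>+y. ennreal (f (x + y) * w y) \<partial>\<nu>)"
      unfolding F_def using that int_f f w0 by (subst nn_integral_eq_integral) (auto simp: max_def)
    also have "\<dots> = (\<integral>\<^sup>+y. ennreal (f (x + y)) * ennreal y \<partial>\<nu>)"
      by (rule nn_integral_cong_AE, use AE_pos in eventually_elim)
        (use that f(2,4) in \<open>auto simp: w_def ennreal_mult[symmetric] indicator_def\<close>)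
    finally show ?thesis .
  qed
  have F_cont: "isCont F x" for x
  proof (unfold continuous_at_sequentially, intro allI impI)
    fix u assume u: "u \<longlonglongrightarrow> x"
    show "(F \<circ> u) \<longlonglongrightarrow> F x"
      unfolding F_def o_def
    proof (rule integral_dominated_convergence[where w="\<lambda>y. b * w y"])
      show "AE y in \<nu>. (\<lambda>n. f (max 0 (u n) + y) * w y) \<longlonglongrightarrow> f (max 0 x + y) * w y"
        by (intro AE_I2 tendsto_mult tendsto_const isCont_tendsto_compose[OF f(1)] tendsto_add tendsto_max u)
      show "AE y in \<nu>. norm (f (max 0 (u n) + y) * w y) \<le> b * w y" for n
        using f w0 by (auto intro!: AE_I2 mult_right_mono simp: abs_mult)
      show "integrable \<nu> (\<lambda>y. b * w y)" using int_w by auto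
    qed auto
  qed
  have F0: "0 \<le> F x" for x unfolding F_def using f w0 by (intro Bochner_Integration.integral_nonneg) auto
  have F_bdd: "\<bar>F x\<bar> \<le> b * integral\<^sup>L \<nu> w" for x
  proof -
    have "F x \<le> (LINT y|\<nu>. b * w y)"
      unfolding F_def using int_w int_f f w0 by (intro integral_mono mult_right_mono) auto
    then show ?thesis using F0 by simp
  qed
  have g_cont: "isCont g x" for x
    unfolding g_def by (intro continuous_intros f(1))
  have g0: "0 \<le> g x" for x unfolding g_def using f by auto
  have g_bdd: "\<bar>g x\<bar> \<le> b * max 0 R" for x
    using g0[of x] f(2-4)[of x] b unfolding g_def by (cases "x \<le> R") (auto intro!: mult_mono)
  have [measurable]: "g \<in> borel_measurable borel" "F \<in> borel_measurable borel"
    by (intro borel_measurable_continuous_onI continuous_at_imp_continuous_on; use g_cont F_cont in auto)+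
  have int_F: "integrable P F" and int_g: "integrable P g" if "real_distribution P" for P
  proof -
    interpret P: real_distribution P by fact
    show "integrable P F" by (rule P.integrable_const_bound[of _ "b * integral\<^sup>L \<nu> w"]) (use F_bdd in auto)
    show "integrable P g" by (rule P.integrable_const_bound[of _ "b * max 0 R"]) (use g_bdd in auto)
  qed
  have E_lim: "E \<longlonglongrightarrow> 0"
  proof -
    have "E \<longlonglongrightarrow> (LINT y|\<nu>. 0)"
      unfolding E_def
    proof (rule integral_dominated_convergence[where w=w])
      show "AE y in \<nu>. (\<lambda>n. wn n y) \<longlonglongrightarrow> 0"
        using AE_pos
      proof eventually_elim
        case (elim y)
        have "\<forall>\<^sub>F n in sequentially. inverse (real (Suc n)) < y"
          using order_tendstoD(2)[OF LIMSEQ_inverse_real_of_nat elim] .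
        then have "\<forall>\<^sub>F n in sequentially. wn n y = 0"
          by eventually_elim (auto simp: wn_def)
        then show ?case by (rule tendsto_eventually)
      qed
    qed (use int_w wn0 in auto)
    then show ?thesis by simp
  qed
  have E0: "0 \<le> E n" for n unfolding E_def using wn0 by (intro Bochner_Integration.integral_nonneg) auto
  have E_nn: "ennreal (E n) = (\<integral>\<^sup>+y. ennreal (wn n y) \<partial>\<nu>)" for n
    unfolding E_def by (rule nn_integral_eq_integral[symmetric]) (use wn0 int_wn in auto)
  have g_ennreal: "ennreal (g x) = ennreal (f x) * ennreal x" for x
    using f(2)[of x] by (cases "0 \<le> x") (auto simp: g_def ennreal_mult ennreal_neg)
  have g_nn: "ennreal (LINT x|N n. g x) = (\<integral>\<^sup>+x. (\<integral>\<^sup>+y\<in>B n. ennreal (f (x + y)) * ennreal y \<partial>\<nu>) \<partial>N n)" for n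
  proof -
    have "ennreal (LINT x|N n. g x) = (\<integral>\<^sup>+x. ennreal (g x) \<partial>N n)"
      by (rule nn_integral_eq_integral[symmetric]) (use int_g half_line_distributionD(1)[OF N(1)] g0 in auto)
    also have "\<dots> = (\<integral>\<^sup>+x. (\<integral>\<^sup>+y\<in>B n. ennreal (f (x + y)) * ennreal y \<partial>\<nu>) \<partial>N n)"
      unfolding g_ennreal by (rule N(3)) simp
    finally show ?thesis .
  qed
  have F_nn_int: "(\<integral>\<^sup>+x. ennreal (F x) \<partial>N n) = ennreal (LINT x|N n. F x)" for n
    by (rule nn_integral_eq_integral) (use int_F half_line_distributionD(1)[OF N(1)] F0 in auto)
  have gF: "(LINT x|N n. g x) \<le> (LINT x|N n. F x)" for n
  proof -
    have "ennreal (LINT x|N n. g x) \<le> (\<integral>\<^sup>+x. ennreal (F x) \<partial>N n)"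
      unfolding g_nn
    proof (rule nn_integral_mono_AE, use half_line_distributionD(7)[OF N(1)[of n]] in eventually_elim)
      case (elim x)
      then show ?case
        unfolding F_nn[OF elim] by (intro nn_integral_mono) (auto simp: indicator_def)
    qed
    then show ?thesis using F0 by (simp add: F_nn_int Bochner_Integration.integral_nonneg)
  qed
  have Fg: "(LINT x|N n. F x) \<le> (LINT x|N n. g x) + b * E n" for n
  proof -
    have pw: "ennreal (F x) \<le> (\<integral>\<^sup>+y\<in>B n. ennreal (f (x + y)) * ennreal y \<partial>\<nu>) + ennreal (b * E n)" if x: "0 \<le> x" for x
    proof -
      have "ennreal (F x) = (\<integral>\<^sup>+y. ennreal (f (x + y)) * ennreal y \<partial>\<nu>)" by (rule F_nn[OF x])
      also have "\<dots> \<le> (\<integral>\<^sup>+y. ennreal (f (x + y)) * ennreal y * indicator (B n) y + ennreal b * ennreal (wn n y) \<partial>\<nu>)"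
      proof (rule nn_integral_mono_AE, use AE_pos in eventually_elim)
        case (elim y)
        show ?case
        proof (cases "y \<in> B n \<or> R < x + y")
          case True
          then show ?thesis using f(4)[of "x + y"] by (auto simp: indicator_def)
        next
          case False
          then have "wn n y = y" using elim x by (auto simp: wn_def w_def B_def not_less)
          moreover have "ennreal (f (x + y)) * ennreal y \<le> ennreal b * ennreal y"
            using f(3) by (intro mult_right_mono ennreal_leI) auto
          ultimately show ?thesis by (simp add: add_increasing)
        qed
      qed
      also have "\<dots> = (\<integral>\<^sup>+y\<in>B n. ennreal (f (x + y)) * ennreal y \<partial>\<nu>) + ennreal b * ennreal (E n)"
        unfolding E_nn by (subst nn_integral_add) (auto simp: nn_integral_cmult)
      finally show ?thesis using b E0 by (simp add: ennreal_mult)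
    qed
    have "ennreal (LINT x|N n. F x) = (\<integral>\<^sup>+x. ennreal (F x) \<partial>N n)"
      by (rule F_nn_int[symmetric])
    also have "\<dots> \<le> (\<integral>\<^sup>+x. (\<integral>\<^sup>+y\<in>B n. ennreal (f (x + y)) * ennreal y \<partial>\<nu>) + ennreal (b * E n) \<partial>N n)"
      by (rule nn_integral_mono_AE, use half_line_distributionD(7)[OF N(1)[of n]] in eventually_elim) (rule pw)
    also have "\<dots> = ennreal (LINT x|N n. g x) + ennreal (b * E n)"
      unfolding g_nn by (subst nn_integral_add) (auto simp: N.emeasure_space_1[simplified])
    finally show ?thesis using b E0 g0
      by (simp add: ennreal_plus[symmetric] Bochner_Integration.integral_nonneg del: ennreal_plus)
  qed
  have "(LINT x|\<mu>. g x) = (LINT x|\<mu>. F x)"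
  proof (rule antisym)
    show "(LINT x|\<mu>. g x) \<le> (LINT x|\<mu>. F x)"
      by (rule LIMSEQ_le[OF conv[OF g_cont g_bdd] conv[OF F_cont F_bdd]]) (use gF in auto)
    have "(\<lambda>n. (LINT x|N n. g x) + b * E n) \<longlonglongrightarrow> (LINT x|\<mu>. g x) + b * 0"
      by (intro tendsto_intros conv[OF g_cont g_bdd] E_lim)
    then show "(LINT x|\<mu>. F x) \<le> (LINT x|\<mu>. g x)"
      using Fg by (intro LIMSEQ_le[OF conv[OF F_cont F_bdd]]) auto
  qed
  then have "(\<integral>\<^sup>+x. ennreal (g x) \<partial>\<mu>) = (\<integral>\<^sup>+x. ennreal (F x) \<partial>\<mu>)"
    using int_F[OF D(1)] int_g[OF D(1)] g0 F0 by (simp add: nn_integral_eq_integral)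
  moreover have "(\<integral>\<^sup>+x. ennreal (F x) \<partial>\<mu>) = (\<integral>\<^sup>+x. \<integral>\<^sup>+y. ennreal (f (x + y)) * ennreal y \<partial>\<nu> \<partial>\<mu>)"
    by (rule nn_integral_cong_AE, use D(7) in eventually_elim) (rule F_nn)
  ultimately show ?thesis by (simp add: g_ennreal)
qed

end

text \<open>
  A nonempty open set is not a null set.
\<close>

lemma continuous_AE_zero:
  fixes h :: "real \<Rightarrow> real"
  assumes cont: "\<And>x. isCont h x" and "open U" and ae: "AE x in lborel. x \<in> U \<longrightarrow> h x = 0" and "x \<in> U"
  shows "h x = 0"
proof (rule ccontr)
  assume "h x \<noteq> 0"
  have [measurable]: "h \<in> borel_measurable borel"
    by (intro borel_measurable_continuous_onI continuous_at_imp_continuous_on) (use cont in auto)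
  have [measurable]: "U \<in> sets borel" using \<open>open U\<close> by simp
  have "open (h -` (- {0}))"
    by (intro open_vimage continuous_at_imp_continuous_on) (use cont in auto)
  then have "open (h -` (- {0}) \<inter> U)" using \<open>open U\<close> by auto
  moreover have "x \<in> h -` (- {0}) \<inter> U" using assms(4) \<open>h x \<noteq> 0\<close> by auto
  ultimately have "\<not> negligible (h -` (- {0}) \<inter> U)" by (intro open_not_negligible) auto
  moreover have "h -` (- {0}) \<inter> U \<in> null_sets lborel"
  proof (rule AE_iff_null_sets[THEN iffD2])
    show "h -` (- {0}) \<inter> U \<in> sets lborel"
      using \<open>open (h -` (- {0}) \<inter> U)\<close> by simp
    show "AE x in lborel. x \<notin> h -` (- {0}) \<inter> U" using ae by eventually_elim auto
  qed
  ultimately show False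
    by (auto simp: negligible_iff_null_sets intro: null_sets_completionI)
qed

lemma density_zero_nonpos:
  assumes p: "continuous_on UNIV p" "\<And>x. 0 \<le> p x"
    and \<mu>: "half_line_distribution (density lborel (\<lambda>x. ennreal (p x)))" and "x \<le> 0"
  shows "p x = (0::real)"
proof -
  have cont: "isCont p x" for x using p(1) by (simp add: continuous_on_eq_continuous_at)
  have [measurable]: "p \<in> borel_measurable borel" by (rule borel_measurable_continuous_onI[OF p(1)])
  have "AE x in lborel. 0 < ennreal (p x) \<longrightarrow> 0 \<le> x"
    using half_line_distributionD(7)[OF \<mu>] by (simp add: AE_density)
  then have ae: "AE x in lborel. x \<in> {..<0} \<longrightarrow> p x = 0"
    by (rule eventually_mono) (use p(2) in \<open>auto simp: less_le\<close>)
  have neg: "p x = 0" if "x < 0" for x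
    using continuous_AE_zero[OF cont _ ae] that by auto
  show ?thesis
  proof (cases "x < 0")
    case False
    then have "x = 0" using \<open>x \<le> 0\<close> by simp
    have "(p \<longlongrightarrow> p 0) (at_left 0)" using cont[of 0] by (simp add: isCont_def filterlim_at_split)
    moreover have "(p \<longlongrightarrow> 0) (at_left 0)"
      by (rule tendsto_eventually) (use neg in \<open>auto simp: eventually_at_filter\<close>)
    ultimately show ?thesis using \<open>x = 0\<close> by (intro tendsto_unique[of "at_left (0::real)"]) auto
  qed (rule neg)
qed

context levy_measure
begin

text \<open>
  Tested against a continuous function with compact support, both sides agree by the size-bias identity and Tonelli's
  theorem. Both are continuous functions of \<open>x\<close>, the right one by dominated convergence because only
  \<open>y \<le> x\<close> matters and \<open>y\<close> is integrable near zero; a tent concentrated where they differ would give a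
  contradiction.
\<close>

lemma steutel_identity:
  assumes \<mu>: "half_line_distribution \<mu>" and ch: "\<And>t. char \<mu> t = exp (CLINT y:{0<..}|\<nu>. iexp (t * y) - 1)"
    and p: "continuous_on UNIV p" "\<And>x. 0 \<le> p x" and dens: "\<mu> = density lborel (\<lambda>x. ennreal (p x))"
  shows "ennreal (x * p x) = (\<integral>\<^sup>+y. ennreal (p (x - y)) * ennreal y \<partial>\<nu>)"
proof -
  have cont: "isCont p x" for x using p(1) by (simp add: continuous_on_eq_continuous_at)
  have [measurable]: "p \<in> borel_measurable borel" by (rule borel_measurable_continuous_onI[OF p(1)])
  have zero: "p x = 0" if "x \<le> 0" for x
    using density_zero_nonpos[OF p \<mu>[unfolded dens] that] .
  (* Near x the integral only sees y below R, and min R t makes F bounded and continuous everywhere. *)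
  define R where "R = x + 1"
  define w where "w y = indicator {0<..R} y * y" for y :: real
  have [measurable]: "w \<in> borel_measurable borel" by (simp add: w_def[abs_def])
  have w0: "0 \<le> w y" for y by (auto simp: w_def indicator_def)
  have int_w: "integrable \<nu> w"
  proof (rule integrableI_nonneg)
    have "(\<integral>\<^sup>+y. ennreal (w y) \<partial>\<nu>) = (\<integral>\<^sup>+y\<in>{0<..R}. ennreal y \<partial>\<nu>)"
      by (intro nn_integral_cong) (auto simp: w_def indicator_def)
    then show "(\<integral>\<^sup>+y. ennreal (w y) \<partial>\<nu>) < \<infinity>" using finite_small by simp
  qed (auto simp: w0)
  have "bounded (p ` {0..max 0 R})"
    by (intro compact_imp_bounded compact_continuous_image) (use p(1) in \<open>auto intro: continuous_on_subset\<close>)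
  then obtain b where "0 < b" "\<forall>u\<in>p ` {0..max 0 R}. norm u \<le> b"
    unfolding bounded_pos by blast
  then have b: "\<And>s. s \<in> {0..max 0 R} \<Longrightarrow> \<bar>p s\<bar> \<le> b" "0 < b"
    unfolding real_norm_def by blast+
  have pb: "p s \<le> b" if "s \<le> R" for s
    using b(1)[of s] b(2) zero[of s] that by (cases "s \<le> 0") auto
  define F where "F t = (LINT y|\<nu>. p (min R t - y) * w y)" for t
  have pw_b: "p (min R t - y) * w y \<le> b * w y" for t y
  proof (cases "0 < y")
    case True
    then show ?thesis by (intro mult_right_mono pb w0) auto
  qed (simp add: w_def)
  have int_p: "integrable \<nu> (\<lambda>y. p (min R t - y) * w y)" for t
    by (rule Bochner_Integration.integrable_bound[OF integrable_mult_right[OF int_w, of b]])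
      (use p(2) w0 b pw_b in \<open>auto intro!: AE_I2 simp: abs_mult\<close>)
  have F_cont: "isCont F t" for t
  proof (unfold continuous_at_sequentially, intro allI impI)
    fix u assume u: "u \<longlonglongrightarrow> t"
    show "(F \<circ> u) \<longlonglongrightarrow> F t"
      unfolding F_def o_def
    proof (rule integral_dominated_convergence[where w="\<lambda>y. b * w y"])
      show "AE y in \<nu>. (\<lambda>n. p (min R (u n) - y) * w y) \<longlonglongrightarrow> p (min R t - y) * w y"
        by (intro AE_I2 tendsto_mult tendsto_const isCont_tendsto_compose[OF cont] tendsto_diff tendsto_min u)
      show "AE y in \<nu>. norm (p (min R (u n) - y) * w y) \<le> b * w y" for n
        using p(2) w0 pw_b by (auto intro!: AE_I2 simp: abs_mult)
      show "integrable \<nu> (\<lambda>y. b * w y)" using int_w by auto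
    qed auto
  qed
  have F0: "0 \<le> F t" for t unfolding F_def using p(2) w0 by (intro Bochner_Integration.integral_nonneg) auto
  have F_nn: "(\<integral>\<^sup>+y. ennreal (p (t - y)) * ennreal y \<partial>\<nu>) = ennreal (F t)" if "t \<le> R" for t
  proof -
    have "ennreal (F t) = (\<integral>\<^sup>+y. ennreal (p (t - y) * w y) \<partial>\<nu>)"
      unfolding F_def min_absorb2[OF that] using int_p[of t, unfolded min_absorb2[OF that]] p(2) w0
      by (subst nn_integral_eq_integral) auto
    also have "\<dots> = (\<integral>\<^sup>+y. ennreal (p (t - y)) * ennreal y \<partial>\<nu>)"
      by (rule nn_integral_cong_AE, use AE_pos in eventually_elim)
        (use that zero p(2) in \<open>auto simp: w_def ennreal_mult[symmetric] indicator_def\<close>)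
    finally show ?thesis by simp
  qed
  define q where "q t = p t * max 0 t" for t
  have q_cont: "isCont q t" for t unfolding q_def by (intro continuous_intros cont)
  have q0: "0 \<le> q t" for t using p(2) by (simp add: q_def)
  have [measurable]: "q \<in> borel_measurable borel" "F \<in> borel_measurable borel"
    by (intro borel_measurable_continuous_onI continuous_at_imp_continuous_on; use q_cont F_cont in auto)+
  have "q x = F x"
  proof (rule ccontr)
    assume neq: "q x \<noteq> F x"
    (* The sign is normalized so that h is positive at x. *)
    define h where "h t = (q t - F t) * sgn (q x - F x)" for t
    have h_cont: "isCont h t" for t unfolding h_def by (intro continuous_intros q_cont F_cont)
    have hx: "0 < h x" using neq by (auto simp: h_def sgn_real_def)
    have "\<forall>\<^sub>F t in at x. 0 < h t"
      using order_tendstoD(1)[OF isContD[OF h_cont] hx] .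
    then obtain d' where d': "0 < d'" "\<And>t. t \<noteq> x \<Longrightarrow> dist t x < d' \<Longrightarrow> 0 < h t"
      by (auto simp: eventually_at)
    define d where "d = min d' 1"
    have d: "0 < d" "d \<le> 1" using d' by (auto simp: d_def)
    have h_pos: "0 < h t" if "\<bar>t - x\<bar> < d" for t
      using d'(2)[of t] hx that by (cases "t = x") (auto simp: d_def dist_real_def)
    define f where "f t = max 0 (d - \<bar>t - x\<bar>)" for t
    have f_cont: "isCont f t" for t unfolding f_def by (intro continuous_intros)
    have f: "0 \<le> f t" "f t \<le> d" "R < t \<Longrightarrow> f t = 0" for t using d by (auto simp: f_def R_def)
    have f_out: "f t = 0" if "t \<notin> {x - d..x + d}" for t using that by (auto simp: f_def max_def)
    have [measurable]: "f \<in> borel_measurable borel"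
      by (intro borel_measurable_continuous_onI continuous_at_imp_continuous_on) (use f_cont in auto)
    have int_f: "integrable lborel (\<lambda>t. f t * k t)" if "\<And>t. isCont k t" for k :: "real \<Rightarrow> real"
    proof -
      have "set_integrable lborel {x - d..x + d} (\<lambda>t. f t * k t)"
        by (intro borel_integrable_atLeastAtMost' continuous_at_imp_continuous_on ballI continuous_mult f_cont that)
      moreover have "(\<lambda>t. indicator {x - d..x + d} t *\<^sub>R (f t * k t)) = (\<lambda>t. f t * k t)"
        using f_out by (auto simp: indicator_def fun_eq_iff)
      ultimately show ?thesis unfolding set_integrable_def by simp
    qed
    have "(\<integral>\<^sup>+t. ennreal (f t * q t) \<partial>lborel) = (\<integral>\<^sup>+t. ennreal (p t) * (ennreal (f t) * ennreal t) \<partial>lborel)"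
    proof (intro nn_integral_cong)
      show "ennreal (f t * q t) = ennreal (p t) * (ennreal (f t) * ennreal t)" for t
        using f(1)[of t] p(2)[of t] by (cases "0 \<le> t") (auto simp: q_def ennreal_mult[symmetric] ennreal_neg mult_ac)
    qed
    also have "\<dots> = (\<integral>\<^sup>+t. ennreal (f t) * ennreal t \<partial>\<mu>)"
      unfolding dens by (subst nn_integral_density) auto
    also have "\<dots> = (\<integral>\<^sup>+t. \<integral>\<^sup>+y. ennreal (f (t + y)) * ennreal y \<partial>\<nu> \<partial>\<mu>)"
      by (rule size_bias_continuous[OF \<mu> ch f_cont f])
    also have "\<dots> = (\<integral>\<^sup>+t. ennreal (p t) * (\<integral>\<^sup>+y. ennreal (f (t + y)) * ennreal y \<partial>\<nu>) \<partial>lborel)"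
      unfolding dens by (subst nn_integral_density) auto
    also have "\<dots> = (\<integral>\<^sup>+t. (\<integral>\<^sup>+y. ennreal (p t) * (ennreal (f (t + y)) * ennreal y) \<partial>\<nu>) \<partial>lborel)"
      by (intro nn_integral_cong nn_integral_cmult[symmetric]) auto
    also have "\<dots> = (\<integral>\<^sup>+y. (\<integral>\<^sup>+t. ennreal (p t) * (ennreal (f (t + y)) * ennreal y) \<partial>lborel) \<partial>\<nu>)"
    proof -
      interpret pair_sigma_finite lborel \<nu> ..
      show ?thesis by (rule Fubini'[symmetric]) measurable
    qed
    also have "\<dots> = (\<integral>\<^sup>+y. (\<integral>\<^sup>+t. ennreal (p (t - y)) * (ennreal (f t) * ennreal y) \<partial>lborel) \<partial>\<nu>)"
    proof (rule nn_integral_cong)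
      show "(\<integral>\<^sup>+t. ennreal (p t) * (ennreal (f (t + y)) * ennreal y) \<partial>lborel)
        = (\<integral>\<^sup>+t. ennreal (p (t - y)) * (ennreal (f t) * ennreal y) \<partial>lborel)" for y
        by (subst nn_integral_real_affine[where c=1 and t="- y"]) (auto simp: add.commute)
    qed
    also have "\<dots> = (\<integral>\<^sup>+t. (\<integral>\<^sup>+y. ennreal (p (t - y)) * (ennreal (f t) * ennreal y) \<partial>\<nu>) \<partial>lborel)"
    proof -
      interpret pair_sigma_finite lborel \<nu> ..
      show ?thesis by (rule Fubini') measurable
    qed
    also have "\<dots> = (\<integral>\<^sup>+t. ennreal (f t * F t) \<partial>lborel)"
    proof (rule nn_integral_cong)
      fix t
      show "(\<integral>\<^sup>+y. ennreal (p (t - y)) * (ennreal (f t) * ennreal y) \<partial>\<nu>) = ennreal (f t * F t)"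
      proof (cases "t \<le> R")
        case True
        have "(\<integral>\<^sup>+y. ennreal (p (t - y)) * (ennreal (f t) * ennreal y) \<partial>\<nu>)
            = (\<integral>\<^sup>+y. ennreal (f t) * (ennreal (p (t - y)) * ennreal y) \<partial>\<nu>)"
          by (intro nn_integral_cong) (simp add: mult_ac)
        also have "\<dots> = ennreal (f t) * (\<integral>\<^sup>+y. ennreal (p (t - y)) * ennreal y \<partial>\<nu>)"
          by (rule nn_integral_cmult) measurable
        finally show ?thesis using F_nn[OF True] f F0 by (simp add: ennreal_mult)
      qed (use f(3) in simp)
    qed
    finally have "(LINT t|lborel. f t * q t) = (LINT t|lborel. f t * F t)"
      using int_f[OF q_cont] int_f[OF F_cont] f q0 F0
      by (simp add: nn_integral_eq_integral Bochner_Integration.integral_nonneg)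
    then have "(LINT t|lborel. f t * h t) = 0"
    proof -
      have "(LINT t|lborel. f t * h t) = (LINT t|lborel. (f t * q t - f t * F t) * sgn (q x - F x))"
        unfolding h_def by (simp add: algebra_simps)
      also have "\<dots> = ((LINT t|lborel. f t * q t) - (LINT t|lborel. f t * F t)) * sgn (q x - F x)"
        using int_f[OF q_cont] int_f[OF F_cont] by simp
      finally show ?thesis using \<open>(LINT t|lborel. f t * q t) = (LINT t|lborel. f t * F t)\<close> by simp
    qed
    moreover have nonneg: "0 \<le> f t * h t" for t
      using h_pos[of t] f(1)[of t] by (cases "\<bar>t - x\<bar> < d") (auto simp: f_def)
    ultimately have "AE t in lborel. f t * h t = 0"
      using int_f[OF h_cont] by (subst (asm) integral_nonneg_eq_0_iff_AE) auto
    then have "f x * h x = 0"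
      using continuous_AE_zero[of "\<lambda>t. f t * h t" UNIV x] f_cont h_cont by (auto intro!: continuous_mult)
    then show False using hx d by (simp add: f_def)
  qed
  moreover have "x * p x = q x" using zero[of x] by (cases "x \<le> 0") (auto simp: q_def)
  ultimately show ?thesis using F_nn[of x] by (simp add: R_def)
qed

section \<open>Splitting off small jumps\<close>

text \<open>
  The jumps above \<open>\<epsilon>\<close> form a compound Poisson law, whose intensity is divided by a number \<open>k\<close> so large that
  each of the \<open>k\<close> equal factors has no jump with probability more than one half.
\<close>

lemma levy_factorization:
  assumes \<mu>: "half_line_distribution \<mu>" and ch: "\<And>t. char \<mu> t = exp (CLINT y:{0<..}|\<nu>. iexp (t * y) - 1)"
    and "0 < \<epsilon>"
  shows "\<exists>M \<pi> k. half_line_distribution M \<and> half_line_distribution \<pi> \<and> 1 / 2 < measure \<pi> {0} \<and>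
    \<mu> = (M \<star> conv_power \<pi> k) \<and>
    (\<forall>\<eta>>0. ennreal \<eta> * emeasure M {\<eta><..} \<le> (\<integral>\<^sup>+y\<in>{0<..\<epsilon>}. ennreal y \<partial>\<nu>))"
proof -
  obtain M where M: "half_line_distribution M"
      "\<And>t. char M t = exp (CLINT y:{0<..\<epsilon>}|\<nu>. iexp (t * y) - 1)"
      "\<And>\<eta>. 0 < \<eta> \<Longrightarrow> ennreal \<eta> * emeasure M {\<eta><..} \<le> (\<integral>\<^sup>+y\<in>{0<..\<epsilon>}. ennreal y \<partial>\<nu>)"
    using small_jumps_exists[OF \<open>0 < \<epsilon>\<close>] by blast
  (* exp (- s) is at least 1 - s, which exceeds 1/2 for s = measure {epsilon<..} / k. *)
  define k where "k = nat \<lceil>2 * measure \<nu> {\<epsilon><..}\<rceil> + 1"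
  have k: "0 < real k" "2 * measure \<nu> {\<epsilon><..} < real k" unfolding k_def by linarith+
  obtain \<pi> where \<pi>: "half_line_distribution \<pi>"
      "\<And>t. char \<pi> t = exp ((1 / real k) *\<^sub>R (CLINT y:{\<epsilon><..}|\<nu>. iexp (t * y) - 1))"
      "ennreal (exp (- (1 / real k) * measure \<nu> {\<epsilon><..})) \<le> emeasure \<pi> {0}"
    using compound_poisson_part[of "{\<epsilon><..}" \<epsilon> "1 / real k"] k \<open>0 < \<epsilon>\<close> by auto
  interpret P: real_distribution \<pi> by (rule half_line_distributionD[OF \<pi>(1)])
  have "1 / 2 < 1 + (- (1 / real k) * measure \<nu> {\<epsilon><..})" using k by (simp add: field_simps)
  also have "\<dots> \<le> exp (- (1 / real k) * measure \<nu> {\<epsilon><..})" by (rule exp_ge_add_one_self)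
  also have "\<dots> \<le> measure \<pi> {0}" using \<pi>(3) by (simp add: P.emeasure_eq_measure)
  finally have half: "1 / 2 < measure \<pi> {0}" .
  have "\<mu> = (M \<star> conv_power \<pi> k)"
  proof (rule Levy_uniqueness)
    show "real_distribution \<mu>" "real_distribution (M \<star> conv_power \<pi> k)"
      using half_line_distribution_convolution[OF M(1) half_line_distribution_conv_power[OF \<pi>(1)]] \<mu>
      by (auto intro: half_line_distributionD)
    show "char \<mu> = char (M \<star> conv_power \<pi> k)"
    proof
      fix t
      let ?I = "CLINT y:{\<epsilon><..}|\<nu>. iexp (t * y) - 1"
      have "char (M \<star> conv_power \<pi> k) t = char M t * char \<pi> t ^ k"
        using half_line_distributionD(1)[OF M(1)] half_line_distributionD(1)[OF half_line_distribution_conv_power[OF \<pi>(1)]]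
        by (simp add: char_convolution char_conv_power[OF \<pi>(1)])
      also have "char \<pi> t ^ k = exp (of_nat k * ((1 / real k) *\<^sub>R ?I))"
        unfolding \<pi>(2) by (rule exp_of_nat_mult[symmetric])
      also have "of_nat k * ((1 / real k) *\<^sub>R ?I) = ?I"
        using k by (simp add: scaleR_conv_of_real)
      finally show "char \<mu> t = char (M \<star> conv_power \<pi> k) t"
        unfolding ch M(2) levy_exponent_union[OF \<open>0 < \<epsilon>\<close>] by (simp add: exp_add)
    qed
  qed
  then show ?thesis using M \<pi>(1) half by blast
qed

end

section \<open>Long-tailed functions\<close>

text \<open>
  In this form eventual positivity of \<open>f\<close> is automatic and asymptotic equivalence can be used directly in estimates.
\<close>

lemma asymp_pos_iff:
  "f \<simeq> h \<longleftrightarrow> (\<forall>\<^sub>F x in at_top. 0 < h x) \<and> (\<forall>e>0. \<forall>\<^sub>F x in at_top. \<bar>f x - h x\<bar> \<le> e * h x)"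
proof
  assume "f \<simeq> h"
  then have f: "\<forall>\<^sub>F x in at_top. 0 < f x" and h: "\<forall>\<^sub>F x in at_top. 0 < h x" and eq: "f \<sim>[at_top] h"
    by (auto simp: asymp_pos_def)
  have "((\<lambda>x. if f x = 0 \<and> h x = 0 then 1 else f x / h x) \<longlongrightarrow> 1) at_top"
    using eq by (simp add: asymp_equiv_def)
  show "(\<forall>\<^sub>F x in at_top. 0 < h x) \<and> (\<forall>e>0. \<forall>\<^sub>F x in at_top. \<bar>f x - h x\<bar> \<le> e * h x)"
  proof (intro conjI allI impI h)
    fix e :: real assume "0 < e"
    have "\<forall>\<^sub>F x in at_top. dist (if f x = 0 \<and> h x = 0 then 1 else f x / h x) 1 < e"
      using eq \<open>0 < e\<close> unfolding asymp_equiv_def by (rule tendstoD)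
    with h show "\<forall>\<^sub>F x in at_top. \<bar>f x - h x\<bar> \<le> e * h x"
    proof eventually_elim
      case (elim x)
      then have "\<bar>f x / h x - 1\<bar> < e" by (simp add: dist_real_def)
      moreover have "f x - h x = (f x / h x - 1) * h x"
        using elim by (simp add: field_simps)
      then have "\<bar>f x - h x\<bar> = \<bar>f x / h x - 1\<bar> * h x"
        using elim by (simp add: abs_mult)
      ultimately show ?case using elim by simp
    qed
  qed
next
  assume *: "(\<forall>\<^sub>F x in at_top. 0 < h x) \<and> (\<forall>e>0. \<forall>\<^sub>F x in at_top. \<bar>f x - h x\<bar> \<le> e * h x)"
  then have h: "\<forall>\<^sub>F x in at_top. 0 < h x" and e: "\<And>e. 0 < e \<Longrightarrow> \<forall>\<^sub>F x in at_top. \<bar>f x - h x\<bar> \<le> e * h x"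
    by auto
  have f: "\<forall>\<^sub>F x in at_top. 0 < f x"
    using h e[of "1 / 2", OF half_gt_zero[OF zero_less_one]]
  proof eventually_elim
    case (elim x)
    then have "h x - f x \<le> 1 / 2 * h x" by (simp only: abs_le_iff) simp
    then show ?case using elim by simp
  qed
  have "((\<lambda>x. if f x = 0 \<and> h x = 0 then 1 else f x / h x) \<longlongrightarrow> 1) at_top"
  proof (rule tendstoI)
    fix d :: real assume "0 < d"
    show "\<forall>\<^sub>F x in at_top. dist (if f x = 0 \<and> h x = 0 then 1 else f x / h x) 1 < d"
      using e[of "d / 2", OF half_gt_zero[OF \<open>0 < d\<close>]] h
    proof eventually_elim
      case (elim x)
      have "f x - h x = (f x / h x - 1) * h x"
        using elim by (simp add: field_simps)
      then have "\<bar>f x / h x - 1\<bar> * h x = \<bar>f x - h x\<bar>"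
        using elim by (simp add: abs_mult)
      also have "\<dots> \<le> d / 2 * h x" by (rule elim)
      finally have "\<bar>f x / h x - 1\<bar> \<le> d / 2" using elim by (simp add: mult_le_cancel_right)
      then show ?case using \<open>0 < d\<close> elim by (simp add: dist_real_def)
    qed
  qed
  then show "f \<simeq> h" using f h by (simp add: asymp_pos_def asymp_equiv_def)
qed

lemma asymp_pos_refl: "\<forall>\<^sub>F x in at_top. 0 < f x \<Longrightarrow> f \<simeq> f"
  by (simp add: asymp_pos_def)

lemma asymp_pos_sym: "f \<simeq> h \<Longrightarrow> h \<simeq> f"
  by (auto simp: asymp_pos_def intro: asymp_equiv_symI)

lemma asymp_pos_trans: "f \<simeq> g \<Longrightarrow> g \<simeq> h \<Longrightarrow> f \<simeq> h"
  by (auto simp: asymp_pos_def intro: asymp_equiv_trans)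

lemma asymp_pos_cmult: "f \<simeq> h \<Longrightarrow> 0 < c \<Longrightarrow> (\<lambda>x. c * f x) \<simeq> (\<lambda>x. c * h x)"
  by (auto simp: asymp_pos_def intro: asymp_equiv_mult elim: eventually_mono)

lemma asymp_pos_shift:
  assumes "f \<simeq> h" shows "(\<lambda>x. f (x + t)) \<simeq> (\<lambda>x. h (x + t))"
proof -
  have lim: "filterlim (\<lambda>x::real. x + t) at_top at_top"
    using filterlim_tendsto_add_at_top[OF tendsto_const filterlim_ident, of t] by (simp add: add.commute)
  show ?thesis
    using assms unfolding asymp_pos_iff by (auto intro: eventually_compose_filterlim[OF _ lim])
qed

lemma asymp_pos_cong:
  assumes "f \<simeq> h" "\<forall>\<^sub>F x in at_top. f x = f' x" "\<forall>\<^sub>F x in at_top. h x = h' x"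
  shows "f' \<simeq> h'"
  unfolding asymp_pos_iff
proof (intro conjI allI impI)
  show "\<forall>\<^sub>F x in at_top. 0 < h' x"
    using assms(1)[unfolded asymp_pos_iff, THEN conjunct1] assms(3) by eventually_elim simp
  show "\<forall>\<^sub>F x in at_top. \<bar>f' x - h' x\<bar> \<le> e * h' x" if "0 < e" for e
    using assms(1)[unfolded asymp_pos_iff, THEN conjunct2, rule_format, OF that] assms(2,3)
    by eventually_elim simp
qed

lemma long_tailedD:
  assumes "h \<in> long_tailed"
  shows "h \<in> borel_measurable borel" "0 \<le> h x" "(\<lambda>x. h (x + t)) \<simeq> h" "\<forall>\<^sub>F x in at_top. 0 < h x"
  using assms by (auto simp: long_tailed_def asymp_pos_def)

lemma long_tailed_asymp:
  assumes "h \<in> long_tailed" "f \<simeq> h" "f \<in> borel_measurable borel" "\<And>x. 0 \<le> f x"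
  shows "f \<in> long_tailed"
proof -
  have "(\<lambda>x. f (x + t)) \<simeq> f" for t
    using asymp_pos_shift[OF assms(2)] long_tailedD(3)[OF assms(1)] asymp_pos_sym[OF assms(2)]
    by (blast intro: asymp_pos_trans)
  then show ?thesis using assms(3,4) by (auto simp: long_tailed_def)
qed

lemma long_tailed_cmult: "h \<in> long_tailed \<Longrightarrow> 0 < c \<Longrightarrow> (\<lambda>x. c * h x) \<in> long_tailed"
  unfolding long_tailed_def using asymp_pos_cmult[of "\<lambda>x. h (x + t)" h c for t] by auto

text \<open>
  The shifts for which all late differences are small exhaust the interval, by pointwise convergence.
\<close>

lemma shift_differences_measure:
  fixes g :: "real \<Rightarrow> real" and z :: "nat \<Rightarrow> real"
  assumes [measurable]: "g \<in> borel_measurable borel"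
    and lim: "\<And>t. ((\<lambda>x. g (x + t) - g x) \<longlongrightarrow> 0) at_top"
    and z: "filterlim z at_top sequentially" and "0 < e" "0 \<le> A"
  shows "(\<lambda>n. emeasure lborel {t\<in>{-2 * A..2 * A}. \<forall>k\<ge>n. \<bar>g (z k + t) - g (z k)\<bar> < e}) \<longlonglongrightarrow> ennreal (4 * A)"
proof -
  let ?I = "\<lambda>n. {t\<in>{-2 * A..2 * A}. \<forall>k\<ge>n. \<bar>g (z k + t) - g (z k)\<bar> < e}"
  have "(\<lambda>n. emeasure lborel (?I n)) \<longlonglongrightarrow> emeasure lborel (\<Union>n. ?I n)"
    by (intro Lim_emeasure_incseq) (auto simp: incseq_def)
  moreover have "(\<Union>n. ?I n) = {-2 * A..2 * A}"
  proof -
    have "\<exists>n. \<forall>k\<ge>n. \<bar>g (z k + t) - g (z k)\<bar> < e" for t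
    proof -
      have "((\<lambda>k. g (z k + t) - g (z k)) \<longlongrightarrow> 0) sequentially"
        by (rule filterlim_compose[OF lim z])
      from tendstoD[OF this \<open>0 < e\<close>] show ?thesis
        by (auto simp: eventually_sequentially dist_real_def)
    qed
    then show ?thesis by auto
  qed
  ultimately show ?thesis using assms(5) by simp
qed

text \<open>
  The uniform convergence theorem for slowly varying functions, in additive form. If uniformity failed along
  \<open>x n\<close> and \<open>t n\<close>, the shifts that are good for \<open>x n\<close> and those good for \<open>x n + t n\<close>, the latter translated by
  \<open>t n\<close>, would each fill more than half of \<open>[-3 B, 3 B]\<close>, and a common point contradicts the failure.
\<close>

lemma uniform_shift_differences:
  fixes g :: "real \<Rightarrow> real"
  assumes meas[measurable]: "g \<in> borel_measurable borel"
    and lim: "\<And>t. ((\<lambda>x. g (x + t) - g x) \<longlongrightarrow> 0) at_top" and "0 < e"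
  shows "\<forall>\<^sub>F x in at_top. \<forall>t. \<bar>t\<bar> \<le> A \<longrightarrow> \<bar>g (x + t) - g x\<bar> \<le> e"
proof -
  define B where "B = max A 1"
  have B: "0 < B" "A \<le> B" by (auto simp: B_def)
  have "\<forall>\<^sub>F x in at_top. \<forall>t. \<bar>t\<bar> \<le> B \<longrightarrow> \<bar>g (x + t) - g x\<bar> \<le> e"
  proof (rule ccontr)
    assume "\<not> ?thesis"
    then have "\<forall>n. \<exists>x\<ge>real n. \<exists>t. \<bar>t\<bar> \<le> B \<and> e < \<bar>g (x + t) - g x\<bar>"
      by (auto simp: eventually_at_top_linorder not_le)
    then obtain x t where x: "\<And>n. real n \<le> x n" and t: "\<And>n. \<bar>t n\<bar> \<le> B" and far: "\<And>n. e < \<bar>g (x n + t n) - g (x n)\<bar>"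
      by metis
    have xl: "filterlim x at_top sequentially"
      by (rule filterlim_at_top_mono[OF filterlim_real_sequentially]) (use x in auto)
    have yl: "filterlim (\<lambda>n. x n + t n) at_top sequentially"
    proof (rule filterlim_at_top_mono)
      show "filterlim (\<lambda>n. - B + real n) at_top sequentially"
        by (rule filterlim_tendsto_add_at_top[OF tendsto_const filterlim_real_sequentially])
      show "\<forall>\<^sub>F n in sequentially. - B + real n \<le> x n + t n"
        using x t by (intro always_eventually allI) (smt (verit))
    qed
    let ?I = "\<lambda>z n. {s\<in>{-2 * B..2 * B}. \<forall>k\<ge>n. \<bar>g (z k + s) - g (z k)\<bar> < e / 2}"
    (* Good shifts fill at least 3 B of the 4 B in [-2 B, 2 B]. *)
    have big: "ennreal (3 * B) < ennreal (4 * B)" using B by (simp add: ennreal_less_iff)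
    have "\<forall>\<^sub>F n in sequentially. ennreal (3 * B) < emeasure lborel (?I x n)"
      by (rule order_tendstoD(1)[OF shift_differences_measure[OF meas lim xl]]) (use \<open>0 < e\<close> B big in auto)
    moreover have "\<forall>\<^sub>F n in sequentially. ennreal (3 * B) < emeasure lborel (?I (\<lambda>n. x n + t n) n)"
      by (rule order_tendstoD(1)[OF shift_differences_measure[OF meas lim yl]]) (use \<open>0 < e\<close> B big in auto)
    ultimately have "\<forall>\<^sub>F n in sequentially. ennreal (3 * B) < emeasure lborel (?I x n)
        \<and> ennreal (3 * B) < emeasure lborel (?I (\<lambda>n. x n + t n) n)"
      by eventually_elim auto
    then obtain n where n: "ennreal (3 * B) < emeasure lborel (?I x n)"
        "ennreal (3 * B) < emeasure lborel (?I (\<lambda>n. x n + t n) n)"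
      by (auto simp: eventually_sequentially)
    define J where "J = {s. s - t n \<in> ?I (\<lambda>n. x n + t n) n}"
    have [measurable]: "J \<in> sets borel" "?I x n \<in> sets borel" "?I (\<lambda>n. x n + t n) n \<in> sets borel"
      unfolding J_def by measurable
    have "emeasure lborel (?I (\<lambda>n. x n + t n) n) = (\<integral>\<^sup>+s. indicator (?I (\<lambda>n. x n + t n) n) s \<partial>lborel)" by simp
    also have "\<dots> = (\<integral>\<^sup>+s. indicator (?I (\<lambda>n. x n + t n) n) (- t n + 1 * s) \<partial>lborel)"
      by (subst nn_integral_real_affine[where c=1 and t="- t n"]) auto
    also have "\<dots> = (\<integral>\<^sup>+s. indicator J s \<partial>lborel)"
      by (intro nn_integral_cong) (auto simp: J_def indicator_def)
    finally have eJ: "ennreal (3 * B) < emeasure lborel J" using n by simp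
    have "?I x n \<inter> J \<noteq> {}"
    proof
      assume disj: "?I x n \<inter> J = {}"
      have "ennreal (3 * B) + ennreal (3 * B) < emeasure lborel (?I x n) + emeasure lborel J"
        using n eJ by (intro add_strict_mono) auto
      also have "\<dots> = emeasure lborel (?I x n \<union> J)"
        using disj by (intro plus_emeasure) auto
      also have "\<dots> \<le> emeasure lborel {- 3 * B..3 * B}"
      proof (rule emeasure_mono)
        show "?I x n \<union> J \<subseteq> {- 3 * B..3 * B}"
          using t[of n] B by (auto simp: J_def abs_le_iff)
      qed simp
      also have "\<dots> = ennreal (3 * B) + ennreal (3 * B)" using B by (simp flip: ennreal_plus)
      finally show False by simp
    qed
    then obtain s where "s \<in> ?I x n" "s \<in> J" by auto
    then have "\<bar>g (x n + s) - g (x n)\<bar> < e / 2" "\<bar>g (x n + t n + (s - t n)) - g (x n + t n)\<bar> < e / 2"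
      unfolding J_def by blast+
    then have "\<bar>g (x n + t n) - g (x n)\<bar> < e" by simp argo
    with far[of n] show False by simp
  qed
  then show ?thesis by eventually_elim (use B in force)
qed

lemma long_tailed_uniform:
  assumes h: "h \<in> long_tailed" and "0 < e"
  shows "\<forall>\<^sub>F x in at_top. 0 < h x \<and> (\<forall>t. \<bar>t\<bar> \<le> A \<longrightarrow> \<bar>h (x + t) - h x\<bar> \<le> e * h x)"
proof -
  note [measurable] = long_tailedD(1)[OF h]
  have pos: "\<forall>\<^sub>F x in at_top. 0 < h x" by (rule long_tailedD(4)[OF h])
  then obtain X where X: "\<And>x. X \<le> x \<Longrightarrow> 0 < h x" by (auto simp: eventually_at_top_linorder)
  have "((\<lambda>x. ln (h (x + t)) - ln (h x)) \<longlongrightarrow> 0) at_top" for t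
  proof -
    have "(\<lambda>x. h (x + t)) \<sim>[at_top] h" and pos': "\<forall>\<^sub>F x in at_top. 0 < h (x + t)"
      using long_tailedD(3)[OF h, of t] by (auto simp: asymp_pos_def)
    then have "((\<lambda>x. if h (x + t) = 0 \<and> h x = 0 then 1 else h (x + t) / h x) \<longlongrightarrow> 1) at_top"
      by (simp add: asymp_equiv_def)
    then have "((\<lambda>x. ln (if h (x + t) = 0 \<and> h x = 0 then 1 else h (x + t) / h x)) \<longlongrightarrow> ln 1) at_top"
      by (rule tendsto_ln) simp
    moreover have "\<forall>\<^sub>F x in at_top. ln (if h (x + t) = 0 \<and> h x = 0 then 1 else h (x + t) / h x) = ln (h (x + t)) - ln (h x)"
      using pos pos' by eventually_elim (simp add: ln_div)
    ultimately show ?thesis using tendsto_cong by force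
  qed
  then have "\<forall>\<^sub>F x in at_top. \<forall>t. \<bar>t\<bar> \<le> A \<longrightarrow> \<bar>ln (h (x + t)) - ln (h x)\<bar> \<le> ln (1 + e)"
    using \<open>0 < e\<close> by (intro uniform_shift_differences) auto
  moreover have "\<forall>\<^sub>F x in at_top. X + \<bar>A\<bar> \<le> x" by (rule eventually_ge_at_top)
  ultimately show ?thesis
  proof eventually_elim
    case (elim x)
    have x: "0 < h x" using elim by (intro X) auto
    have "\<bar>h (x + t) - h x\<bar> \<le> e * h x" if t: "\<bar>t\<bar> \<le> A" for t
    proof -
      have xt: "0 < h (x + t)" using elim t by (intro X) (auto simp: abs_le_iff)
      have l: "\<bar>ln (h (x + t)) - ln (h x)\<bar> \<le> ln (1 + e)" using elim t by auto
      then have "ln (h (x + t)) \<le> ln ((1 + e) * h x)" using x \<open>0 < e\<close> by (simp add: ln_mult)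
      then have u: "h (x + t) \<le> (1 + e) * h x" using x xt \<open>0 < e\<close> by (subst (asm) ln_le_cancel_iff) auto
      from l have "ln (h x) \<le> ln ((1 + e) * h (x + t))" using xt \<open>0 < e\<close> by (simp add: ln_mult)
      then have "h x \<le> (1 + e) * h (x + t)" using x xt \<open>0 < e\<close> by (subst (asm) ln_le_cancel_iff) auto
      then have "h x - h (x + t) \<le> e * h x / (1 + e)" using \<open>0 < e\<close> by (simp add: field_simps)
      also have "\<dots> \<le> e * h x" using x \<open>0 < e\<close> by (simp add: field_simps)
      finally show ?thesis using u by (simp add: abs_le_iff algebra_simps)
    qed
    with x show ?case by blast
  qed
qed

text \<open>
  Every convolution integral below is cut at \<open>A\<close> and \<open>x - A\<close>. In the near part the value of
  a long-tailed kernel hardly differs from \<open>F x\<close>, in the far part the measure is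
  seen through a window of bounded distance from \<open>x\<close>, and subexponentiality is the statement that
  the middle part is negligible once \<open>A\<close> is large.
\<close>

abbreviation near_part :: "(real \<Rightarrow> real) \<Rightarrow> real measure \<Rightarrow> real \<Rightarrow> real \<Rightarrow> ennreal" where
  "near_part F m A x \<equiv> \<integral>\<^sup>+y\<in>{0..A}. ennreal (F (x - y)) \<partial>m"

abbreviation middle_part :: "(real \<Rightarrow> real) \<Rightarrow> real measure \<Rightarrow> real \<Rightarrow> real \<Rightarrow> ennreal" where
  "middle_part F m A x \<equiv> \<integral>\<^sup>+y\<in>{A<..<x - A}. ennreal (F (x - y)) \<partial>m"

abbreviation far_part :: "(real \<Rightarrow> real) \<Rightarrow> real measure \<Rightarrow> real \<Rightarrow> real \<Rightarrow> ennreal" where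
  "far_part F m A x \<equiv> \<integral>\<^sup>+y\<in>{x - A..}. ennreal (F (x - y)) \<partial>m"

lemma near_part_upper:
  assumes h: "h \<in> long_tailed" and "0 < e" and [measurable_cong]: "sets m = sets borel"
  shows "\<forall>\<^sub>F x in at_top. near_part h m A x \<le> ennreal ((1 + e) * h x) * emeasure m {0..A}"
  using long_tailed_uniform[OF h \<open>0 < e\<close>, of A]
proof eventually_elim
  case (elim x)
  have "near_part h m A x \<le> (\<integral>\<^sup>+y. ennreal ((1 + e) * h x) * indicator {0..A} y \<partial>m)"
  proof (rule nn_integral_mono)
    fix y
    have "h (x - y) \<le> (1 + e) * h x" if "y \<in> {0..A}"
      using elim[THEN conjunct2, rule_format, of "- y"] that by (auto simp: abs_le_iff algebra_simps)
    then show "ennreal (h (x - y)) * indicator {0..A} y \<le> ennreal ((1 + e) * h x) * indicator {0..A} y"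
      by (auto simp: indicator_def intro!: ennreal_leI)
  qed
  also have "\<dots> = ennreal ((1 + e) * h x) * emeasure m {0..A}"
    by (rule nn_integral_cmult_indicator) measurable
  finally show ?case .
qed

lemma near_part_lower:
  assumes h: "h \<in> long_tailed" and "0 < e" and [measurable_cong]: "sets m = sets borel"
  shows "\<forall>\<^sub>F x in at_top. ennreal ((1 - e) * h x) * emeasure m {0..A} \<le> near_part h m A x"
  using long_tailed_uniform[OF h \<open>0 < e\<close>, of A]
proof eventually_elim
  case (elim x)
  have "ennreal ((1 - e) * h x) * emeasure m {0..A} = (\<integral>\<^sup>+y. ennreal ((1 - e) * h x) * indicator {0..A} y \<partial>m)"
    by (rule nn_integral_cmult_indicator[symmetric]) measurable
  also have "\<dots> \<le> near_part h m A x"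
  proof (rule nn_integral_mono)
    fix y
    have "(1 - e) * h x \<le> h (x - y)" if "y \<in> {0..A}"
      using elim[THEN conjunct2, rule_format, of "- y"] that by (auto simp: abs_le_iff algebra_simps)
    then show "ennreal ((1 - e) * h x) * indicator {0..A} y \<le> ennreal (h (x - y)) * indicator {0..A} y"
      by (auto simp: indicator_def intro!: ennreal_leI)
  qed
  finally show ?case .
qed

section \<open>Smoothing by windows\<close>

text \<open>
  Tonelli's theorem: \<open>z\<close> lies in \<open>[y - d, y)\<close> exactly if \<open>y\<close> lies in \<open>(z, z + d]\<close>.
\<close>

lemma smoothing_identity:
  fixes G :: "real \<Rightarrow> ennreal"
  assumes "sigma_finite_measure m" and [measurable_cong]: "sets m = sets borel"
    and [measurable]: "G \<in> borel_measurable borel" "J \<in> sets borel"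
  shows "(\<integral>\<^sup>+y\<in>J. (\<integral>\<^sup>+z\<in>{y - d..<y}. G z \<partial>lborel) \<partial>m) = (\<integral>\<^sup>+z. G z * emeasure m ({z<..z + d} \<inter> J) \<partial>lborel)"
proof -
  interpret m: sigma_finite_measure m by fact
  interpret pair_sigma_finite lborel m ..
  have sp: "space m = UNIV" using sets_eq_imp_space_eq[OF assms(2)] by simp
  have "(\<integral>\<^sup>+y\<in>J. (\<integral>\<^sup>+z\<in>{y - d..<y}. G z \<partial>lborel) \<partial>m)
      = (\<integral>\<^sup>+y. (\<integral>\<^sup>+z. G z * (indicator {y - d..<y} z * indicator J y) \<partial>lborel) \<partial>m)"
    by (intro nn_integral_cong) (simp add: nn_integral_multc[symmetric] mult.assoc)
  also have "\<dots> = (\<integral>\<^sup>+z. (\<integral>\<^sup>+y. G z * (indicator {y - d..<y} z * indicator J y) \<partial>m) \<partial>lborel)"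
    by (rule Fubini') (simp add: indicator_def[abs_def] split_beta)
  also have "\<dots> = (\<integral>\<^sup>+z. (\<integral>\<^sup>+y. G z * indicator ({z<..z + d} \<inter> J) y \<partial>m) \<partial>lborel)"
    by (intro nn_integral_cong arg_cong2[where f=times]) (auto simp: indicator_def)
  also have "\<dots> = (\<integral>\<^sup>+z. G z * emeasure m ({z<..z + d} \<inter> J) \<partial>lborel)"
    by (intro nn_integral_cong nn_integral_cmult_indicator) measurable
  finally show ?thesis .
qed

text \<open>
  A slowly varying integrand may be averaged over a window before it is integrated, and then only the
  window masses of \<open>m\<close> enter. With its converse this lets measures be compared through their windows.
\<close>

lemma smoothing_upper:
  fixes F G :: "real \<Rightarrow> ennreal"
  assumes "sigma_finite_measure m" "sets m = sets borel"
    and "F \<in> borel_measurable borel" "G \<in> borel_measurable borel" "J \<in> sets borel" "0 < d"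
    and FG: "\<And>y z. y \<in> J \<Longrightarrow> y - d \<le> z \<Longrightarrow> z < y \<Longrightarrow> F y \<le> G z"
  shows "ennreal d * (\<integral>\<^sup>+y\<in>J. F y \<partial>m) \<le> (\<integral>\<^sup>+z. G z * emeasure m ({z<..z + d} \<inter> J) \<partial>lborel)"
proof -
  note [measurable] = assms(3-5)
  have [measurable_cong]: "sets m = sets borel" by fact
  have "ennreal d * F y * indicator J y \<le> (\<integral>\<^sup>+z\<in>{y - d..<y}. G z \<partial>lborel) * indicator J y" for y
  proof (cases "y \<in> J")
    case True
    have "ennreal d * F y = (\<integral>\<^sup>+z. F y * indicator {y - d..<y} z \<partial>lborel)"
      using \<open>0 < d\<close> by (simp add: nn_integral_cmult_indicator mult.commute)
    also have "\<dots> \<le> (\<integral>\<^sup>+z\<in>{y - d..<y}. G z \<partial>lborel)"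
      by (intro nn_integral_mono) (use FG[OF True] in \<open>auto simp: indicator_def\<close>)
    finally show ?thesis using True by simp
  qed simp
  then have "(\<integral>\<^sup>+y. ennreal d * F y * indicator J y \<partial>m) \<le> (\<integral>\<^sup>+y\<in>J. (\<integral>\<^sup>+z\<in>{y - d..<y}. G z \<partial>lborel) \<partial>m)"
    by (intro nn_integral_mono)
  moreover have "ennreal d * (\<integral>\<^sup>+y\<in>J. F y \<partial>m) \<le> (\<integral>\<^sup>+y. ennreal d * F y * indicator J y \<partial>m)"
    by (subst nn_integral_cmult[symmetric]) (auto simp: mult.assoc)
  ultimately show ?thesis
    using smoothing_identity[OF assms(1,2,4,5)] by simp
qed

lemma smoothing_lower:
  fixes F G :: "real \<Rightarrow> ennreal"
  assumes "sigma_finite_measure m" "sets m = sets borel"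
    and [measurable]: "F \<in> borel_measurable borel" "G \<in> borel_measurable borel" "J \<in> sets borel" and "0 < d"
    and FG: "\<And>y z. y \<in> J \<Longrightarrow> y - d \<le> z \<Longrightarrow> z < y \<Longrightarrow> G z \<le> F y"
  shows "(\<integral>\<^sup>+z. G z * emeasure m ({z<..z + d} \<inter> J) \<partial>lborel) \<le> ennreal d * (\<integral>\<^sup>+y\<in>J. F y \<partial>m)"
proof -
  have [measurable_cong]: "sets m = sets borel" by fact
  have "(\<integral>\<^sup>+z\<in>{y - d..<y}. G z \<partial>lborel) * indicator J y \<le> ennreal d * (F y * indicator J y)" for y
  proof (cases "y \<in> J")
    case True
    have "(\<integral>\<^sup>+z\<in>{y - d..<y}. G z \<partial>lborel) \<le> (\<integral>\<^sup>+z. F y * indicator {y - d..<y} z \<partial>lborel)"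
      by (intro nn_integral_mono) (use FG[OF True] in \<open>auto simp: indicator_def\<close>)
    also have "\<dots> = ennreal d * F y"
      using \<open>0 < d\<close> by (simp add: nn_integral_cmult_indicator mult.commute)
    finally show ?thesis using True by simp
  qed simp
  then have "(\<integral>\<^sup>+y\<in>J. (\<integral>\<^sup>+z\<in>{y - d..<y}. G z \<partial>lborel) \<partial>m) \<le> (\<integral>\<^sup>+y. ennreal d * (F y * indicator J y) \<partial>m)"
    by (intro nn_integral_mono)
  also have "\<dots> = ennreal d * (\<integral>\<^sup>+y\<in>J. F y \<partial>m)"
    by (rule nn_integral_cmult) measurable
  finally show ?thesis
    using smoothing_identity[OF assms(1,2,4,5)] by simp
qed

lemma ennreal_le_diffI:
  assumes "ennreal c + M \<le> ennreal d" "0 \<le> c"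
  shows "M \<le> ennreal (d - c)"
proof (cases M)
  case (real r)
  then show ?thesis using assms
    by (cases "0 \<le> d") (auto simp: ennreal_neg simp flip: ennreal_plus intro!: ennreal_leI)
qed (use assms in \<open>auto simp: top_unique\<close>)

lemma nn_integral_split3:
  fixes m :: "real measure"
  assumes [measurable_cong]: "sets m = sets borel" and ae: "AE y in m. 0 \<le> y" and "0 \<le> A" "A < B"
    and [measurable]: "F \<in> borel_measurable borel"
  shows "(\<integral>\<^sup>+y. F y \<partial>m) = (\<integral>\<^sup>+y\<in>{0..A}. F y \<partial>m) + (\<integral>\<^sup>+y\<in>{A<..<B}. F y \<partial>m) + (\<integral>\<^sup>+y\<in>{B..}. F y \<partial>m)"
proof -
  have "(\<integral>\<^sup>+y. F y \<partial>m) = (\<integral>\<^sup>+y. F y * indicator {0..A} y + F y * indicator {A<..<B} y + F y * indicator {B..} y \<partial>m)"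
  proof (rule nn_integral_cong_AE, use ae in eventually_elim)
    case (elim y)
    consider "y \<le> A" | "A < y" "y < B" | "B \<le> y" by linarith
    then show ?case using elim assms(3,4) by cases (simp_all add: indicator_def)
  qed
  also have "\<dots> = (\<integral>\<^sup>+y. F y * indicator {0..A} y + F y * indicator {A<..<B} y \<partial>m) + (\<integral>\<^sup>+y\<in>{B..}. F y \<partial>m)"
    by (rule nn_integral_add) measurable
  also have "(\<integral>\<^sup>+y. F y * indicator {0..A} y + F y * indicator {A<..<B} y \<partial>m)
      = (\<integral>\<^sup>+y\<in>{0..A}. F y \<partial>m) + (\<integral>\<^sup>+y\<in>{A<..<B}. F y \<partial>m)"
    by (rule nn_integral_add) measurable
  finally show ?thesis .
qed

lemma window_measurable:
  fixes m :: "real measure"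
  assumes "sigma_finite_measure m" and [measurable_cong]: "sets m = sets borel" and [measurable]: "J \<in> sets borel"
  shows "(\<lambda>z. emeasure m ({z<..z + d} \<inter> J)) \<in> borel_measurable borel"
proof -
  interpret sigma_finite_measure m by fact
  have "(\<lambda>z. \<integral>\<^sup>+y. indicator J y * (if z < y \<and> y \<le> z + d then 1 else 0) \<partial>m) \<in> borel_measurable borel"
    by measurable
  moreover have "(\<integral>\<^sup>+y. indicator J y * (if z < y \<and> y \<le> z + d then 1 else 0) \<partial>m) = emeasure m ({z<..z + d} \<inter> J)" for z
  proof -
    have "indicator J y * (if z < y \<and> y \<le> z + d then 1 else 0) = (indicator ({z<..z + d} \<inter> J) y :: ennreal)" for y
      by (auto simp: indicator_def)
    moreover have "{z<..z + d} \<inter> J \<in> sets m" by measurable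
    ultimately show ?thesis by (simp only: nn_integral_indicator)
  qed
  ultimately show ?thesis by simp
qed

lemma distribution_mass:
  assumes "real_distribution m" "AE y in m. 0 \<le> y" "0 < d"
  shows "\<forall>\<^sub>F A in at_top. ennreal (1 - d) \<le> emeasure m {0..A}"
proof -
  interpret real_distribution m by fact
  have "\<forall>\<^sub>F A in at_top. 1 - d < cdf m A"
    using order_tendstoD(1)[OF cdf_lim_at_top_prob, of "1 - d"] assms(3) by simp
  then show ?thesis
  proof eventually_elim
    case (elim A)
    have "emeasure m {..A} = emeasure m {0..A}"
      by (rule emeasure_eq_AE, use assms(2) in eventually_elim) auto
    then show ?case using elim by (simp add: cdf_def emeasure_eq_measure)
  qed
qed

text \<open>
  The near part of a subexponential convolution already accounts for \<open>h x\<close>, and so does the far part by symmetry,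
  which exhausts \<open>2 h x\<close>.
\<close>

lemma middle_part_small:
  fixes m :: "real measure"
  assumes h: "h \<in> long_tailed" and m: "real_distribution m" "AE y in m. 0 \<le> y"
    and tot: "\<And>A. 0 < A \<Longrightarrow> \<forall>\<^sub>F x in at_top. 2 * near_part h m A x
      + middle_part h m A x \<le> ennreal (T x)"
    and T: "T \<simeq> (\<lambda>x. 2 * h x)" and "0 < e"
  shows "\<exists>A0. \<forall>A\<ge>A0. \<forall>\<^sub>F x in at_top. middle_part h m A x \<le> ennreal (e * h x)"
proof -
  interpret real_distribution m by (rule m)
  (* The error below is 6 d - 2 d^2 times h x. *)
  define d where "d = min (e / 8) 1"
  have d: "0 < d" "d \<le> 1" "8 * d \<le> e" using \<open>0 < e\<close> by (auto simp: d_def min_def)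
  obtain A0 where A0: "\<And>A. A0 \<le> A \<Longrightarrow> ennreal (1 - d) \<le> emeasure m {0..A}"
    using distribution_mass[OF m d(1)] by (auto simp: eventually_at_top_linorder)
  show ?thesis
  proof (intro exI[of _ "max A0 1"] allI impI)
    fix A assume A: "max A0 1 \<le> A"
    have T': "\<forall>\<^sub>F x in at_top. \<bar>T x - 2 * h x\<bar> \<le> d * (2 * h x)"
      using T d(1) unfolding asymp_pos_iff by blast
    have "0 < A" using A by simp
    from tot[OF this] T' near_part_lower[OF h d(1) events_eq_borel, of A] long_tailedD(4)[OF h]
    show "\<forall>\<^sub>F x in at_top. middle_part h m A x \<le> ennreal (e * h x)"
    proof eventually_elim
      case (elim x)
      have hx: "0 < h x" by fact
      have "ennreal (2 * ((1 - d) * h x * (1 - d))) = 2 * (ennreal ((1 - d) * h x) * ennreal (1 - d))"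
        using d hx by (subst ennreal_mult[symmetric]) (auto simp: ennreal_mult ennreal_numeral[symmetric] simp del: ennreal_numeral)
      also have "\<dots> \<le> 2 * (ennreal ((1 - d) * h x) * emeasure m {0..A})"
        using A0[of A] A by (intro mult_left_mono) auto
      also have "\<dots> \<le> 2 * near_part h m A x"
        by (rule mult_left_mono) (use elim in auto)
      finally have "ennreal (2 * ((1 - d) * h x * (1 - d))) + middle_part h m A x
          \<le> 2 * near_part h m A x + middle_part h m A x"
        by (rule add_right_mono)
      also have "\<dots> \<le> ennreal (T x)" by (rule elim)
      finally have "middle_part h m A x \<le> ennreal (T x - 2 * ((1 - d) * h x * (1 - d)))"
        by (rule ennreal_le_diffI) (use d hx in auto)
      also have "\<dots> \<le> ennreal (e * h x)"
      proof (rule ennreal_leI)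
        have "T x \<le> 2 * h x + d * (2 * h x)" using elim(2) by linarith
        moreover have "2 * h x + d * (2 * h x) - 2 * ((1 - d) * h x * (1 - d)) = (6 * d - 2 * d\<^sup>2) * h x"
          by (simp add: algebra_simps power2_eq_square)
        moreover have "(6 * d - 2 * d\<^sup>2) * h x \<le> e * h x"
        proof (rule mult_right_mono)
          have "0 \<le> d\<^sup>2" by simp
          then show "6 * d - 2 * d\<^sup>2 \<le> e" using d by linarith
        qed (use hx in simp)
        ultimately show "T x - 2 * ((1 - d) * h x * (1 - d)) \<le> e * h x" by linarith
      qed
      finally show ?case .
    qed
  qed
qed

lemma long_tailed_unit_shift:
  assumes h: "h \<in> long_tailed" and "0 < e"
  shows "\<exists>A1. \<forall>u\<ge>A1. \<forall>t. \<bar>t\<bar> \<le> 1 \<longrightarrow> h u \<le> (1 + e) * h (u + t)"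
proof -
  obtain A1 where A1: "\<And>u t. A1 \<le> u \<Longrightarrow> \<bar>t\<bar> \<le> 1 \<Longrightarrow> \<bar>h (u + t) - h u\<bar> \<le> e * h u"
    using long_tailed_uniform[OF h \<open>0 < e\<close>, of 1] by (auto simp: eventually_at_top_linorder)
  show ?thesis
  proof (intro exI[of _ "A1 + 1"] allI impI)
    fix u t :: real assume "A1 + 1 \<le> u" "\<bar>t\<bar> \<le> 1"
    then have "\<bar>h (u + t + (- t)) - h (u + t)\<bar> \<le> e * h (u + t)" by (intro A1) auto
    then show "h u \<le> (1 + e) * h (u + t)" by (simp add: algebra_simps abs_le_iff)
  qed
qed

lemma middle_part_upper:
  assumes m: "sigma_finite_measure m" "sets m = sets borel" and h: "h \<in> long_tailed"
    and [measurable]: "g \<in> borel_measurable borel" and "0 \<le> k" "0 < e"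
    and win: "\<And>z. b \<le> z \<Longrightarrow> emeasure m {z<..z + 1} \<le> ennreal (k * g z)"
  shows "\<exists>A1. \<forall>A\<ge>A1. \<forall>x. middle_part h m A x
    \<le> ennreal ((1 + e) * k) * (\<integral>\<^sup>+z\<in>{A - 1<..<x - A}. ennreal (h (x - z)) * ennreal (g z) \<partial>lborel)"
proof -
  note [measurable] = long_tailedD(1)[OF h]
  have [measurable_cong]: "sets m = sets borel" by fact
  obtain A1 where A1: "\<And>u t. A1 \<le> u \<Longrightarrow> \<bar>t\<bar> \<le> 1 \<Longrightarrow> h u \<le> (1 + e) * h (u + t)"
    using long_tailed_unit_shift[OF h \<open>0 < e\<close>] by blast
  show ?thesis
  proof (intro exI[of _ "max A1 (b + 1)"] allI impI)
    fix A x assume A: "max A1 (b + 1) \<le> A"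
    let ?J = "{A<..<x - A}"
    have "ennreal 1 * (\<integral>\<^sup>+y\<in>?J. ennreal (h (x - y)) \<partial>m)
        \<le> (\<integral>\<^sup>+z. ennreal ((1 + e) * h (x - z)) * emeasure m ({z<..z + 1} \<inter> ?J) \<partial>lborel)"
    proof (rule smoothing_upper[OF m])
      fix y z assume "y \<in> ?J" "y - 1 \<le> z" "z < y"
      then show "ennreal (h (x - y)) \<le> ennreal ((1 + e) * h (x - z))"
        using A1[of "x - y" "y - z"] A by (auto intro!: ennreal_leI)
    qed auto
    also have "\<dots> \<le> (\<integral>\<^sup>+z. ennreal ((1 + e) * k) * (ennreal (h (x - z)) * ennreal (g z) * indicator {A - 1<..<x - A} z) \<partial>lborel)"
    proof (rule nn_integral_mono)
      fix z
      show "ennreal ((1 + e) * h (x - z)) * emeasure m ({z<..z + 1} \<inter> ?J)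
        \<le> ennreal ((1 + e) * k) * (ennreal (h (x - z)) * ennreal (g z) * indicator {A - 1<..<x - A} z)"
      proof (cases "z \<in> {A - 1<..<x - A}")
        case True
        have "emeasure m ({z<..z + 1} \<inter> ?J) \<le> emeasure m {z<..z + 1}"
          by (rule emeasure_mono) (auto simp: m(2))
        also have "\<dots> \<le> ennreal (k * g z)" using True A by (intro win) auto
        finally have "ennreal ((1 + e) * h (x - z)) * emeasure m ({z<..z + 1} \<inter> ?J)
          \<le> ennreal ((1 + e) * h (x - z)) * ennreal (k * g z)" by (rule mult_left_mono) simp
        then show ?thesis using True \<open>0 \<le> k\<close> \<open>0 < e\<close> long_tailedD(2)[OF h]
          by (simp add: ennreal_mult' mult_ac)
      next
        case False
        then have "{z<..z + 1} \<inter> ?J = {}" by auto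
        then show ?thesis by (simp only: emeasure_empty mult_zero_right zero_le)
      qed
    qed
    also have "\<dots> = ennreal ((1 + e) * k) * (\<integral>\<^sup>+z\<in>{A - 1<..<x - A}. ennreal (h (x - z)) * ennreal (g z) \<partial>lborel)"
      by (rule nn_integral_cmult) measurable
    finally show "(\<integral>\<^sup>+y\<in>?J. ennreal (h (x - y)) \<partial>m)
      \<le> ennreal ((1 + e) * k) * (\<integral>\<^sup>+z\<in>{A - 1<..<x - A}. ennreal (h (x - z)) * ennreal (g z) \<partial>lborel)" by simp
  qed
qed

lemma middle_part_lower:
  assumes m: "sigma_finite_measure m" "sets m = sets borel" and h: "h \<in> long_tailed"
    and [measurable]: "g \<in> borel_measurable borel" and "0 \<le> k" "0 < e"
    and win: "\<And>z. b \<le> z \<Longrightarrow> ennreal (g z) \<le> ennreal k * emeasure m {z<..z + 1}"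
  shows "\<exists>A1. \<forall>A\<ge>A1. \<forall>x. (\<integral>\<^sup>+z\<in>{A<..<x - A - 1}. ennreal (h (x - z)) * ennreal (g z) \<partial>lborel)
    \<le> ennreal ((1 + e) * k) * middle_part h m A x"
proof -
  note [measurable] = long_tailedD(1)[OF h]
  have [measurable_cong]: "sets m = sets borel" by fact
  obtain A1 where A1: "\<And>u t. A1 \<le> u \<Longrightarrow> \<bar>t\<bar> \<le> 1 \<Longrightarrow> h u \<le> (1 + e) * h (u + t)"
    using long_tailed_unit_shift[OF h \<open>0 < e\<close>] by blast
  show ?thesis
  proof (intro exI[of _ "max (A1 + 1) b"] allI impI)
    fix A x assume A: "max (A1 + 1) b \<le> A"
    let ?J = "{A<..<x - A}"
    have m1: "emeasure m ({z<..z + 1} \<inter> ?J) = emeasure m {z<..z + 1}" if "z \<in> {A<..<x - A - 1}" for z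
      using that by (intro arg_cong[where f="emeasure m"]) auto
    have "(\<integral>\<^sup>+z\<in>{A<..<x - A - 1}. ennreal (h (x - z)) * ennreal (g z) \<partial>lborel)
        \<le> (\<integral>\<^sup>+z. ennreal k * (ennreal (h (x - z)) * emeasure m ({z<..z + 1} \<inter> ?J)) \<partial>lborel)"
    proof (rule nn_integral_mono)
      fix z
      show "ennreal (h (x - z)) * ennreal (g z) * indicator {A<..<x - A - 1} z
        \<le> ennreal k * (ennreal (h (x - z)) * emeasure m ({z<..z + 1} \<inter> ?J))"
      proof (cases "z \<in> {A<..<x - A - 1}")
        case True
        have "ennreal (h (x - z)) * ennreal (g z) \<le> ennreal (h (x - z)) * (ennreal k * emeasure m {z<..z + 1})"
          by (intro mult_left_mono win) (use True A in auto)
        then show ?thesis using True by (simp add: m1[OF True] mult_ac)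
      qed simp
    qed
    also have "\<dots> \<le> ennreal k * (\<integral>\<^sup>+z. ennreal (h (x - z)) * emeasure m ({z<..z + 1} \<inter> ?J) \<partial>lborel)"
      using window_measurable[OF m, of ?J 1] by (subst nn_integral_cmult) auto
    also have "\<dots> \<le> ennreal k * (ennreal 1 * (\<integral>\<^sup>+y\<in>?J. ennreal ((1 + e) * h (x - y)) \<partial>m))"
    proof (intro mult_left_mono smoothing_lower[OF m])
      fix y z assume "y \<in> ?J" "y - 1 \<le> z" "z < y"
      then show "ennreal (h (x - z)) \<le> ennreal ((1 + e) * h (x - y))"
        using A1[of "x - z" "z - y"] A by (auto intro!: ennreal_leI)
    qed auto
    also have "(\<integral>\<^sup>+y\<in>?J. ennreal ((1 + e) * h (x - y)) \<partial>m) = ennreal (1 + e) * (\<integral>\<^sup>+y\<in>?J. ennreal (h (x - y)) \<partial>m)"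
      using \<open>0 < e\<close> by (subst nn_integral_cmult[symmetric]) (auto simp: ennreal_mult' mult.assoc)
    finally show "(\<integral>\<^sup>+z\<in>{A<..<x - A - 1}. ennreal (h (x - z)) * ennreal (g z) \<partial>lborel)
      \<le> ennreal ((1 + e) * k) * (\<integral>\<^sup>+y\<in>?J. ennreal (h (x - y)) \<partial>m)"
      using \<open>0 < e\<close> \<open>0 \<le> k\<close> by (simp add: ennreal_mult' mult_ac)
  qed
qed

lemma long_tailed_average:
  assumes h: "h \<in> long_tailed" and "0 < c" "0 < e"
  shows "\<forall>\<^sub>F x in at_top. ennreal ((1 - e) * c * h x) \<le> (\<integral>\<^sup>+z\<in>{x..<x + c}. ennreal (h z) \<partial>lborel) \<and>
    (\<integral>\<^sup>+z\<in>{x..<x + c}. ennreal (h z) \<partial>lborel) \<le> ennreal ((1 + e) * c * h x)"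
  using long_tailed_uniform[OF h \<open>0 < e\<close>, of c]
proof eventually_elim
  case (elim x)
  have b: "(1 - e) * h x \<le> h z \<and> h z \<le> (1 + e) * h x" if "z \<in> {x..<x + c}" for z
    using elim[THEN conjunct2, rule_format, of "z - x"] that by (auto simp: abs_le_iff algebra_simps)
  have const: "(\<integral>\<^sup>+z. ennreal k * indicator {x..<x + c} z \<partial>lborel) = ennreal (k * c)" for k
    using \<open>0 < c\<close> by (simp add: nn_integral_cmult_indicator ennreal_mult'')
  have "ennreal ((1 - e) * h x * c) \<le> (\<integral>\<^sup>+z\<in>{x..<x + c}. ennreal (h z) \<partial>lborel)"
    unfolding const[symmetric] by (rule nn_integral_mono) (use b in \<open>auto simp: indicator_def intro!: ennreal_leI\<close>)
  moreover have "(\<integral>\<^sup>+z\<in>{x..<x + c}. ennreal (h z) \<partial>lborel) \<le> ennreal ((1 + e) * h x * c)"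
    unfolding const[symmetric] by (rule nn_integral_mono) (use b in \<open>auto simp: indicator_def intro!: ennreal_leI\<close>)
  ultimately show ?case by (simp add: mult_ac)
qed

text \<open>
  Both sides integrate, against \<open>m\<close>, the length of an intersection of two intervals, and this length is symmetric in \<open>c\<close> and
  \<open>d\<close>.
\<close>

lemma window_average_swap:
  fixes m :: "real measure"
  assumes m: "finite_measure m" "sets m = sets borel" and "0 < c" "0 < d"
  shows "(\<integral>\<^sup>+z\<in>{x..<x + d}. ennreal (measure m {z<..z + c}) \<partial>lborel)
    = (\<integral>\<^sup>+z\<in>{x..<x + c}. ennreal (measure m {z<..z + d}) \<partial>lborel)"
proof -
  interpret finite_measure m by fact
  have eq: "(\<integral>\<^sup>+z\<in>{x..<x + d}. ennreal (measure m {z<..z + c}) \<partial>lborel)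
      = (\<integral>\<^sup>+y. emeasure lborel ({x..<x + d} \<inter> {y - c..<y}) \<partial>m)" for c d
  proof -
    have "(\<integral>\<^sup>+y. emeasure lborel ({x..<x + d} \<inter> {y - c..<y}) \<partial>m)
        = (\<integral>\<^sup>+y\<in>UNIV. (\<integral>\<^sup>+z\<in>{y - c..<y}. indicator {x..<x + d} z \<partial>lborel) \<partial>m)"
      by (intro nn_integral_cong) (simp add: indicator_inter_arith[symmetric] Int_commute)
    also have "\<dots> = (\<integral>\<^sup>+z. indicator {x..<x + d} z * emeasure m ({z<..z + c} \<inter> UNIV) \<partial>lborel)"
      by (rule smoothing_identity) (auto simp: m(2) sigma_finite_measure_axioms)
    finally show ?thesis by (simp add: emeasure_eq_measure mult.commute)
  qed
  have len: "emeasure lborel ({x..<x + d} \<inter> {y - c..<y}) = ennreal (max 0 (min (y - x) d + min (y - x) c - (y - x)))" for c d y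
  proof -
    have "{x..<x + d} \<inter> {y - c..<y} = {max x (y - c)..<min (x + d) y}" by auto
    moreover have "min (x + d) y - max x (y - c) = min (y - x) d + min (y - x) c - (y - x)"
      by (auto simp: min_def max_def)
    ultimately show ?thesis
      by (cases "max x (y - c) \<le> min (x + d) y") (auto simp: max_def)
  qed
  show ?thesis
    unfolding eq len by (simp add: add.commute)
qed

text \<open>
  By the uniform slow variation of windows, the two sides of the preceding exchange with \<open>d = 1\<close> are asymptotic to the window
  of length \<open>c\<close> and to \<open>c\<close> times the window of length one.
\<close>

lemma window_linear:
  assumes m: "finite_measure m" "sets m = sets borel"
    and lt: "\<And>c. 0 < c \<Longrightarrow> (\<lambda>x. measure m {x<..x + c}) \<in> long_tailed" and "0 < c"
  shows "(\<lambda>x. measure m {x<..x + c}) \<simeq> (\<lambda>x. c * measure m {x<..x + 1})"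
  unfolding asymp_pos_iff
proof (intro conjI allI impI)
  let ?R = "\<lambda>c x. measure m {x<..x + c}"
  have pos: "\<forall>\<^sub>F x in at_top. 0 < ?R 1 x" using long_tailedD(4)[OF lt[of 1]] by simp
  then show "\<forall>\<^sub>F x in at_top. 0 < c * ?R 1 x" using \<open>0 < c\<close> by (auto elim: eventually_mono)
  fix e :: real assume "0 < e"
  define d where "d = min (1 / 2) (e / 4)"
  have d: "0 < d" "d \<le> 1 / 2" "4 * d \<le> e" using \<open>0 < e\<close> by (auto simp: d_def)
  show "\<forall>\<^sub>F x in at_top. \<bar>?R c x - c * ?R 1 x\<bar> \<le> e * (c * ?R 1 x)"
    using long_tailed_average[OF lt[OF \<open>0 < c\<close>] zero_less_one d(1)]
      long_tailed_average[OF lt[OF zero_less_one] \<open>0 < c\<close> d(1)] pos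
  proof eventually_elim
    case (elim x)
    note swap = window_average_swap[OF m \<open>0 < c\<close> zero_less_one, of x]
    have "ennreal ((1 - d) * 1 * ?R c x) \<le> ennreal ((1 + d) * c * ?R 1 x)"
      using elim(1)[THEN conjunct1] elim(2)[THEN conjunct2] unfolding swap by (rule order_trans)
    then have 1: "(1 - d) * ?R c x \<le> (1 + d) * (c * ?R 1 x)"
      using d \<open>0 < c\<close> by (simp add: mult.assoc)
    have "ennreal ((1 - d) * c * ?R 1 x) \<le> ennreal ((1 + d) * 1 * ?R c x)"
      using elim(2)[THEN conjunct1] elim(1)[THEN conjunct2] unfolding swap by (rule order_trans)
    then have 2: "(1 - d) * (c * ?R 1 x) \<le> (1 + d) * ?R c x"
      using d \<open>0 < c\<close> by (simp add: mult.assoc)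
    define X Y where "X = ?R c x" and "Y = c * ?R 1 x"
    have XY: "0 \<le> X" "0 < Y" "(1 - d) * X \<le> (1 + d) * Y" "(1 - d) * Y \<le> (1 + d) * X"
      using 1 2 elim(3) \<open>0 < c\<close> by (auto simp: X_def Y_def)
    have "(1 + d) * Y \<le> (1 - d) * ((1 + 4 * d) * Y)"
    proof -
      have "(1 - d) * (1 + 4 * d) = 1 + d + 2 * d * (1 - 2 * d)" by (simp add: algebra_simps)
      then have "1 + d \<le> (1 - d) * (1 + 4 * d)" using d by (simp add: mult_nonneg_nonneg)
      then show ?thesis using XY(2) mult_right_mono[of "1 + d" "(1 - d) * (1 + 4 * d)" Y] by (simp add: mult.assoc)
    qed
    then have "(1 - d) * X \<le> (1 - d) * ((1 + 4 * d) * Y)" using XY(3) by linarith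
    then have u: "X \<le> (1 + 4 * d) * Y" using d by (simp add: mult_le_cancel_left)
    have "(1 + d) * ((1 - 2 * d) * Y) \<le> (1 - d) * Y"
    proof -
      have "(1 + d) * (1 - 2 * d) \<le> 1 - d" using d by (simp add: algebra_simps)
      then show ?thesis using XY(2) mult_right_mono[of "(1 + d) * (1 - 2 * d)" "1 - d" Y] by (simp add: mult.assoc)
    qed
    then have "(1 + d) * ((1 - 2 * d) * Y) \<le> (1 + d) * X" using XY(4) by linarith
    then have l: "(1 - 2 * d) * Y \<le> X" using d by (simp add: mult_le_cancel_left)
    have "4 * d * Y \<le> e * Y" "2 * d * Y \<le> e * Y" using d XY(2) by (auto intro!: mult_right_mono)
    then have "\<bar>X - Y\<bar> \<le> e * Y" using u l by (auto simp: abs_le_iff algebra_simps)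
    then show ?case by (simp add: X_def Y_def)
  qed
qed

lemma ennreal_add_geD:
  assumes "ennreal c \<le> ennreal d + M" "0 \<le> d"
  shows "ennreal (c - d) \<le> M"
proof (cases M)
  case (real r)
  then show ?thesis using assms by (auto simp flip: ennreal_plus intro!: ennreal_leI)
qed auto

lemma ennreal_mult_le_cancelD:
  assumes "ennreal d * M \<le> ennreal (d * c)" "0 < d"
  shows "M \<le> ennreal c"
proof (cases M)
  case (real r)
  then have "ennreal (d * r) \<le> ennreal (d * c)" using assms by (simp add: ennreal_mult)
  then have "d * r \<le> d * c \<or> d * r \<le> 0" using real assms by (auto simp: ennreal_le_iff2)
  then show ?thesis using real assms
    by (auto simp: mult_le_0_iff intro: ennreal_leI)
qed (use assms in \<open>auto simp: ennreal_mult_top top_unique\<close>)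

lemma ennreal_mult_ge_cancelD:
  assumes "ennreal (d * c) \<le> ennreal d * M" "0 < d"
  shows "ennreal c \<le> M"
proof (cases M)
  case (real r)
  then have "ennreal (d * c) \<le> ennreal (d * r)" using assms by (simp add: ennreal_mult)
  then have "d * c \<le> d * r" using real assms by (simp add: ennreal_le_iff)
  then show ?thesis using real assms by (auto intro: ennreal_leI)
qed auto

lemma loc_long_tailedD:
  "\<rho> \<in> loc_long_tailed \<Longrightarrow> 0 < c \<Longrightarrow> (\<lambda>x. measure \<rho> {x<..x + c}) \<in> long_tailed"
  by (simp add: loc_long_tailed_def)

section \<open>A density and its Levy measure\<close>

text \<open>
  The setting of the asymptotic part. It keeps from infinite divisibility only Steutel's identity; the factorization of
  the law enters separately, through its characteristic function.
\<close>

locale steutel_density = levy_measure \<nu> for \<nu> +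
  fixes p :: "real \<Rightarrow> real"
  assumes p_cont: "continuous_on UNIV p"
    and p_nonneg: "\<And>x. 0 \<le> p x"
    and p_nonpos: "\<And>x. x \<le> 0 \<Longrightarrow> p x = 0"
    and p_int: "(\<integral>\<^sup>+x. ennreal (p x) \<partial>lborel) = 1"
    and steutel: "\<And>x. ennreal (x * p x) = (\<integral>\<^sup>+y. ennreal (p (x - y)) * ennreal y \<partial>\<nu>)"
    and nu_tail: "\<And>c. 0 < c \<Longrightarrow> 0 < emeasure \<nu> {c<..}"
begin

lemma p_borel [measurable]: "p \<in> borel_measurable borel"
  by (rule borel_measurable_continuous_onI[OF p_cont])

definition \<mu> :: "real measure" where "\<mu> = density lborel (\<lambda>x. ennreal (p x))"

lemma sets_mu [simp, measurable_cong]: "sets \<mu> = sets borel" by (simp add: \<mu>_def)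

lemma mu_distribution: "real_distribution \<mu>"
  by (rule real_distributionI)
    (auto simp: \<mu>_def emeasure_density p_int intro!: prob_spaceI)

lemma p_nonzeroD: "p x \<noteq> 0 \<Longrightarrow> 0 < x"
  using p_nonpos[of x] by (meson not_le)

lemma mu_pos: "AE x in \<mu>. 0 \<le> x"
  unfolding \<mu>_def 
proof (subst AE_density)
  have "0 \<le> x" if "0 < ennreal (p x)" for x
    using that p_nonzeroD[of x] by (cases "p x = 0") auto
  then show "AE x in lborel. 0 < ennreal (p x) \<longrightarrow> 0 \<le> x" by simp
qed simp

lemma mu_half_line: "half_line_distribution \<mu>"
  by (rule half_line_distributionI[OF mu_distribution mu_pos])

lemma nn_integral_mu: "f \<in> borel_measurable borel \<Longrightarrow> (\<integral>\<^sup>+x. f x \<partial>\<mu>) = (\<integral>\<^sup>+x. ennreal (p x) * f x \<partial>lborel)"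
  unfolding \<mu>_def by (rule nn_integral_density) auto

definition win :: "real \<Rightarrow> real" where "win x = measure \<nu> {x<..x + 1}"

lemma nu_finite: "0 < d \<Longrightarrow> B \<subseteq> {d<..} \<Longrightarrow> emeasure \<nu> B < \<infinity>"
  using finite_tail[of d] emeasure_mono[of B "{d<..}" \<nu>] by (auto intro: le_less_trans)

lemma nu_measure: "0 < d \<Longrightarrow> B \<subseteq> {d<..} \<Longrightarrow> emeasure \<nu> B = ennreal (measure \<nu> B)"
  using nu_finite[of d B] by (intro emeasure_eq_ennreal_measure) auto

lemma nu_window: "0 < x \<Longrightarrow> emeasure \<nu> {x<..x + c} = ennreal (measure \<nu> {x<..x + c})"
  by (rule nu_measure[of x]) auto

lemma nu_unit_window: "0 < x \<Longrightarrow> emeasure \<nu> {x<..x + 1} = ennreal (win x)"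
  unfolding win_def by (rule nu_window)

lemma win_nonneg: "0 \<le> win x" by (simp add: win_def)

lemma win_borel [measurable]: "win \<in> borel_measurable borel"
proof -
  have "(\<lambda>x. enn2real (emeasure \<nu> ({x<..x + 1} \<inter> UNIV))) \<in> borel_measurable borel"
    by (intro borel_measurable_enn2real window_measurable) (auto simp: sigma_finite_nu)
  then show ?thesis by (simp add: win_def[abs_def] measure_def)
qed

definition tail_mass :: real where "tail_mass = measure \<nu> {1<..}"

lemma lambda_pos: "0 < tail_mass" and lambda: "emeasure \<nu> {1<..} = ennreal tail_mass"
proof -
  show *: "emeasure \<nu> {1<..} = ennreal tail_mass" unfolding tail_mass_def by (rule nu_measure[of 1]) auto
  show "0 < tail_mass" using nu_tail[of 1] unfolding * by simp
qed

abbreviation \<rho> :: "real measure" where "\<rho> \<equiv> normalized_levy \<nu>"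

lemma sets_rho [simp, measurable_cong]: "sets \<rho> = sets borel" by (simp add: normalized_levy_def)

lemma nn_integral_rho:
  assumes [measurable]: "f \<in> borel_measurable borel"
  shows "(\<integral>\<^sup>+x. f x \<partial>\<rho>) = ennreal (1 / tail_mass) * (\<integral>\<^sup>+x\<in>{1<..}. f x \<partial>\<nu>)"
proof -
  have "indicator {1<..} x / emeasure \<nu> {1<..} = ennreal (1 / tail_mass) * indicator {1<..} x" for x :: real
    unfolding lambda using lambda_pos by (auto simp: indicator_def divide_ennreal[symmetric])
  then have "(\<integral>\<^sup>+x. f x \<partial>\<rho>) = (\<integral>\<^sup>+x. ennreal (1 / tail_mass) * (f x * indicator {1<..} x) \<partial>\<nu>)"
    unfolding normalized_levy_def by (subst nn_integral_density) (auto simp: mult_ac)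
  also have "\<dots> = ennreal (1 / tail_mass) * (\<integral>\<^sup>+x\<in>{1<..}. f x \<partial>\<nu>)"
    by (rule nn_integral_cmult) measurable
  finally show ?thesis .
qed

lemma emeasure_rho:
  assumes [measurable]: "B \<in> sets borel"
  shows "emeasure \<rho> B = ennreal (1 / tail_mass) * emeasure \<nu> (B \<inter> {1<..})"
proof -
  have "emeasure \<rho> B = (\<integral>\<^sup>+x. indicator B x \<partial>\<rho>)" by simp
  also have "\<dots> = ennreal (1 / tail_mass) * (\<integral>\<^sup>+x. indicator B x * indicator {1<..} x \<partial>\<nu>)"
    by (rule nn_integral_rho) simp
  also have "\<dots> = ennreal (1 / tail_mass) * emeasure \<nu> (B \<inter> {1<..})"
    unfolding indicator_inter_arith[symmetric] by simp
  finally show ?thesis .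
qed

lemma rho_distribution: "real_distribution \<rho>"
proof (rule real_distributionI)
  have "space \<rho> = UNIV" by (simp add: normalized_levy_def)
  then show "prob_space \<rho>"
    using lambda_pos by (intro prob_spaceI) (simp add: emeasure_rho lambda ennreal_mult[symmetric])
qed simp

lemma rho_half_line: "half_line_distribution \<rho>"
proof -
  have "{..<0} \<inter> {1<..} = ({} :: real set)" by auto
  then show ?thesis
    using rho_distribution by (simp add: half_line_distribution_def emeasure_rho)
qed

lemma rho_window: "1 \<le> x \<Longrightarrow> measure \<nu> {x<..x + c} = tail_mass * measure \<rho> {x<..x + c}"
proof -
  assume x: "1 \<le> x"
  have "{x<..x + c} \<inter> {1<..} = {x<..x + c}" using x by auto
  then have "emeasure \<rho> {x<..x + c} = ennreal (1 / tail_mass * measure \<nu> {x<..x + c})"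
    using x lambda_pos by (simp add: emeasure_rho nu_window ennreal_mult[symmetric])
  then have "measure \<rho> {x<..x + c} = 1 / tail_mass * measure \<nu> {x<..x + c}"
    using lambda_pos unfolding measure_def by (simp add: measure_nonneg)
  then show ?thesis using lambda_pos by simp
qed

definition \<sigma> :: "real measure" where "\<sigma> = density \<nu> (\<lambda>y. ennreal y)"

lemma sets_sigma [simp, measurable_cong]: "sets \<sigma> = sets borel" by (simp add: \<sigma>_def)

lemma space_sigma [simp]: "space \<sigma> = UNIV" by (simp add: \<sigma>_def)

lemma emeasure_sigma: "B \<in> sets borel \<Longrightarrow> emeasure \<sigma> B = (\<integral>\<^sup>+y\<in>B. ennreal y \<partial>\<nu>)"
  unfolding \<sigma>_def by (rule emeasure_density) auto

lemma nn_integral_sigma: "f \<in> borel_measurable borel \<Longrightarrow> (\<integral>\<^sup>+y. f y \<partial>\<sigma>) = (\<integral>\<^sup>+y. ennreal y * f y \<partial>\<nu>)"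
  unfolding \<sigma>_def by (rule nn_integral_density) auto

lemma sigma_pos: "AE y in \<sigma>. 0 < y"
  unfolding \<sigma>_def using AE_pos by (simp add: AE_density)

lemma sigma_nonneg: "AE y in \<sigma>. 0 \<le> y"
  using sigma_pos by eventually_elim simp

lemma sigma_finite_below: "emeasure \<sigma> {..R} < \<infinity>"
proof -
  have "emeasure \<sigma> {..R} = (\<integral>\<^sup>+y\<in>{0<..R}. ennreal y \<partial>\<nu>)"
    by (subst emeasure_sigma, simp)
      (rule nn_integral_cong_AE, use AE_pos in eventually_elim, auto simp: indicator_def)
  then show ?thesis using finite_small by simp
qed

lemma sigma_bounded: "B \<subseteq> {..R} \<Longrightarrow> emeasure \<sigma> B < \<infinity>"
  using sigma_finite_below[of R] emeasure_mono[of B "{..R}" \<sigma>] by (auto intro: le_less_trans)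

lemma sigma_finite_sigma: "sigma_finite_measure \<sigma>"
proof
  have "\<Union> (range (\<lambda>n::nat. {..real n})) = UNIV" using real_arch_simple by auto
  then show "\<exists>A. countable A \<and> A \<subseteq> sets \<sigma> \<and> \<Union> A = space \<sigma> \<and> (\<forall>B\<in>A. emeasure \<sigma> B \<noteq> \<infinity>)"
    using sigma_finite_below by (intro exI[of _ "range (\<lambda>n::nat. {..real n})"]) (auto simp: less_top[symmetric])
qed

lemma steutel_sigma: "ennreal (x * p x) = (\<integral>\<^sup>+y. ennreal (p (x - y)) \<partial>\<sigma>)"
  unfolding steutel by (subst nn_integral_sigma) (auto simp: mult.commute)

lemma nn_integral_sigma_upper:
  assumes [measurable]: "f \<in> borel_measurable borel" "B \<in> sets borel" and B: "\<And>y. y \<in> B \<Longrightarrow> f y \<noteq> 0 \<Longrightarrow> y \<le> v"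
  shows "(\<integral>\<^sup>+y\<in>B. f y \<partial>\<sigma>) \<le> ennreal v * (\<integral>\<^sup>+y\<in>B. f y \<partial>\<nu>)"
proof -
  have "(\<integral>\<^sup>+y\<in>B. f y \<partial>\<sigma>) = (\<integral>\<^sup>+y. ennreal y * (f y * indicator B y) \<partial>\<nu>)"
    by (rule nn_integral_sigma) measurable
  also have "\<dots> \<le> (\<integral>\<^sup>+y. ennreal v * (f y * indicator B y) \<partial>\<nu>)"
  proof (rule nn_integral_mono)
    fix y
    show "ennreal y * (f y * indicator B y) \<le> ennreal v * (f y * indicator B y)"
      using B[of y] by (cases "y \<in> B"; cases "f y = 0") (simp_all add: mult_right_mono ennreal_leI)
  qed
  also have "\<dots> = ennreal v * (\<integral>\<^sup>+y\<in>B. f y \<partial>\<nu>)"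
    by (rule nn_integral_cmult) measurable
  finally show ?thesis .
qed

lemma nn_integral_sigma_lower:
  assumes [measurable]: "f \<in> borel_measurable borel" "B \<in> sets borel" and B: "\<And>y. y \<in> B \<Longrightarrow> f y \<noteq> 0 \<Longrightarrow> u \<le> y"
  shows "ennreal u * (\<integral>\<^sup>+y\<in>B. f y \<partial>\<nu>) \<le> (\<integral>\<^sup>+y\<in>B. f y \<partial>\<sigma>)"
proof -
  have "ennreal u * (\<integral>\<^sup>+y\<in>B. f y \<partial>\<nu>) = (\<integral>\<^sup>+y. ennreal u * (f y * indicator B y) \<partial>\<nu>)"
    by (rule nn_integral_cmult[symmetric]) measurable
  also have "\<dots> \<le> (\<integral>\<^sup>+y. ennreal y * (f y * indicator B y) \<partial>\<nu>)"
  proof (rule nn_integral_mono)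
    fix y
    show "ennreal u * (f y * indicator B y) \<le> ennreal y * (f y * indicator B y)"
      using B[of y] by (cases "y \<in> B"; cases "f y = 0") (simp_all add: mult_right_mono ennreal_leI)
  qed
  also have "\<dots> = (\<integral>\<^sup>+y\<in>B. f y \<partial>\<sigma>)"
    by (rule nn_integral_sigma[symmetric]) measurable
  finally show ?thesis .
qed

lemma sigma_window_upper: "emeasure \<sigma> {x<..x + c} \<le> ennreal (x + c) * emeasure \<nu> {x<..x + c}"
  using nn_integral_sigma_upper[of "\<lambda>_. 1" "{x<..x + c}" "x + c"] by simp

lemma sigma_window_lower: "ennreal x * emeasure \<nu> {x<..x + c} \<le> emeasure \<sigma> {x<..x + c}"
  using nn_integral_sigma_lower[of "\<lambda>_. 1" "{x<..x + c}" x] by simp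

lemma steutel_split:
  assumes "0 < A" "2 * A < x"
  shows "ennreal (x * p x) = near_part p \<sigma> A x
    + middle_part p \<sigma> A x + far_part p \<sigma> A x"
  unfolding steutel_sigma by (rule nn_integral_split3) (use assms sigma_nonneg in auto)

lemma far_part_sigma:
  assumes "0 < A" "A < x"
  shows "far_part p \<sigma> A x \<le> ennreal x * far_part p \<nu> A x"
    and "ennreal (x - A) * far_part p \<nu> A x \<le> far_part p \<sigma> A x"
proof -
  have y_le: "y \<le> x" if "ennreal (p (x - y)) \<noteq> 0" for y
    using that p_nonzeroD[of "x - y"] by (cases "p (x - y) = 0") auto
  show "far_part p \<sigma> A x \<le> ennreal x * far_part p \<nu> A x"
    by (rule nn_integral_sigma_upper) (use y_le in auto)
  show "ennreal (x - A) * far_part p \<nu> A x \<le> far_part p \<sigma> A x"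
    by (rule nn_integral_sigma_lower) auto
qed

lemma p_local_bound: "\<exists>b>0. \<forall>x\<le>R. p x \<le> b"
proof -
  have "bounded (p ` {0..max 0 R})"
    by (intro compact_imp_bounded compact_continuous_image) (use p_cont in \<open>auto intro: continuous_on_subset\<close>)
  then obtain b where b: "0 < b" "\<forall>u\<in>p ` {0..max 0 R}. norm u \<le> b"
    unfolding bounded_pos by blast
  have "p x \<le> b" if "x \<le> R" for x
  proof (cases "x \<le> 0")
    case False
    then have "norm (p x) \<le> b" using that b(2) by auto
    then show ?thesis by simp
  qed (use p_nonpos b in auto)
  then show ?thesis using b(1) by blast
qed

lemma windows_uniform:
  assumes L: "\<rho> \<in> loc_long_tailed" and "0 < d" "0 < e"
  shows "\<forall>\<^sub>F x in at_top. 0 < win x \<and> (\<forall>z. \<bar>z - x\<bar> \<le> A \<longrightarrow> \<bar>measure \<nu> {z<..z + d} - d * win x\<bar> \<le> e * (d * win x))"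
proof -
  define h where "h = min 1 (e / 3)"
  have h: "0 < h" "h \<le> 1" "3 * h \<le> e" using \<open>0 < e\<close> by (auto simp: h_def)
  interpret rho: real_distribution \<rho> by (rule rho_distribution)
  have "(\<lambda>x. measure \<rho> {x<..x + d}) \<simeq> (\<lambda>x. d * measure \<rho> {x<..x + 1})"
    by (rule window_linear[OF rho.finite_measure_axioms sets_rho loc_long_tailedD[OF L] \<open>0 < d\<close>])
  then have lin: "\<forall>\<^sub>F x in at_top. \<bar>measure \<rho> {x<..x + d} - d * measure \<rho> {x<..x + 1}\<bar> \<le> h * (d * measure \<rho> {x<..x + 1})"
    using h(1) unfolding asymp_pos_iff by blast
  have pos: "\<forall>\<^sub>F x in at_top. 0 < measure \<rho> {x<..x + 1}" using long_tailedD(4)[OF loc_long_tailedD[OF L, of 1]] by simp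
  show ?thesis
    using lin long_tailed_uniform[OF loc_long_tailedD[OF L \<open>0 < d\<close>] h(1), of A] pos eventually_ge_at_top[of "1 + \<bar>A\<bar>"]
  proof eventually_elim
    case (elim x)
    have ax: "win x = tail_mass * measure \<rho> {x<..x + 1}" unfolding win_def using elim(4) by (intro rho_window) auto
    have "\<bar>measure \<nu> {z<..z + d} - d * win x\<bar> \<le> e * (d * win x)" if "\<bar>z - x\<bar> \<le> A" for z
    proof -
      define X Y Z where "X = measure \<rho> {z<..z + d}" and "Y = measure \<rho> {x<..x + d}" and "Z = d * measure \<rho> {x<..x + 1}"
      have XY: "\<bar>X - Y\<bar> \<le> h * Y" using elim(2)[THEN conjunct2, rule_format, OF that] by (simp add: X_def Y_def)
      have YZ: "\<bar>Y - Z\<bar> \<le> h * Z" using elim(1) by (simp add: Y_def Z_def)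
      have Z0: "0 \<le> Z" using \<open>0 < d\<close> by (simp add: Z_def)
      have "Y \<le> 2 * Z" using YZ mult_right_mono[OF h(2) Z0] by linarith
      then have "h * Y \<le> h * (2 * Z)" using h(1) by (intro mult_left_mono) auto
      then have "\<bar>X - Z\<bar> \<le> 3 * h * Z" using XY YZ by linarith
      also have "\<dots> \<le> e * Z" using h(3) Z0 by (intro mult_right_mono)
      finally have "tail_mass * \<bar>X - Z\<bar> \<le> tail_mass * (e * Z)" using lambda_pos by (intro mult_left_mono) auto
      moreover have "measure \<nu> {z<..z + d} = tail_mass * X"
        unfolding X_def using elim(4) that by (intro rho_window) auto
      moreover have "d * win x = tail_mass * Z" by (simp add: ax Z_def)
      moreover have "\<bar>tail_mass * X - tail_mass * Z\<bar> = tail_mass * \<bar>X - Z\<bar>"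
        using lambda_pos by (simp add: right_diff_distrib[symmetric] abs_mult)
      ultimately show ?thesis by (simp only: mult.left_commute[of e])
    qed
    moreover have "0 < win x" using elim(3) lambda_pos by (simp add: ax)
    ultimately show ?case by blast
  qed
qed

lemma win_rho_asymp:
  assumes L: "\<rho> \<in> loc_long_tailed"
  shows "win \<simeq> (\<lambda>x. tail_mass * measure \<rho> {x<..x + 1})"
proof (rule asymp_pos_cong)
  show "(\<lambda>x. tail_mass * measure \<rho> {x<..x + 1}) \<simeq> (\<lambda>x. tail_mass * measure \<rho> {x<..x + 1})"
    using long_tailedD(4)[OF long_tailed_cmult[OF loc_long_tailedD[OF L, of 1] lambda_pos]] by (intro asymp_pos_refl) simp
  show "\<forall>\<^sub>F x in at_top. tail_mass * measure \<rho> {x<..x + 1} = win x"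
    using eventually_ge_at_top[of 1] by eventually_elim (simp add: win_def rho_window)
qed simp

lemma win_long_tailed:
  assumes L: "\<rho> \<in> loc_long_tailed"
  shows "win \<in> long_tailed"
  by (rule long_tailed_asymp[OF long_tailed_cmult[OF loc_long_tailedD[OF L, of 1] lambda_pos] win_rho_asymp[OF L]])
    (auto simp: win_nonneg)

text \<open>
  At a bounded distance from \<open>x\<close> the measure \<open>\<nu>\<close> behaves like \<open>win x\<close> times Lebesgue measure, so the far part is
  about \<open>win x\<close> times the integral of \<open>p\<close> over \<open>[0, A]\<close>. As \<open>p\<close> is only continuous near zero, and not slowly varying,
  smoothing is done with short windows and an additive error from uniform continuity.
\<close>

lemma far_part_window:
  assumes L: "\<rho> \<in> loc_long_tailed" and "0 < e"
  shows "\<exists>A0. \<forall>A\<ge>A0. \<forall>\<^sub>F x in at_top.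
    ennreal ((1 - e) * win x) \<le> far_part p \<nu> A x \<and>
    far_part p \<nu> A x \<le> ennreal ((1 + e) * win x)"
proof -
  define e' where "e' = min e (1 / 2)"
  have e': "0 < e'" "e' \<le> e" "e' \<le> 1 / 2" using \<open>0 < e\<close> by (auto simp: e'_def)
  obtain A0 where A0: "\<And>A. A0 \<le> A \<Longrightarrow> ennreal (1 - e' / 4) \<le> emeasure \<mu> {0..A}"
    using distribution_mass[OF mu_distribution mu_pos, of "e' / 4"] e' by (auto simp: eventually_at_top_linorder)
  show ?thesis
  proof (intro exI[of _ "max A0 1"] allI impI)
    fix A assume A: "max A0 1 \<le> A"
    define h where "h = e' / (8 * (A + 2))"
    have h: "0 < h" "h * (A + 2) = e' / 8" using e' A by (auto simp: h_def field_simps)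
    have "h * A \<le> h * (A + 2)" "h * (A + 1) \<le> h * (A + 2)" "h * 1 \<le> h * (A + 2)"
      using h(1) A by (intro mult_left_mono; simp)+
    then have hA: "h * A \<le> e' / 8" "h * (A + 1) \<le> e' / 8" "h \<le> e' / 8" "h \<le> 1"
      using e' unfolding h(2) by simp_all
    have "uniformly_continuous_on {-1..A + 2} p"
      by (rule compact_uniformly_continuous) (use p_cont in \<open>auto intro: continuous_on_subset\<close>)
    then obtain \<delta>' where \<delta>': "0 < \<delta>'" "\<And>u v. u \<in> {-1..A + 2} \<Longrightarrow> v \<in> {-1..A + 2} \<Longrightarrow> \<bar>u - v\<bar> < \<delta>' \<Longrightarrow> \<bar>p u - p v\<bar> < h"
      unfolding uniformly_continuous_on_def dist_real_def using h(1) by metis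
    define \<delta> where "\<delta> = min (\<delta>' / 2) 1"
    have \<delta>: "0 < \<delta>" "\<delta> < \<delta>'" "\<delta> \<le> 1" using \<delta>'(1) by (auto simp: \<delta>_def)
    have uc: "\<bar>p u - p v\<bar> \<le> h" if "u \<in> {-1..A + 2}" "v \<in> {-1..A + 2}" "\<bar>u - v\<bar> \<le> \<delta>" for u v
      using \<delta>'(2)[of u v] that \<delta> by simp
    (* The restriction to z <= x - delta costs only the values of p on [0, delta], small because p vanishes at 0. *)
    have p_small: "p u \<le> h" if "0 \<le> u" "u \<le> \<delta>" for u
      using uc[of u 0] that \<delta> A p_nonpos[of 0] by simp
    show "\<forall>\<^sub>F x in at_top. ennreal ((1 - e) * win x) \<le> far_part p \<nu> A x \<and>
      far_part p \<nu> A x \<le> ennreal ((1 + e) * win x)"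
      using windows_uniform[OF L \<delta>(1) h(1), of "A + 1"] eventually_ge_at_top[of "A + 3"]
    proof eventually_elim
      case (elim x)
      have ax: "0 < win x" using elim by blast
      have w: "\<bar>measure \<nu> {z<..z + \<delta>} - \<delta> * win x\<bar> \<le> h * (\<delta> * win x)" if "\<bar>z - x\<bar> \<le> A + 1" for z
        using elim that by blast
      have wu: "emeasure \<nu> {z<..z + \<delta>} \<le> ennreal ((1 + h) * (\<delta> * win x))" if "\<bar>z - x\<bar> \<le> A + 1" for z
        using w[OF that] that elim(2) by (subst nu_window) (auto intro!: ennreal_leI simp: algebra_simps abs_le_iff)
      have wl: "ennreal ((1 - h) * (\<delta> * win x)) \<le> emeasure \<nu> {z<..z + \<delta>}" if "\<bar>z - x\<bar> \<le> A + 1" for z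
        using w[OF that] that elim(2) by (subst nu_window) (auto intro!: ennreal_leI simp: algebra_simps abs_le_iff)
      define J where "J = {x - A..x}"
      have [measurable]: "J \<in> sets borel" by (simp add: J_def)
      define I where "I = (\<integral>\<^sup>+y\<in>J. ennreal (p (x - y)) \<partial>\<nu>)"
      have I: "far_part p \<nu> A x = I"
        unfolding I_def by (intro nn_integral_cong) (auto simp: J_def indicator_def p_nonpos)
      have "ennreal \<delta> * I \<le> (\<integral>\<^sup>+z. ennreal (p (x - z) + h) * emeasure \<nu> ({z<..z + \<delta>} \<inter> J) \<partial>lborel)"
        unfolding I_def
      proof (rule smoothing_upper[OF sigma_finite_nu])
        fix y z assume "y \<in> J" "y - \<delta> \<le> z" "z < y"
        then show "ennreal (p (x - y)) \<le> ennreal (p (x - z) + h)"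
          using uc[of "x - y" "x - z"] \<delta> by (intro ennreal_leI) (auto simp: J_def abs_le_iff)
      qed (use \<delta> in auto)
      also have "\<dots> \<le> (\<integral>\<^sup>+z. ennreal ((1 + h) * (\<delta> * win x)) * (ennreal (p (x - z)) + ennreal h * indicator {x - A - 1..x} z) \<partial>lborel)"
      proof (rule nn_integral_mono)
        fix z
        show "ennreal (p (x - z) + h) * emeasure \<nu> ({z<..z + \<delta>} \<inter> J)
          \<le> ennreal ((1 + h) * (\<delta> * win x)) * (ennreal (p (x - z)) + ennreal h * indicator {x - A - 1..x} z)"
        proof (cases "z \<in> {x - A - 1..x}")
          case True
          have "emeasure \<nu> ({z<..z + \<delta>} \<inter> J) \<le> emeasure \<nu> {z<..z + \<delta>}" by (rule emeasure_mono) auto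
          also have "\<dots> \<le> ennreal ((1 + h) * (\<delta> * win x))" using True A by (intro wu) auto
          finally have "ennreal (p (x - z) + h) * emeasure \<nu> ({z<..z + \<delta>} \<inter> J)
            \<le> ennreal (p (x - z) + h) * ennreal ((1 + h) * (\<delta> * win x))" by (rule mult_left_mono) simp
          also have "\<dots> = ennreal ((1 + h) * (\<delta> * win x)) * (ennreal (p (x - z)) + ennreal h)"
            using p_nonneg h by (simp add: mult.commute)
          finally show ?thesis using True by simp
        next
          case False
          then have "{z<..z + \<delta>} \<inter> J = {}" using \<delta> by (auto simp: J_def)
          then show ?thesis by (simp only: emeasure_empty mult_zero_right zero_le)
        qed
      qed
      also have "\<dots> = ennreal ((1 + h) * (\<delta> * win x)) * ((\<integral>\<^sup>+z. ennreal (p (x - z)) \<partial>lborel) + ennreal h * emeasure lborel {x - A - 1..x})"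
        by (subst nn_integral_cmult, simp, subst nn_integral_add) (auto simp: nn_integral_cmult_indicator)
      also have "(\<integral>\<^sup>+z. ennreal (p (x - z)) \<partial>lborel) = 1"
        using p_int by (subst (asm) nn_integral_real_affine[where c="-1" and t=x]) auto
      also have "1 + ennreal h * emeasure lborel {x - A - 1..x} = ennreal (1 + h * (A + 1))"
        using h A by (simp add: ennreal_mult[symmetric] algebra_simps flip: ennreal_1 ennreal_plus)
      also have "ennreal ((1 + h) * (\<delta> * win x)) * ennreal (1 + h * (A + 1)) = ennreal (\<delta> * ((1 + h) * (1 + h * (A + 1)) * win x))"
        using h A \<delta> ax by (subst ennreal_mult[symmetric]) (auto simp: mult_ac)
      finally have "I \<le> ennreal ((1 + h) * (1 + h * (A + 1)) * win x)"
        using \<delta>(1) by (rule ennreal_mult_le_cancelD)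
      also have "\<dots> \<le> ennreal ((1 + e) * win x)"
      proof (intro ennreal_leI mult_right_mono)
        have "(1 + h) * (1 + h * (A + 1)) = 1 + h * (A + 2) + h * (h * (A + 1))" by (simp add: algebra_simps)
        also have "h * (h * (A + 1)) \<le> 1 * (e' / 8)" using hA h A by (intro mult_mono) auto
        finally show "(1 + h) * (1 + h * (A + 1)) \<le> 1 + e" using h e' by simp
      qed (use ax in simp)
      finally have up: "I \<le> ennreal ((1 + e) * win x)" .
      let ?G = "\<lambda>z. ennreal (p (x - z) - h) * indicator {x - A..x - \<delta>} z"
      have mass: "ennreal (1 - e' / 4 - h * A) \<le> (\<integral>\<^sup>+z. ?G z \<partial>lborel)"
      proof (rule ennreal_add_geD)
        have "ennreal (1 - e' / 4) \<le> emeasure \<mu> {0..A}" using A0 A by auto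
        also have "\<dots> = (\<integral>\<^sup>+u\<in>{0..A}. ennreal (p u) \<partial>lborel)" unfolding \<mu>_def by (rule emeasure_density) auto
        also have "\<dots> = (\<integral>\<^sup>+z. ennreal (p (x - z)) * indicator {0..A} (x - z) \<partial>lborel)"
          by (subst nn_integral_real_affine[where c="-1" and t=x]) auto
        also have "\<dots> \<le> (\<integral>\<^sup>+z. ennreal h * indicator {x - A..x} z + ?G z \<partial>lborel)"
        proof (rule nn_integral_mono)
          fix z
          show "ennreal (p (x - z)) * indicator {0..A} (x - z) \<le> ennreal h * indicator {x - A..x} z + ?G z"
          proof (cases "z \<in> {x - A..x}")
            case True
            have "p (x - z) \<le> h + (if z \<le> x - \<delta> then max 0 (p (x - z) - h) else 0)"
              using p_small[of "x - z"] True by (auto simp: max_def)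
            then have "ennreal (p (x - z)) \<le> ennreal (h + (if z \<le> x - \<delta> then max 0 (p (x - z) - h) else 0))"
              by (rule ennreal_leI)
            also have "\<dots> = ennreal h + ennreal (if z \<le> x - \<delta> then max 0 (p (x - z) - h) else 0)"
              using h by (intro ennreal_plus) auto
            also have "ennreal (if z \<le> x - \<delta> then max 0 (p (x - z) - h) else 0) = ?G z"
              using True by (auto simp: indicator_def)
            finally show ?thesis using True by (simp add: indicator_def)
          qed (auto simp: indicator_def)
        qed
        also have "\<dots> = ennreal h * emeasure lborel {x - A..x} + (\<integral>\<^sup>+z. ?G z \<partial>lborel)"
          by (subst nn_integral_add) (auto simp: nn_integral_cmult_indicator)
        also have "ennreal h * emeasure lborel {x - A..x} = ennreal (h * A)"
          using A h by (simp add: ennreal_mult)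
        finally show "ennreal (1 - e' / 4) \<le> ennreal (h * A) + (\<integral>\<^sup>+z. ?G z \<partial>lborel)" .
      qed (use h A in simp)
      have "ennreal (\<delta> * ((1 - h) * (1 - e' / 4 - h * A) * win x))
          = ennreal ((1 - h) * (\<delta> * win x)) * ennreal (1 - e' / 4 - h * A)"
        using hA e' \<delta> ax by (subst ennreal_mult[symmetric]) (auto simp: mult_ac)
      also have "\<dots> \<le> ennreal ((1 - h) * (\<delta> * win x)) * (\<integral>\<^sup>+z. ?G z \<partial>lborel)"
        by (rule mult_left_mono[OF mass]) simp
      also have "\<dots> = (\<integral>\<^sup>+z. ennreal ((1 - h) * (\<delta> * win x)) * ?G z \<partial>lborel)"
        by (rule nn_integral_cmult[symmetric]) measurable
      also have "\<dots> \<le> (\<integral>\<^sup>+z. ?G z * emeasure \<nu> ({z<..z + \<delta>} \<inter> J) \<partial>lborel)"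
      proof (rule nn_integral_mono)
        fix z
        show "ennreal ((1 - h) * (\<delta> * win x)) * ?G z \<le> ?G z * emeasure \<nu> ({z<..z + \<delta>} \<inter> J)"
        proof (cases "z \<in> {x - A..x - \<delta>}")
          case True
          then have "{z<..z + \<delta>} \<inter> J = {z<..z + \<delta>}" by (auto simp: J_def)
          moreover have "ennreal ((1 - h) * (\<delta> * win x)) \<le> emeasure \<nu> {z<..z + \<delta>}"
            using True A \<delta> by (intro wl) auto
          ultimately show ?thesis
            by (simp only: mult.commute[of _ "?G z"]) (intro mult_left_mono; simp)
        qed simp
      qed
      also have "\<dots> \<le> ennreal \<delta> * I"
        unfolding I_def
      proof (rule smoothing_lower[OF sigma_finite_nu])
        fix y z assume *: "y \<in> J" "y - \<delta> \<le> z" "z < y"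
        show "?G z \<le> ennreal (p (x - y))"
        proof (cases "z \<in> {x - A..x - \<delta>}")
          case True
          then have "\<bar>p (x - z) - p (x - y)\<bar> \<le> h" using * \<delta> by (intro uc) (auto simp: J_def)
          then show ?thesis using True by (auto intro!: ennreal_leI)
        qed simp
      qed (use \<delta> in auto)
      finally have "ennreal ((1 - h) * (1 - e' / 4 - h * A) * win x) \<le> I"
        using \<delta>(1) by (rule ennreal_mult_ge_cancelD)
      moreover have "ennreal ((1 - e) * win x) \<le> ennreal ((1 - h) * (1 - e' / 4 - h * A) * win x)"
      proof (intro ennreal_leI mult_right_mono)
        have "0 \<le> h * A" using h A by simp
        then have "h * (1 - e' / 4 - h * A) \<le> h * 1" using h(1) e' by (intro mult_left_mono) auto
        then have "(1 - h) * (1 - e' / 4 - h * A) \<ge> 1 - e' / 4 - h * A - h" by (simp add: algebra_simps)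
        then show "1 - e \<le> (1 - h) * (1 - e' / 4 - h * A)" using hA e' by linarith
      qed (use ax in simp)
      ultimately show ?case using up unfolding I by auto
    qed
  qed
qed

end

section \<open>The asymptotic constant\<close>

text \<open>
  A long-tailed function decays more slowly than any exponential, because over a unit step it loses at most the factor
  \<open>exp (- e)\<close>.
\<close>

lemma long_tailed_exponential_lower:
  assumes h: "h \<in> long_tailed" and "0 < e"
  shows "\<exists>X\<ge>0. 0 < h X \<and> (\<forall>x\<ge>X. h X * exp (- (e * (x - X + 1))) \<le> h x)"
proof -
  define d where "d = 1 - exp (- e)"
  have d: "0 < d" using \<open>0 < e\<close> by (simp add: d_def)
  obtain X0 where X0: "\<And>x. X0 \<le> x \<Longrightarrow> 0 < h x"
      "\<And>x t. X0 \<le> x \<Longrightarrow> \<bar>t\<bar> \<le> 1 \<Longrightarrow> \<bar>h (x + t) - h x\<bar> \<le> d * h x"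
    using long_tailed_uniform[OF h d, of 1] by (auto simp: eventually_at_top_linorder)
  define X where "X = max X0 0"
  have step: "exp (- e) * h x \<le> h (x + t)" if "X \<le> x" "0 \<le> t" "t \<le> 1" for x t
    using X0(2)[of x t] that by (auto simp: X_def d_def abs_le_iff algebra_simps)
  have hX: "0 < h X" using X0(1) by (simp add: X_def)
  have "\<forall>x. X \<le> x \<and> x \<le> X + real n + 1 \<longrightarrow> h X * exp (- (e * (x - X + 1))) \<le> h x" for n
  proof (induction n)
    case 0
    show ?case
    proof (intro allI impI)
      fix x assume x: "X \<le> x \<and> x \<le> X + real 0 + 1"
      have "exp (- (e * (x - X + 1))) \<le> exp (- e)" using x \<open>0 < e\<close> by (simp add: algebra_simps)
      then have "h X * exp (- (e * (x - X + 1))) \<le> h X * exp (- e)" using hX by (intro mult_left_mono) auto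
      also have "\<dots> \<le> h x" using step[of X "x - X"] x by (simp add: mult.commute)
      finally show "h X * exp (- (e * (x - X + 1))) \<le> h x" .
    qed
  next
    case (Suc n)
    show ?case
    proof (intro allI impI)
      fix x assume x: "X \<le> x \<and> x \<le> X + real (Suc n) + 1"
      show "h X * exp (- (e * (x - X + 1))) \<le> h x"
      proof (cases "x \<le> X + real n + 1")
        case False
        then have "h X * exp (- (e * ((x - 1) - X + 1))) \<le> h (x - 1)" using Suc.IH[rule_format, of "x - 1"] x by auto
        then have "exp (- e) * (h X * exp (- (e * ((x - 1) - X + 1)))) \<le> exp (- e) * h (x - 1)"
          by (intro mult_left_mono) auto
        also have "\<dots> \<le> h x" using step[of "x - 1" 1] False by simp
        also have "exp (- e) * (h X * exp (- (e * ((x - 1) - X + 1)))) = h X * exp (- (e * (x - X + 1)))"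
          by (simp add: exp_add[symmetric] algebra_simps)
        finally show ?thesis .
      qed (use Suc.IH x in blast)
    qed
  qed
  then have "h X * exp (- (e * (x - X + 1))) \<le> h x" if "X \<le> x" for x
  proof -
    obtain n where "x - X \<le> real n" using real_arch_simple by blast
    then have "X \<le> x \<and> x \<le> X + real n + 1" using that by linarith
    then show ?thesis using \<open>\<And>n. \<forall>x. X \<le> x \<and> x \<le> X + real n + 1 \<longrightarrow> h X * exp (- (e * (x - X + 1))) \<le> h x\<close> by blast
  qed
  then show ?thesis using hX by (intro exI[of _ X]) (auto simp: X_def)
qed

context steutel_density
begin

text \<open>
  The integral is continuous in \<open>T\<close>, at most one at \<open>T = 0\<close>, and unbounded because \<open>p\<close> has no
  exponential moment; the intermediate value theorem gives \<open>T\<close>.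
\<close>

lemma truncated_exponential_moment:
  assumes p: "p \<in> long_tailed" and "0 < e" "0 < d"
  shows "\<exists>T\<ge>0. (\<integral>\<^sup>+x. ennreal (exp (e * min x T)) \<partial>\<mu>) = ennreal (1 + d)"
proof -
  interpret mu: real_distribution \<mu> by (rule mu_distribution)
  obtain X where X: "0 \<le> X" "0 < p X" "\<And>x. X \<le> x \<Longrightarrow> p X * exp (- (e * (x - X + 1))) \<le> p x"
    using long_tailed_exponential_lower[OF p \<open>0 < e\<close>] by blast
  define c where "c = p X * exp (- e)"
  have c: "0 < c" using X by (simp add: c_def)
  have low: "c \<le> exp (e * x) * p x" if "X \<le> x" for x
  proof -
    have "c \<le> p X * exp (- e + e * X)" unfolding c_def using X \<open>0 < e\<close> by (intro mult_left_mono) auto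
    also have "\<dots> = exp (e * x) * (p X * exp (- (e * (x - X + 1))))"
      by (simp add: exp_add[symmetric] algebra_simps)
    also have "\<dots> \<le> exp (e * x) * p x" using X(3)[OF that] by (intro mult_left_mono) auto
    finally show ?thesis .
  qed
  define T0 where "T0 = X + (1 + d) / c"
  have T0: "X \<le> T0" "0 \<le> T0" using c \<open>0 < d\<close> X by (auto simp: T0_def)
  define g where "g T = (LINT x|\<mu>. exp (e * min x (min T T0)))" for T
  have int: "integrable \<mu> (\<lambda>x. exp (e * min x (min T T0)))" for T
    by (rule mu.integrable_const_bound[of _ "exp (e * T0)"])
      (use \<open>0 < e\<close> in \<open>auto intro!: AE_I2 mult_left_mono\<close>)
  have g_nn: "ennreal (g T) = (\<integral>\<^sup>+x. ennreal (exp (e * min x (min T T0))) \<partial>\<mu>)" for T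
    unfolding g_def using int by (intro nn_integral_eq_integral[symmetric]) auto
  have cont: "isCont g T" for T
  proof (unfold continuous_at_sequentially, intro allI impI)
    fix u assume u: "u \<longlonglongrightarrow> T"
    show "(g \<circ> u) \<longlonglongrightarrow> g T"
      unfolding g_def o_def
    proof (rule integral_dominated_convergence[where w="\<lambda>_. exp (e * T0)"])
      show "AE x in \<mu>. (\<lambda>n. exp (e * min x (min (u n) T0))) \<longlonglongrightarrow> exp (e * min x (min T T0))"
        by (intro AE_I2 tendsto_intros u)
      show "AE x in \<mu>. norm (exp (e * min x (min (u n) T0))) \<le> exp (e * T0)" for n
        using \<open>0 < e\<close> by (auto intro!: AE_I2 mult_left_mono)
    qed auto
  qed
  have "g 0 \<le> 1 + d"
  proof -
    have "g 0 \<le> (LINT x|\<mu>. 1)"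
      unfolding g_def using int[of 0] T0 \<open>0 < e\<close>
      by (intro integral_mono) (auto simp: mult_le_0_iff min_def)
    then show ?thesis using \<open>0 < d\<close> by (simp add: mu.prob_space[simplified])
  qed
  moreover have "1 + d \<le> g T0"
  proof -
    have "ennreal (1 + d) = (\<integral>\<^sup>+x. ennreal c * indicator {X..T0} x \<partial>lborel)"
      using c \<open>0 < d\<close> by (simp add: nn_integral_cmult_indicator ennreal_mult[symmetric] T0_def)
    also have "\<dots> \<le> (\<integral>\<^sup>+x. ennreal (p x) * ennreal (exp (e * min x (min T0 T0))) \<partial>lborel)"
    proof (rule nn_integral_mono)
      fix x show "ennreal c * indicator {X..T0} x \<le> ennreal (p x) * ennreal (exp (e * min x (min T0 T0)))"
        using low[of x] p_nonneg[of x] by (auto simp: indicator_def ennreal_mult[symmetric] mult.commute intro!: ennreal_leI)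
    qed
    also have "\<dots> = ennreal (g T0)" unfolding g_nn by (rule nn_integral_mu[symmetric]) measurable
    finally show ?thesis using \<open>0 < d\<close> by (subst (asm) ennreal_le_iff2) auto
  qed
  ultimately obtain T where "0 \<le> T" "T \<le> T0" "g T = 1 + d"
    using IVT[of g 0 "1 + d" T0] cont T0 by auto
  then show ?thesis using g_nn[of T] by (intro exI[of _ T]) (simp add: min_absorb1)
qed

text \<open>
  Since \<open>min x S / x\<close> is nonincreasing, Steutel's identity survives the truncation of the factor \<open>x\<close> as an
  inequality, and the weight \<open>w\<close> is submultiplicative on the half line.
\<close>

lemma weighted_steutel:
  assumes \<phi>: "\<phi> = (\<lambda>x. min x S)" "0 < S" and w: "w = (\<lambda>x. exp (e * min x T))" "0 \<le> T" "0 < e"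
  shows "(\<integral>\<^sup>+x. ennreal (\<phi> x * w x) \<partial>\<mu>) \<le> (\<integral>\<^sup>+x. ennreal (w x) \<partial>\<mu>) * (\<integral>\<^sup>+y. ennreal (\<phi> y * w y) \<partial>\<nu>)"
proof -
  have [measurable]: "\<phi> \<in> borel_measurable borel" "w \<in> borel_measurable borel"
    unfolding \<phi> w by measurable
  have w_sub: "w (s + y) \<le> w s * w y" if "0 \<le> s" "0 \<le> y" for s y
  proof -
    have "min (s + y) T \<le> min s T + min y T" using that w(2) by (auto simp: min_def)
    then have "e * min (s + y) T \<le> e * min s T + e * min y T"
      using w(3) by (simp add: distrib_left[symmetric])
    then show ?thesis by (simp add: w(1) exp_add[symmetric])
  qed
  have pw: "ennreal (\<phi> x * p x) \<le> (\<integral>\<^sup>+y. ennreal (\<phi> y) * ennreal (p (x - y)) \<partial>\<nu>)" if "0 < x" for x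
  proof -
    have "ennreal (\<phi> x * p x) = ennreal (\<phi> x / x) * ennreal (x * p x)"
      using that \<phi> p_nonneg[of x] by (simp add: ennreal_mult[symmetric])
    also have "\<dots> = (\<integral>\<^sup>+y. ennreal (\<phi> x / x) * (ennreal (p (x - y)) * ennreal y) \<partial>\<nu>)"
      unfolding steutel by (rule nn_integral_cmult[symmetric]) measurable
    also have "\<dots> \<le> (\<integral>\<^sup>+y. ennreal (\<phi> y) * ennreal (p (x - y)) \<partial>\<nu>)"
    proof (rule nn_integral_mono_AE, use AE_pos in eventually_elim)
      case (elim y)
      show ?case
      proof (cases "y < x")
        case True
        have "\<phi> x / x * y \<le> \<phi> y"
        proof (cases "x \<le> S")
          case False
          have "S * y / x \<le> min y S" using True elim False \<phi>(2) by (auto simp: min_def field_simps)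
          then show ?thesis using False by (simp add: \<phi>(1))
        qed (use that True in \<open>simp add: \<phi>(1)\<close>)
        then have "\<phi> x / x * y * p (x - y) \<le> \<phi> y * p (x - y)" by (rule mult_right_mono) (rule p_nonneg)
        then show ?thesis
          using that elim \<phi> p_nonneg[of "x - y"] by (simp add: ennreal_mult[symmetric] mult_ac ennreal_leI)
      next
        case False
        then show ?thesis using p_nonpos[of "x - y"] by simp
      qed
    qed
    finally show ?thesis .
  qed
  have "(\<integral>\<^sup>+x. ennreal (\<phi> x * w x) \<partial>\<mu>) = (\<integral>\<^sup>+x. ennreal (p x) * ennreal (\<phi> x * w x) \<partial>lborel)"
    by (rule nn_integral_mu) measurable
  also have "\<dots> \<le> (\<integral>\<^sup>+x. (\<integral>\<^sup>+y. ennreal (\<phi> y * w y) * (ennreal (p (x - y)) * ennreal (w (x - y))) \<partial>\<nu>) \<partial>lborel)"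
  proof (rule nn_integral_mono)
    fix x
    show "ennreal (p x) * ennreal (\<phi> x * w x) \<le> (\<integral>\<^sup>+y. ennreal (\<phi> y * w y) * (ennreal (p (x - y)) * ennreal (w (x - y))) \<partial>\<nu>)"
    proof (cases "0 < x")
      case True
      have "ennreal (p x) * ennreal (\<phi> x * w x) = ennreal (\<phi> x * p x) * ennreal (w x)"
        using True \<phi> w(1) p_nonneg[of x] by (simp add: ennreal_mult[symmetric] mult_ac)
      also have "\<dots> \<le> (\<integral>\<^sup>+y. ennreal (\<phi> y) * ennreal (p (x - y)) \<partial>\<nu>) * ennreal (w x)"
        by (rule mult_right_mono[OF pw[OF True]]) simp
      also have "\<dots> = (\<integral>\<^sup>+y. ennreal (\<phi> y) * ennreal (p (x - y)) * ennreal (w x) \<partial>\<nu>)"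
        by (rule nn_integral_multc[symmetric]) measurable
      also have "\<dots> \<le> (\<integral>\<^sup>+y. ennreal (\<phi> y * w y) * (ennreal (p (x - y)) * ennreal (w (x - y))) \<partial>\<nu>)"
      proof (rule nn_integral_mono_AE, use AE_pos in eventually_elim)
        case (elim y)
        show ?case
        proof (cases "y < x")
          case True
          have "w x \<le> w (x - y) * w y" using w_sub[of "x - y" y] True elim by simp
          then have "(\<phi> y * p (x - y)) * w x \<le> (\<phi> y * p (x - y)) * (w (x - y) * w y)"
            using elim \<phi> p_nonneg by (intro mult_left_mono) auto
          then show ?thesis
            using elim \<phi> w(1) p_nonneg[of "x - y"] by (simp add: ennreal_mult[symmetric] mult_ac ennreal_leI)
        next
          case False
          then show ?thesis using p_nonpos[of "x - y"] by simp
        qed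
      qed
      finally show ?thesis .
    next
      case False
      then show ?thesis using p_nonpos[of x] by simp
    qed
  qed
  also have "\<dots> = (\<integral>\<^sup>+y. (\<integral>\<^sup>+x. ennreal (\<phi> y * w y) * (ennreal (p (x - y)) * ennreal (w (x - y))) \<partial>lborel) \<partial>\<nu>)"
  proof -
    interpret pair_sigma_finite lborel \<nu> ..
    show ?thesis by (rule Fubini'[symmetric]) measurable
  qed
  also have "\<dots> = (\<integral>\<^sup>+y. ennreal (\<phi> y * w y) * (\<integral>\<^sup>+x. ennreal (w x) \<partial>\<mu>) \<partial>\<nu>)"
  proof (rule nn_integral_cong)
    fix y
    have "(\<integral>\<^sup>+x. ennreal (p (x - y)) * ennreal (w (x - y)) \<partial>lborel) = (\<integral>\<^sup>+x. ennreal (w x) \<partial>\<mu>)"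
      by (subst nn_integral_mu, simp, subst (2) nn_integral_real_affine[where c=1 and t="- y"]) auto
    then show "(\<integral>\<^sup>+x. ennreal (\<phi> y * w y) * (ennreal (p (x - y)) * ennreal (w (x - y))) \<partial>lborel)
        = ennreal (\<phi> y * w y) * (\<integral>\<^sup>+x. ennreal (w x) \<partial>\<mu>)"
      by (subst nn_integral_cmult) auto
  qed
  also have "\<dots> = (\<integral>\<^sup>+x. ennreal (w x) \<partial>\<mu>) * (\<integral>\<^sup>+y. ennreal (\<phi> y * w y) \<partial>\<nu>)"
    by (subst nn_integral_multc) (auto simp: mult.commute)
  finally show ?thesis .
qed

text \<open>
  Suppose \<open>k < 1\<close>. In the weighted identity the integral against \<open>\<nu>\<close> is, up to a constant from bounded \<open>y\<close> and
  factors close to one, at most \<open>k\<close> times that against \<open>p\<close>, which is \<open>M\<close>. Hence \<open>M\<close> is bounded independently of the weight. But as \<open>e\<close> tends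
  to zero the excess \<open>d\<close> of \<open>\<integral> w p\<close> over one comes from beyond any given \<open>S\<close>, so that \<open>M\<close> exceeds \<open>S d / 2\<close>.
\<close>

lemma window_ratio_ge_one:
  assumes p: "p \<in> long_tailed" and "0 < k" and ratio: "\<forall>\<^sub>F x in at_top. win x \<le> k * p x"
  shows "1 \<le> k"
proof (rule ccontr)
  assume "\<not> 1 \<le> k"
  obtain d where d: "0 < d" "k * (1 + d) ^ 3 < 1"
  proof -
    have "((\<lambda>d. k * (1 + d) ^ 3) \<longlongrightarrow> k * (1 + 0) ^ 3) (at_right 0)" by (intro tendsto_intros)
    then have "\<forall>\<^sub>F d in at_right 0. k * (1 + d) ^ 3 < 1"
      using \<open>\<not> 1 \<le> k\<close> by (intro order_tendstoD(2)) auto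
    moreover have "\<forall>\<^sub>F d in at_right (0::real). 0 < d" by (rule eventually_at_right_less)
    ultimately have "\<forall>\<^sub>F d in at_right 0. 0 < d \<and> k * (1 + d) ^ 3 < 1" by eventually_elim auto
    from eventually_happens[OF this] that show ?thesis by auto
  qed
  obtain B0 where B0: "\<And>x. B0 \<le> x \<Longrightarrow> win x \<le> k * p x"
    using ratio by (auto simp: eventually_at_top_linorder)
  (* Beyond B - 1 a unit step multiplies min z S by at most 1 + d. *)
  define B where "B = max (B0 + 1) (2 + 1 / d)"
  have B: "B0 \<le> B - 1" "1 \<le> d * (B - 1)" "1 < B"
  proof -
    have "2 + 1 / d \<le> B" by (simp add: B_def)
    then have "1 / d \<le> B - 1" by linarith
    then show "1 \<le> d * (B - 1)" using d(1) by (simp add: field_simps)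
    show "1 < B" using \<open>2 + 1 / d \<le> B\<close> d(1) zero_less_divide_1_iff[of d] by linarith
  qed (simp add: B_def)
  define K where "K = exp B * enn2real (emeasure \<sigma> {..B})"
  have K: "ennreal (exp B) * emeasure \<sigma> {..B} = ennreal K" "0 \<le> K"
    using sigma_finite_below[of B] by (auto simp: K_def ennreal_mult less_top[symmetric])
  define K' where "K' = (1 + d) * K / (1 - k * (1 + d) ^ 3)"
  have K': "0 \<le> K'" using K d by (auto simp: K'_def)
  (* S is chosen after the bound K' on M, and e after S: on [0, S] the weight is then at most 1 + d / 2. *)
  define S where "S = max B (2 * (K' + 1) / d)"
  have S: "B \<le> S" "K' + 1 \<le> S * (d / 2)" using d(1) by (auto simp: S_def field_simps max_def)
  have Spos: "0 < S" using S(1) B(3) by linarith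
  define e where "e = min 1 (min (ln (1 + d)) (ln (1 + d / 2) / S))"
  have e: "0 < e" "e \<le> 1" "exp e \<le> 1 + d" "exp (e * S) \<le> 1 + d / 2"
  proof -
    show "0 < e" "e \<le> 1" using d(1) Spos by (auto simp: e_def)
    have "e \<le> ln (1 + d)" by (auto simp: e_def)
    then show "exp e \<le> 1 + d" using d(1) by (simp add: ln_ge_iff[symmetric])
    have "e \<le> ln (1 + d / 2) / S" by (auto simp: e_def)
    then have "e * S \<le> ln (1 + d / 2)" using Spos by (simp add: field_simps)
    then show "exp (e * S) \<le> 1 + d / 2" using d(1) by (subst (asm) ln_ge_iff) auto
  qed
  obtain T where T: "0 \<le> T" "(\<integral>\<^sup>+x. ennreal (exp (e * min x T)) \<partial>\<mu>) = ennreal (1 + d)"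
    using truncated_exponential_moment[OF p e(1) d(1)] by blast
  define \<phi> where "\<phi> = (\<lambda>x::real. min x S)"
  define w where "w = (\<lambda>x::real. exp (e * min x T))"
  have [measurable]: "\<phi> \<in> borel_measurable borel" "w \<in> borel_measurable borel"
    unfolding \<phi>_def w_def by measurable
  have w0: "0 < w x" for x by (simp add: w_def)
  define M where "M = (\<integral>\<^sup>+x. ennreal (\<phi> x * w x) \<partial>\<mu>)"
  have wM: "(\<integral>\<^sup>+x. ennreal (w x) \<partial>\<mu>) = ennreal (1 + d)" using T(2) by (simp add: w_def)
  have M1: "M \<le> ennreal (1 + d) * (\<integral>\<^sup>+y. ennreal (\<phi> y * w y) \<partial>\<nu>)"
    unfolding M_def wM[symmetric] by (rule weighted_steutel[OF \<phi>_def Spos w_def T(1) e(1)])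
  have small: "(\<integral>\<^sup>+y\<in>{..B}. ennreal (\<phi> y * w y) \<partial>\<nu>) \<le> ennreal K"
  proof -
    have "(\<integral>\<^sup>+y\<in>{..B}. ennreal (\<phi> y * w y) \<partial>\<nu>) \<le> (\<integral>\<^sup>+y. ennreal (exp B) * (ennreal y * indicator {..B} y) \<partial>\<nu>)"
    proof (rule nn_integral_mono_AE, use AE_pos in eventually_elim)
      case (elim y)
      have "w y \<le> exp B" if "y \<le> B"
      proof -
        have "e * min y T \<le> e * y" using e(1) by (intro mult_left_mono) auto
        also have "\<dots> \<le> 1 * y" using e(2) elim by (intro mult_right_mono) auto
        finally show ?thesis using that by (simp add: w_def)
      qed
      then have "\<phi> y * w y \<le> y * exp B" if "y \<le> B"
        using that elim w0[of y] Spos by (intro mult_mono) (auto simp: \<phi>_def)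
      then show ?case using elim by (auto simp: indicator_def ennreal_mult[symmetric] mult.commute intro!: ennreal_leI)
    qed
    also have "\<dots> = ennreal (exp B) * emeasure \<sigma> {..B}"
      by (subst nn_integral_cmult) (auto simp: emeasure_sigma)
    finally show ?thesis unfolding K(1) .
  qed
  have large: "(\<integral>\<^sup>+y\<in>{B<..}. ennreal (\<phi> y * w y) \<partial>\<nu>) \<le> ennreal (k * (1 + d)\<^sup>2) * M"
  proof -
    have "ennreal 1 * (\<integral>\<^sup>+y\<in>{B<..}. ennreal (\<phi> y * w y) \<partial>\<nu>)
        \<le> (\<integral>\<^sup>+z. ennreal ((1 + d)\<^sup>2 * (\<phi> z * w z)) * emeasure \<nu> ({z<..z + 1} \<inter> {B<..}) \<partial>lborel)"
    proof (rule smoothing_upper[OF sigma_finite_nu])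
      fix y z assume yz: "y \<in> {B<..}" "y - 1 \<le> z" "z < y"
      have z: "B - 1 < z" using yz by auto
      have "e * min y T \<le> e * (min z T + 1)" using e(1) yz by (intro mult_left_mono) auto
      then have "w y \<le> exp (e * min z T + e)" by (simp add: w_def distrib_left)
      also have "\<dots> \<le> w z * (1 + d)" using e(3) by (simp add: exp_add w_def)
      finally have 1: "w y \<le> (1 + d) * w z" by (simp add: mult.commute)
      have "B - 1 \<le> \<phi> z" using z S(1) by (auto simp: \<phi>_def)
      then have "d * (B - 1) \<le> d * \<phi> z" using d(1) by (intro mult_left_mono) auto
      then have "1 \<le> d * \<phi> z" using B(2) by linarith
      moreover have "\<phi> y \<le> \<phi> z + 1" using yz by (auto simp: \<phi>_def)
      ultimately have 2: "\<phi> y \<le> (1 + d) * \<phi> z" by (simp add: algebra_simps)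
      have "\<phi> y * w y \<le> ((1 + d) * \<phi> z) * ((1 + d) * w z)"
        using 1 2 w0[of y] yz B(3) Spos \<open>B - 1 \<le> \<phi> z\<close> d(1) by (intro mult_mono) (auto simp: \<phi>_def)
      then show "ennreal (\<phi> y * w y) \<le> ennreal ((1 + d)\<^sup>2 * (\<phi> z * w z))"
        by (intro ennreal_leI) (simp add: power2_eq_square mult_ac)
    qed auto
    also have "\<dots> \<le> (\<integral>\<^sup>+z. ennreal (k * (1 + d)\<^sup>2) * (ennreal (p z) * ennreal (\<phi> z * w z)) \<partial>lborel)"
    proof (rule nn_integral_mono)
      fix z
      show "ennreal ((1 + d)\<^sup>2 * (\<phi> z * w z)) * emeasure \<nu> ({z<..z + 1} \<inter> {B<..})
        \<le> ennreal (k * (1 + d)\<^sup>2) * (ennreal (p z) * ennreal (\<phi> z * w z))"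
      proof (cases "B - 1 < z")
        case True
        have "0 < z" using True B(3) by simp
        have "emeasure \<nu> ({z<..z + 1} \<inter> {B<..}) \<le> emeasure \<nu> {z<..z + 1}" by (rule emeasure_mono) auto
        also have "\<dots> = ennreal (win z)" using \<open>0 < z\<close> by (rule nu_unit_window)
        also have "\<dots> \<le> ennreal (k * p z)" using B0[of z] True B(1) by (intro ennreal_leI) auto
        finally have "ennreal ((1 + d)\<^sup>2 * (\<phi> z * w z)) * emeasure \<nu> ({z<..z + 1} \<inter> {B<..})
          \<le> ennreal ((1 + d)\<^sup>2 * (\<phi> z * w z)) * ennreal (k * p z)" by (rule mult_left_mono) simp
        also have "\<dots> = ennreal (k * (1 + d)\<^sup>2) * (ennreal (p z) * ennreal (\<phi> z * w z))"
          using \<open>0 < k\<close> d(1) \<open>0 < z\<close> Spos w0[of z] p_nonneg[of z]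
          by (simp add: ennreal_mult[symmetric] \<phi>_def mult_ac)
        finally show ?thesis .
      next
        case False
        then have "{z<..z + 1} \<inter> {B<..} = {}" by auto
        then show ?thesis by (simp only: emeasure_empty mult_zero_right zero_le)
      qed
    qed
    also have "\<dots> = ennreal (k * (1 + d)\<^sup>2) * M"
      unfolding M_def by (subst nn_integral_cmult, simp, subst nn_integral_mu) auto
    finally show ?thesis by simp
  qed
  have "M \<le> (\<integral>\<^sup>+x. ennreal (S * exp (e * T)) \<partial>\<mu>)"
    unfolding M_def
  proof (rule nn_integral_mono)
    fix x
    have "\<phi> x * w x \<le> S * w x" using w0[of x] by (intro mult_right_mono) (auto simp: \<phi>_def)
    also have "\<dots> \<le> S * exp (e * T)" using Spos e(1) by (intro mult_left_mono) (auto simp: w_def)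
    finally show "ennreal (\<phi> x * w x) \<le> ennreal (S * exp (e * T))" by (rule ennreal_leI)
  qed
  also have "\<dots> < \<infinity>"
    using real_distribution.axioms(1)[OF mu_distribution] prob_space.emeasure_space_1[of \<mu>]
    by (simp add: ennreal_mult_less_top less_top[symmetric])
  finally obtain r where r: "M = ennreal r" "0 \<le> r" by (cases M) auto
  have "(\<integral>\<^sup>+y. ennreal (\<phi> y * w y) \<partial>\<nu>) = (\<integral>\<^sup>+y. ennreal (\<phi> y * w y) * indicator {..B} y + ennreal (\<phi> y * w y) * indicator {B<..} y \<partial>\<nu>)"
    by (intro nn_integral_cong) (auto simp: indicator_def)
  also have "\<dots> = (\<integral>\<^sup>+y\<in>{..B}. ennreal (\<phi> y * w y) \<partial>\<nu>) + (\<integral>\<^sup>+y\<in>{B<..}. ennreal (\<phi> y * w y) \<partial>\<nu>)"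
    by (rule nn_integral_add) measurable
  also have "\<dots> \<le> ennreal K + ennreal (k * (1 + d)\<^sup>2) * M" using small large by (rule add_mono)
  also have "\<dots> = ennreal (K + k * (1 + d)\<^sup>2 * r)"
    using K(2) r \<open>0 < k\<close> by (simp add: ennreal_mult)
  finally have "ennreal r \<le> ennreal (1 + d) * ennreal (K + k * (1 + d)\<^sup>2 * r)"
    using M1 unfolding r(1) by (meson mult_left_mono order_trans zero_le)
  then have "ennreal r \<le> ennreal ((1 + d) * (K + k * (1 + d)\<^sup>2 * r))"
    using d(1) K(2) r(2) \<open>0 < k\<close> by (simp add: ennreal_mult)
  then have "r \<le> (1 + d) * (K + k * (1 + d)\<^sup>2 * r)"
    using d(1) K(2) r(2) \<open>0 < k\<close> by (subst (asm) ennreal_le_iff) auto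
  then have "(1 - k * (1 + d) ^ 3) * r \<le> (1 + d) * K"
    by (simp add: algebra_simps power2_eq_square power3_eq_cube)
  then have "r \<le> K'" using d(2) by (simp add: K'_def field_simps)
  have "ennreal (1 + d) = (\<integral>\<^sup>+x. ennreal (w x) * indicator {..S} x + ennreal (w x) * indicator {S<..} x \<partial>\<mu>)"
    unfolding wM[symmetric] by (intro nn_integral_cong) (auto simp: indicator_def)
  also have "\<dots> = (\<integral>\<^sup>+x\<in>{..S}. ennreal (w x) \<partial>\<mu>) + (\<integral>\<^sup>+x\<in>{S<..}. ennreal (w x) \<partial>\<mu>)"
    by (rule nn_integral_add) measurable
  also have "(\<integral>\<^sup>+x\<in>{..S}. ennreal (w x) \<partial>\<mu>) \<le> (\<integral>\<^sup>+x. ennreal (1 + d / 2) \<partial>\<mu>)"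
  proof (rule nn_integral_mono)
    fix x
    have "w x \<le> 1 + d / 2" if "x \<le> S"
    proof -
      have "e * min x T \<le> e * S" using e(1) that by (intro mult_left_mono) auto
      then have "w x \<le> exp (e * S)" by (simp add: w_def)
      then show ?thesis using e(4) by linarith
    qed
    then show "ennreal (w x) * indicator {..S} x \<le> ennreal (1 + d / 2)"
      by (auto simp: indicator_def intro!: ennreal_leI)
  qed
  also have "(\<integral>\<^sup>+x. ennreal (1 + d / 2) \<partial>\<mu>) = ennreal (1 + d / 2)"
    using real_distribution.axioms(1)[OF mu_distribution] prob_space.emeasure_space_1[of \<mu>] by simp
  finally have "ennreal (1 + d) \<le> ennreal (1 + d / 2) + (\<integral>\<^sup>+x\<in>{S<..}. ennreal (w x) \<partial>\<mu>)"
    by (simp add: add_right_mono)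
  then have "ennreal (d / 2) \<le> (\<integral>\<^sup>+x\<in>{S<..}. ennreal (w x) \<partial>\<mu>)"
    using ennreal_add_geD[of "1 + d" "1 + d / 2"] d(1) by simp
  then have "ennreal (S * (d / 2)) \<le> ennreal S * (\<integral>\<^sup>+x\<in>{S<..}. ennreal (w x) \<partial>\<mu>)"
    using Spos d(1) by (subst ennreal_mult) (auto intro: mult_left_mono)
  also have "\<dots> = (\<integral>\<^sup>+x. ennreal S * (ennreal (w x) * indicator {S<..} x) \<partial>\<mu>)"
    by (rule nn_integral_cmult[symmetric]) measurable
  also have "\<dots> \<le> M"
    unfolding M_def
    by (rule nn_integral_mono) (use Spos w0 in \<open>auto simp: indicator_def \<phi>_def ennreal_mult[symmetric] less_imp_le\<close>)
  finally have "S * (d / 2) \<le> r" unfolding r(1) using r(2) by (simp add: ennreal_le_iff)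
  with \<open>r \<le> K'\<close> S(2) show False by linarith
qed

end

section \<open>Negligible middle parts\<close>

lemma half_line_convolution_window:
  assumes \<rho>: "half_line_distribution \<rho>" and "0 < c"
  shows "emeasure (\<rho> \<star> \<rho>) {x<..x + c} = (\<integral>\<^sup>+y. ennreal (measure \<rho> {x - y<..x - y + c}) \<partial>\<rho>)"
proof -
  interpret R: real_distribution \<rho> by (rule half_line_distributionD[OF \<rho>])
  have "emeasure (\<rho> \<star> \<rho>) {x<..x + c} = (\<integral>\<^sup>+y. emeasure \<rho> {v. v + y \<in> {x<..x + c}} \<partial>\<rho>)"
    by (rule convolution_emeasure) (auto simp: R.finite_measure_axioms)
  also have "\<dots> = (\<integral>\<^sup>+y. ennreal (measure \<rho> {x - y<..x - y + c}) \<partial>\<rho>)"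
    unfolding R.emeasure_eq_measure[symmetric] by (intro nn_integral_cong arg_cong[where f="emeasure \<rho>"]) auto
  finally show ?thesis .
qed

lemma window_function_measurable:
  fixes m :: "real measure"
  assumes "sigma_finite_measure m" "sets m = sets borel"
  shows "(\<lambda>x. measure m {x<..x + c}) \<in> borel_measurable borel"
proof -
  have "(\<lambda>x. enn2real (emeasure m ({x<..x + c} \<inter> UNIV))) \<in> borel_measurable borel"
    by (intro borel_measurable_enn2real window_measurable assms) auto
  then show ?thesis by (simp add: measure_def)
qed

text \<open>
  Exchanging the two summands: if the first is at most \<open>A\<close> and the sum exceeds \<open>x\<close>, the second is at least \<open>x - A\<close>;
  if the first is at least \<open>x - A\<close> and the sum is at most \<open>x + c\<close>, the second is at most \<open>A + c\<close>.
\<close>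

lemma half_line_near_far:
  assumes \<rho>: "half_line_distribution \<rho>" and "0 < c"
  shows "(\<integral>\<^sup>+y\<in>{0..A}. ennreal (measure \<rho> {x - y<..x - y + c}) \<partial>\<rho>)
      \<le> (\<integral>\<^sup>+y\<in>{x - A..}. ennreal (measure \<rho> {x - y<..x - y + c}) \<partial>\<rho>)"
    and "(\<integral>\<^sup>+y\<in>{x - A..}. ennreal (measure \<rho> {x - y<..x - y + c}) \<partial>\<rho>)
      \<le> (\<integral>\<^sup>+y\<in>{0..A + c}. ennreal (measure \<rho> {x - y<..x - y + c}) \<partial>\<rho>)"
proof -
  note D = half_line_distributionD[OF \<rho>]
  interpret R: real_distribution \<rho> by (rule D)
  interpret pair_sigma_finite \<rho> \<rho> ..
  let ?W = "\<lambda>y v. if x < y + v \<and> y + v \<le> x + c then 1 else 0 :: ennreal"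
  have W: "ennreal (measure \<rho> {x - y<..x - y + c}) = (\<integral>\<^sup>+v. ?W y v \<partial>\<rho>)" for y
  proof -
    have "(\<integral>\<^sup>+v. ?W y v \<partial>\<rho>) = (\<integral>\<^sup>+v. indicator {x - y<..x - y + c} v \<partial>\<rho>)"
      by (intro nn_integral_cong) (auto simp: indicator_def)
    then show ?thesis by (simp add: R.emeasure_eq_measure)
  qed
  have swap: "(\<integral>\<^sup>+y\<in>B. ennreal (measure \<rho> {x - y<..x - y + c}) \<partial>\<rho>) = (\<integral>\<^sup>+y. (\<integral>\<^sup>+v. ?W y v * indicator B v \<partial>\<rho>) \<partial>\<rho>)"
    if [measurable]: "B \<in> sets borel" for B
  proof -
    have "(\<integral>\<^sup>+y\<in>B. ennreal (measure \<rho> {x - y<..x - y + c}) \<partial>\<rho>) = (\<integral>\<^sup>+y. (\<integral>\<^sup>+v. ?W y v * indicator B y \<partial>\<rho>) \<partial>\<rho>)"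
      unfolding W by (intro nn_integral_cong nn_integral_multc[symmetric]) measurable
    also have "\<dots> = (\<integral>\<^sup>+v. (\<integral>\<^sup>+y. ?W y v * indicator B y \<partial>\<rho>) \<partial>\<rho>)"
      by (rule Fubini'[symmetric]) measurable
    also have "\<dots> = (\<integral>\<^sup>+v. (\<integral>\<^sup>+y. ?W v y * indicator B y \<partial>\<rho>) \<partial>\<rho>)"
      by (simp add: add.commute)
    finally show ?thesis .
  qed
  have direct: "(\<integral>\<^sup>+y\<in>B. ennreal (measure \<rho> {x - y<..x - y + c}) \<partial>\<rho>) = (\<integral>\<^sup>+y. (\<integral>\<^sup>+v. ?W y v * indicator B y \<partial>\<rho>) \<partial>\<rho>)"
    if [measurable]: "B \<in> sets borel" for B
    unfolding W by (intro nn_integral_cong nn_integral_multc[symmetric]) measurable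
  show "(\<integral>\<^sup>+y\<in>{0..A}. ennreal (measure \<rho> {x - y<..x - y + c}) \<partial>\<rho>)
      \<le> (\<integral>\<^sup>+y\<in>{x - A..}. ennreal (measure \<rho> {x - y<..x - y + c}) \<partial>\<rho>)"
  proof -
    have "(\<integral>\<^sup>+y. (\<integral>\<^sup>+v. ?W y v * indicator {0..A} v \<partial>\<rho>) \<partial>\<rho>)
        \<le> (\<integral>\<^sup>+y. (\<integral>\<^sup>+v. ?W y v * indicator {x - A..} y \<partial>\<rho>) \<partial>\<rho>)"
      by (intro nn_integral_mono) (auto simp: indicator_def)
    then show ?thesis using swap[of "{0..A}"] direct[of "{x - A..}"] by simp
  qed
  show "(\<integral>\<^sup>+y\<in>{x - A..}. ennreal (measure \<rho> {x - y<..x - y + c}) \<partial>\<rho>)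
      \<le> (\<integral>\<^sup>+y\<in>{0..A + c}. ennreal (measure \<rho> {x - y<..x - y + c}) \<partial>\<rho>)"
  proof -
    have le: "(\<integral>\<^sup>+v. ?W y v * indicator {x - A..} y \<partial>\<rho>) \<le> (\<integral>\<^sup>+v. ?W y v * indicator {0..A + c} v \<partial>\<rho>)" for y
      by (rule nn_integral_mono_AE, use D(7) in eventually_elim) (auto simp: indicator_def)
    have "(\<integral>\<^sup>+y. (\<integral>\<^sup>+v. ?W y v * indicator {x - A..} y \<partial>\<rho>) \<partial>\<rho>)
        \<le> (\<integral>\<^sup>+y. (\<integral>\<^sup>+v. ?W y v * indicator {0..A + c} v \<partial>\<rho>) \<partial>\<rho>)"
      by (rule nn_integral_mono) (rule le)
    then show ?thesis using swap[of "{0..A + c}"] direct[of "{x - A..}"] by simp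
  qed
qed

context steutel_density
begin

definition middle_negligible :: bool where
  "middle_negligible \<longleftrightarrow> (\<forall>e>0. \<exists>A0. \<forall>A\<ge>A0. \<forall>\<^sub>F x in at_top.
     middle_part win \<nu> A x \<le> ennreal (e * win x))"

lemma density_conv_nn:
  "ennreal (density_conv p p x) = (\<integral>\<^sup>+y. ennreal (p (x - y)) \<partial>\<mu>)"
proof -
  obtain b where b: "0 < b" "\<And>s. s \<le> x \<Longrightarrow> p s \<le> b" using p_local_bound[of x] by blast
  have int_p: "integrable lborel p"
    by (rule integrableI_nonneg) (auto simp: p_nonneg p_int)
  have "integrable lborel (\<lambda>u. p (x - u) * p u)"
  proof (rule Bochner_Integration.integrable_bound[OF integrable_mult_right[OF int_p, of b]])
    show "AE u in lborel. norm (p (x - u) * p u) \<le> norm (b * p u)"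
    proof (rule AE_I2)
      fix u
      show "norm (p (x - u) * p u) \<le> norm (b * p u)"
        using b(1) b(2)[of "x - u"] p_nonneg[of u] p_nonneg[of "x - u"] p_nonpos[of u]
        by (cases "u \<le> 0") (auto simp: abs_mult intro!: mult_right_mono)
    qed
  qed measurable
  then have "ennreal (density_conv p p x) = (\<integral>\<^sup>+u. ennreal (p (x - u) * p u) \<partial>lborel)"
    unfolding density_conv_def by (intro nn_integral_eq_integral[symmetric]) (auto simp: p_nonneg)
  also have "\<dots> = (\<integral>\<^sup>+y. ennreal (p (x - y)) \<partial>\<mu>)"
    by (subst nn_integral_mu) (auto simp: ennreal_mult p_nonneg mult.commute)
  finally show ?thesis .
qed

lemma density_conv_nonneg: "0 \<le> density_conv p p x"
  unfolding density_conv_def by (rule Bochner_Integration.integral_nonneg) (simp add: p_nonneg)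

text \<open>
  For densities the reflection \<open>y \<mapsto> x - y\<close> exchanges the near and the far part exactly.
\<close>

lemma density_conv_split:
  assumes "0 < A" "2 * A < x"
  shows "ennreal (density_conv p p x) = 2 * near_part p \<mu> A x
    + middle_part p \<mu> A x"
proof -
  have "far_part p \<mu> A x = (\<integral>\<^sup>+y. ennreal (p y) * (ennreal (p (x - y)) * indicator {x - A..} y) \<partial>lborel)"
    by (rule nn_integral_mu) measurable
  also have "\<dots> = (\<integral>\<^sup>+y. ennreal (p (x - y)) * (ennreal (p y) * indicator {x - A..} (x - y)) \<partial>lborel)"
    by (subst nn_integral_real_affine[where c="-1" and t=x]) auto
  also have "\<dots> = (\<integral>\<^sup>+y. ennreal (p y) * (ennreal (p (x - y)) * indicator {0..A} y) \<partial>lborel)"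
    by (intro nn_integral_cong) (use p_nonpos in \<open>auto simp: indicator_def mult_ac\<close>)
  also have "\<dots> = near_part p \<mu> A x"
    by (rule nn_integral_mu[symmetric]) measurable
  finally have far: "far_part p \<mu> A x = near_part p \<mu> A x" .
  have "(\<integral>\<^sup>+y. ennreal (p (x - y)) \<partial>\<mu>) = near_part p \<mu> A x
      + middle_part p \<mu> A x + far_part p \<mu> A x"
    by (rule nn_integral_split3) (use assms mu_pos in auto)
  then show ?thesis
    unfolding density_conv_nn far mult_2 by (simp only: ac_simps)
qed

lemma density_middle_small:
  assumes p: "p \<in> long_tailed" and s: "density_conv p p \<simeq> (\<lambda>x. 2 * p x)" and "0 < e"
  shows "\<exists>A0. \<forall>A\<ge>A0. \<forall>\<^sub>F x in at_top. middle_part p \<mu> A x \<le> ennreal (e * p x)"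
proof (rule middle_part_small[OF p mu_distribution mu_pos _ s \<open>0 < e\<close>])
  fix A :: real assume "0 < A"
  show "\<forall>\<^sub>F x in at_top. 2 * near_part p \<mu> A x
    + middle_part p \<mu> A x \<le> ennreal (density_conv p p x)"
    using eventually_gt_at_top[of "2 * A"] by eventually_elim (simp add: density_conv_split[OF \<open>0 < A\<close>])
qed

lemma subexponentialI:
  assumes p: "p \<in> long_tailed"
    and mid: "\<And>e. 0 < e \<Longrightarrow> \<exists>A0. \<forall>A\<ge>A0. \<forall>\<^sub>F x in at_top. middle_part p \<mu> A x \<le> ennreal (e * p x)"
  shows "p \<in> subexp_densities"
proof -
  interpret mu: real_distribution \<mu> by (rule mu_distribution)
  have "density_conv p p \<simeq> (\<lambda>x. 2 * p x)"
    unfolding asymp_pos_iff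
  proof (intro conjI allI impI)
    show "\<forall>\<^sub>F x in at_top. 0 < 2 * p x" using long_tailedD(4)[OF p] by simp
    fix e :: real assume "0 < e"
    define d where "d = min (1 / 2) (e / 2)"
    have d: "0 < d" "d \<le> 1 / 2" "2 * d \<le> e" using \<open>0 < e\<close> by (auto simp: d_def)
    obtain A1 where A1: "\<And>A. A1 \<le> A \<Longrightarrow> ennreal (1 - d) \<le> emeasure \<mu> {0..A}"
      using distribution_mass[OF mu_distribution mu_pos d(1)] by (auto simp: eventually_at_top_linorder)
    obtain A2 where A2: "\<And>A. A2 \<le> A \<Longrightarrow> \<forall>\<^sub>F x in at_top. middle_part p \<mu> A x \<le> ennreal (2 * d * p x)"
      using mid[of "2 * d"] d(1) by auto
    define A where "A = max 1 (max A1 A2)"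
    have A: "0 < A" "A1 \<le> A" "A2 \<le> A" by (auto simp: A_def)
    show "\<forall>\<^sub>F x in at_top. \<bar>density_conv p p x - 2 * p x\<bar> \<le> e * (2 * p x)"
      using A2[OF A(3)] near_part_upper[OF p d(1) sets_mu, of A] near_part_lower[OF p d(1) sets_mu, of A]
        eventually_gt_at_top[of "2 * A"] long_tailedD(4)[OF p]
    proof eventually_elim
      case (elim x)
      have px: "0 < p x" by fact
      let ?N = "\<integral>\<^sup>+y\<in>{0..A}. ennreal (p (x - y)) \<partial>\<mu>"
      have "?N \<le> ennreal ((1 + d) * p x) * emeasure \<mu> {0..A}" by fact
      also have "\<dots> \<le> ennreal ((1 + d) * p x) * 1" by (intro mult_left_mono mu.emeasure_le_1) auto
      finally have Nu: "?N \<le> ennreal ((1 + d) * p x)" by simp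
      have "ennreal ((1 - d) * p x * (1 - d)) = ennreal ((1 - d) * p x) * ennreal (1 - d)"
        using d px by (intro ennreal_mult) auto
      also have "\<dots> \<le> ennreal ((1 - d) * p x) * emeasure \<mu> {0..A}" using A1[OF A(2)] by (intro mult_left_mono) auto
      also have "\<dots> \<le> ?N" by fact
      finally have Nl: "ennreal ((1 - d) * p x * (1 - d)) \<le> ?N" .
      have "ennreal (density_conv p p x) \<le> 2 * ennreal ((1 + d) * p x) + ennreal (2 * d * p x)"
        unfolding density_conv_split[OF A(1) elim(4)] using Nu elim(1) by (intro add_mono mult_left_mono) auto
      also have "\<dots> = ennreal (2 * ((1 + d) * p x) + 2 * d * p x)"
        using d px by (simp add: ennreal_mult ennreal_plus)
      finally have u: "density_conv p p x \<le> 2 * ((1 + d) * p x) + 2 * d * p x"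
        using d px by (subst (asm) ennreal_le_iff) auto
      have "ennreal (2 * ((1 - d) * p x * (1 - d))) \<le> ennreal (density_conv p p x)"
      proof -
        have "ennreal (2 * ((1 - d) * p x * (1 - d))) = 2 * ennreal ((1 - d) * p x * (1 - d))"
          using d px by (simp add: ennreal_mult)
        also have "\<dots> \<le> 2 * ?N" using Nl by (rule mult_left_mono) simp
        also have "\<dots> \<le> ennreal (density_conv p p x)" unfolding density_conv_split[OF A(1) elim(4)] by simp
        finally show ?thesis .
      qed
      then have l: "2 * ((1 - d) * p x * (1 - d)) \<le> density_conv p p x"
        using density_conv_nonneg by (subst (asm) ennreal_le_iff) auto
      have "2 * ((1 - d) * p x * (1 - d)) = 2 * p x - 4 * (d * p x) + 2 * (d * d * p x)" by (simp add: algebra_simps)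
      moreover have "0 \<le> d * d * p x" using px by simp
      moreover have "2 * d * p x \<le> e * p x" using d px by (intro mult_right_mono) auto
      ultimately show "\<bar>density_conv p p x - 2 * p x\<bar> \<le> e * (2 * p x)" using u l
        by (auto simp: abs_le_iff algebra_simps)
    qed
  qed
  then show ?thesis
    using p p_int p_nonneg p_borel by (simp add: subexp_densities_def long_tailed_densities_def prob_densities_def)
qed

text \<open>
  Beyond one, \<open>\<nu>\<close> and its normalization differ by a constant, and the middle part only involves jumps larger than
  one.
\<close>

lemma loc_subexp_middle:
  assumes S: "\<rho> \<in> loc_subexp"
  shows "\<rho> \<in> loc_long_tailed" and middle_negligible
proof -
  show L: "\<rho> \<in> loc_long_tailed" using S unfolding loc_subexp_def loc_long_tailed_def by blast
  interpret rho: real_distribution \<rho> by (rule rho_distribution)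
  let ?R = "\<lambda>x. measure \<rho> {x<..x + 1}"
  have R: "?R \<in> long_tailed" by (rule loc_long_tailedD[OF L]) simp
  note [measurable] = long_tailedD(1)[OF R]
  have [measurable]: "(\<lambda>y. measure \<rho> {x - y<..x - y + 1}) \<in> borel_measurable borel" for x
    by (rule measurable_compose[OF _ long_tailedD(1)[OF R]]) measurable
  show middle_negligible
    unfolding middle_negligible_def
  proof (intro allI impI)
    fix e :: real assume "0 < e"
    then have "0 < e / tail_mass" using lambda_pos by simp
    have "\<exists>A0. \<forall>A\<ge>A0. \<forall>\<^sub>F x in at_top. middle_part ?R \<rho> A x \<le> ennreal (e / tail_mass * ?R x)"
    proof (rule middle_part_small[OF R rho_distribution half_line_distributionD(7)[OF rho_half_line] _ _ \<open>0 < e / tail_mass\<close>])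
      show "(\<lambda>x. measure (\<rho> \<star> \<rho>) {x<..x + 1}) \<simeq> (\<lambda>x. 2 * ?R x)"
        using S unfolding loc_subexp_def by (simp only: mem_Collect_eq)
      fix A :: real assume "0 < A"
      show "\<forall>\<^sub>F x in at_top. 2 * near_part ?R \<rho> A x
        + middle_part ?R \<rho> A x \<le> ennreal (measure (\<rho> \<star> \<rho>) {x<..x + 1})"
        using eventually_gt_at_top[of "2 * A"]
      proof eventually_elim
        case (elim x)
        interpret RR: real_distribution "\<rho> \<star> \<rho>"
          by (rule half_line_distributionD[OF half_line_distribution_convolution[OF rho_half_line rho_half_line]])
        have "ennreal (measure (\<rho> \<star> \<rho>) {x<..x + 1}) = (\<integral>\<^sup>+y. ennreal (?R (x - y)) \<partial>\<rho>)"
          unfolding RR.emeasure_eq_measure[symmetric] by (rule half_line_convolution_window[OF rho_half_line]) simp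
        also have "\<dots> = near_part ?R \<rho> A x + middle_part ?R \<rho> A x
            + far_part ?R \<rho> A x"
          by (rule nn_integral_split3) (use elim \<open>0 < A\<close> half_line_distributionD(7)[OF rho_half_line] in auto)
        finally have split: "ennreal (measure (\<rho> \<star> \<rho>) {x<..x + 1}) = near_part ?R \<rho> A x
            + middle_part ?R \<rho> A x + far_part ?R \<rho> A x" .
        have comb: "2 * N + M' \<le> N + M' + F" if "N \<le> F" for N M' F :: ennreal
          unfolding mult_2 using add_left_mono[OF that, of "N + M'"] by (simp only: ac_simps)
        show ?case
          unfolding split by (rule comb, rule half_line_near_far(1)[OF rho_half_line zero_less_one])
      qed
    qed
    then obtain A0 where A0: "\<And>A. A0 \<le> A \<Longrightarrow> \<forall>\<^sub>F x in at_top. middle_part ?R \<rho> A x \<le> ennreal (e / tail_mass * ?R x)"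
      by blast
    show "\<exists>A0. \<forall>A\<ge>A0. \<forall>\<^sub>F x in at_top. middle_part win \<nu> A x \<le> ennreal (e * win x)"
    proof (intro exI[of _ "max A0 1"] allI impI)
      fix A assume A: "max A0 1 \<le> A"
      then have "A0 \<le> A" by simp
      from A0[OF this] eventually_ge_at_top[of 1]
      show "\<forall>\<^sub>F x in at_top. middle_part win \<nu> A x \<le> ennreal (e * win x)"
      proof eventually_elim
        case (elim x)
        have ind: "indicator {A<..<x - A} y * indicator {1<..} y = (indicator {A<..<x - A} y :: ennreal)" for y
          using A by (auto simp: indicator_def)
        have "middle_part win \<nu> A x
            = (\<integral>\<^sup>+y. ennreal tail_mass * (ennreal (?R (x - y)) * indicator {A<..<x - A} y * indicator {1<..} y) \<partial>\<nu>)"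
        proof (rule nn_integral_cong)
          fix y
          show "ennreal (win (x - y)) * indicator {A<..<x - A} y
            = ennreal tail_mass * (ennreal (?R (x - y)) * indicator {A<..<x - A} y * indicator {1<..} y)"
          proof (cases "y \<in> {A<..<x - A}")
            case True
            then have "win (x - y) = tail_mass * ?R (x - y)"
              unfolding win_def using A by (intro rho_window) auto
            then show ?thesis using lambda_pos True A by (simp add: ennreal_mult)
          qed simp
        qed
        also have "\<dots> = ennreal tail_mass * (\<integral>\<^sup>+y. ennreal (?R (x - y)) * indicator {A<..<x - A} y * indicator {1<..} y \<partial>\<nu>)"
          by (rule nn_integral_cmult) measurable
        also have "(\<integral>\<^sup>+y. ennreal (?R (x - y)) * indicator {A<..<x - A} y * indicator {1<..} y \<partial>\<nu>)
            = ennreal tail_mass * middle_part ?R \<rho> A x"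
          using lambda_pos by (subst nn_integral_rho) (auto simp: mult.assoc[symmetric] ennreal_mult[symmetric])
        also have "ennreal tail_mass * (ennreal tail_mass * middle_part ?R \<rho> A x)
            \<le> ennreal tail_mass * (ennreal tail_mass * ennreal (e / tail_mass * ?R x))"
          by (intro mult_left_mono elim) auto
        also have "\<dots> = ennreal (e * win x)"
          using lambda_pos \<open>0 < e\<close> elim(2) by (simp add: ennreal_mult[symmetric] win_def rho_window)
        finally show ?case .
      qed
    qed
  qed
qed

section \<open>From the Levy measure to the density\<close>

text \<open>
  Let \<open>U\<close> be the supremum of \<open>p / win\<close> over \<open>[A, Z]\<close>. In Steutel's identity at \<open>x\<close> in this interval the near and
  the middle part are each at most \<open>U / 8\<close> times \<open>x win x\<close>, and the far part at most twice that quantity. So \<open>U \<le> U / 4 + 2\<close> unless the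
  supremum is attained before the fixed point \<open>X\<close>, which bounds \<open>U\<close> independently of \<open>Z\<close>.
\<close>

lemma density_window_bound:
  assumes L: "\<rho> \<in> loc_long_tailed" and mid: middle_negligible
  shows "\<exists>K>0. \<forall>\<^sub>F x in at_top. p x \<le> K * win x"
proof -
  have al: "win \<in> long_tailed" by (rule win_long_tailed[OF L])
  obtain X0 where X0: "0 \<le> X0" "0 < win X0" "\<And>x. X0 \<le> x \<Longrightarrow> win X0 * exp (- (1 * (x - X0 + 1))) \<le> win x"
    using long_tailed_exponential_lower[OF al zero_less_one] by auto
  have win_pos: "0 < win x" if "X0 \<le> x" for x
    using X0(3)[OF that] mult_pos_pos[OF X0(2) exp_gt_zero] by (rule order.strict_trans2[rotated])
  obtain A1 where A1: "\<And>A. A1 \<le> A \<Longrightarrow> \<forall>\<^sub>F x in at_top.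
      far_part p \<nu> A x \<le> ennreal ((1 + 1) * win x)"
    using far_part_window[OF L zero_less_one] by (auto elim: eventually_mono)
  obtain A2 where A2: "\<And>A. A2 \<le> A \<Longrightarrow> \<forall>\<^sub>F x in at_top.
      middle_part win \<nu> A x \<le> ennreal (1 / 8 * win x)"
    using mid[unfolded middle_negligible_def, rule_format, of "1 / 8"] by auto
  define A where "A = max (max X0 1) (max A1 A2)"
  have A: "X0 \<le> A" "1 \<le> A" "A1 \<le> A" "A2 \<le> A" by (auto simp: A_def)
  define s where "s = enn2real (emeasure \<sigma> {0..A})"
  have s: "emeasure \<sigma> {0..A} = ennreal s" "0 \<le> s"
    using sigma_bounded[of "{0..A}" A] by (auto simp: s_def less_top[symmetric])
  obtain X where X: "max (3 * A) (16 * s) \<le> X" "\<And>x. X \<le> x \<Longrightarrow>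
      far_part p \<nu> A x \<le> ennreal ((1 + 1) * win x) \<and>
      middle_part win \<nu> A x \<le> ennreal (1 / 8 * win x) \<and>
      near_part win \<sigma> A x \<le> ennreal ((1 + 1) * win x) * emeasure \<sigma> {0..A}"
  proof -
    have "\<forall>\<^sub>F x in at_top. far_part p \<nu> A x \<le> ennreal ((1 + 1) * win x) \<and>
      middle_part win \<nu> A x \<le> ennreal (1 / 8 * win x) \<and>
      near_part win \<sigma> A x \<le> ennreal ((1 + 1) * win x) * emeasure \<sigma> {0..A}"
      using A1[OF A(3)] A2[OF A(4)] near_part_upper[OF al zero_less_one sets_sigma, of A]
      by eventually_elim blast
    then obtain X1 where "\<And>x. X1 \<le> x \<Longrightarrow> far_part p \<nu> A x \<le> ennreal ((1 + 1) * win x) \<and>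
      middle_part win \<nu> A x \<le> ennreal (1 / 8 * win x) \<and>
      near_part win \<sigma> A x \<le> ennreal ((1 + 1) * win x) * emeasure \<sigma> {0..A}"
      by (auto simp: eventually_at_top_linorder)
    then show ?thesis by (intro that[of "max X1 (max (3 * A) (16 * s))"]) auto
  qed
  have XA: "3 * A \<le> X" "16 * s \<le> X" using X(1) by auto
  (* The ratio is locally bounded: p is continuous and win has an exponential lower bound. *)
  have bdd: "\<exists>K\<ge>0. \<forall>t\<in>{A..Z}. p t \<le> K * win t" for Z
  proof -
    obtain b where b: "0 < b" "\<And>t. t \<le> Z \<Longrightarrow> p t \<le> b" using p_local_bound[of Z] by blast
    define l where "l = win X0 * exp (- (1 * (Z - X0 + 1)))"
    have l: "0 < l" using X0(2) by (simp add: l_def)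
    have "p t \<le> b / l * win t" if t: "t \<in> {A..Z}" for t
    proof -
      have "l \<le> win X0 * exp (- (1 * (t - X0 + 1)))"
        unfolding l_def using X0(2) t by (intro mult_left_mono) auto
      also have "\<dots> \<le> win t" using X0(3)[of t] t A by auto
      finally have "b / l * l \<le> b / l * win t" using b(1) l by (intro mult_left_mono) auto
      then have "b \<le> b / l * win t" using l by simp
      moreover have "p t \<le> b" using b(2)[of t] t by simp
      ultimately show ?thesis by (rule order_trans[rotated])
    qed
    then show ?thesis using b(1) l by (intro exI[of _ "b / l"]) auto
  qed
  obtain K0 where K0: "0 \<le> K0" "\<And>t. t \<in> {A..X} \<Longrightarrow> p t \<le> K0 * win t" using bdd[of X] by blast
  define K where "K = max K0 4"
  have "p t \<le> K * win t" if t: "A \<le> t" for t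
  proof -
    define Z where "Z = max t X"
    define U where "U = Sup ((\<lambda>t. p t / win t) ` {A..Z})"
    obtain K1 where K1: "0 \<le> K1" "\<And>t. t \<in> {A..Z} \<Longrightarrow> p t \<le> K1 * win t" using bdd[of Z] by blast
    have bd: "bdd_above ((\<lambda>t. p t / win t) ` {A..Z})"
      using K1(2) win_pos A(1) by (intro bdd_aboveI2[of _ _ K1]) (auto simp: field_simps)
    have U: "p u \<le> U * win u" if "u \<in> {A..Z}" for u
    proof -
      have "p u / win u \<le> U" unfolding U_def using that bd by (rule cSUP_upper)
      then show ?thesis using win_pos[of u] that A(1) by (simp add: field_simps)
    qed
    have AZ: "A \<in> {A..Z}" using t by (auto simp: Z_def)
    have "p A / win A \<le> U" unfolding U_def using AZ bd by (rule cSUP_upper)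
    moreover have "0 \<le> p A / win A" using p_nonneg win_nonneg by (rule divide_nonneg_nonneg)
    ultimately have U0: "0 \<le> U" by linarith
    have "U \<le> max K0 (U / 4 + 2)"
    proof (subst (1) U_def, rule cSUP_least)
      show "{A..Z} \<noteq> {}" using AZ by blast
      fix x assume x: "x \<in> {A..Z}"
      have ax: "0 < win x" using win_pos x A(1) by auto
      have "p x \<le> max K0 (U / 4 + 2) * win x"
      proof (cases "x \<le> X")
        case True
        then have "p x \<le> K0 * win x" using K0(2) x by auto
        also have "\<dots> \<le> max K0 (U / 4 + 2) * win x" using ax by (intro mult_right_mono) auto
        finally show ?thesis .
      next
        case False
        then have xX: "X \<le> x" by simp
        have x2: "2 * A < x" "0 < A" "0 < x" using xX XA A(2) by auto
        have "near_part p \<sigma> A x \<le> (\<integral>\<^sup>+y. ennreal U * (ennreal (win (x - y)) * indicator {0..A} y) \<partial>\<sigma>)"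
        proof (rule nn_integral_mono)
          fix y
          show "ennreal (p (x - y)) * indicator {0..A} y \<le> ennreal U * (ennreal (win (x - y)) * indicator {0..A} y)"
            using U[of "x - y"] x x2 U0 by (auto simp: indicator_def ennreal_mult[symmetric] win_nonneg intro!: ennreal_leI)
        qed
        also have "\<dots> = ennreal U * near_part win \<sigma> A x" by (rule nn_integral_cmult) measurable
        also have "\<dots> \<le> ennreal U * (ennreal ((1 + 1) * win x) * emeasure \<sigma> {0..A})" using X(2)[OF xX] by (intro mult_left_mono) auto
        also have "\<dots> = ennreal (U * (2 * win x * s))" unfolding s(1) using U0 ax s(2) by (simp add: ennreal_mult)
        finally have 1: "near_part p \<sigma> A x \<le> ennreal (U * (2 * win x * s))" .
        have "middle_part p \<sigma> A x \<le> ennreal x * middle_part p \<nu> A x"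
          by (rule nn_integral_sigma_upper) (use x2 in auto)
        also have "middle_part p \<nu> A x \<le> (\<integral>\<^sup>+y. ennreal U * (ennreal (win (x - y)) * indicator {A<..<x - A} y) \<partial>\<nu>)"
        proof (rule nn_integral_mono)
          fix y
          show "ennreal (p (x - y)) * indicator {A<..<x - A} y \<le> ennreal U * (ennreal (win (x - y)) * indicator {A<..<x - A} y)"
            using U[of "x - y"] x x2 U0 by (auto simp: indicator_def ennreal_mult[symmetric] win_nonneg intro!: ennreal_leI)
        qed
        also have "\<dots> = ennreal U * middle_part win \<nu> A x" by (rule nn_integral_cmult) measurable
        also have "\<dots> \<le> ennreal U * ennreal (1 / 8 * win x)" using X(2)[OF xX] by (intro mult_left_mono) auto
        finally have 2: "middle_part p \<sigma> A x \<le> ennreal (x * (U * (1 / 8 * win x)))"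
          using x2 U0 ax by (simp add: ennreal_mult[symmetric] mult_left_mono del: times_divide_eq_left times_divide_eq_right)
        have "far_part p \<sigma> A x \<le> ennreal x * far_part p \<nu> A x"
          by (rule far_part_sigma) (use x2 in auto)
        also have "\<dots> \<le> ennreal x * ennreal ((1 + 1) * win x)" using X(2)[OF xX] by (intro mult_left_mono) auto
        finally have 3: "far_part p \<sigma> A x \<le> ennreal (x * (2 * win x))"
          using x2 ax by (simp add: ennreal_mult)
        have "ennreal (x * p x) \<le> ennreal (U * (2 * win x * s)) + ennreal (x * (U * (1 / 8 * win x))) + ennreal (x * (2 * win x))"
          unfolding steutel_split[OF x2(2,1)] by (intro add_mono 1 2 3)
        also have "\<dots> = ennreal (U * (2 * win x * s) + x * (U * (1 / 8 * win x)) + x * (2 * win x))"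
          using x2 U0 ax s by (simp add: ennreal_plus)
        finally have "x * p x \<le> U * (2 * win x * s) + x * (U * (1 / 8 * win x)) + x * (2 * win x)"
          using x2 U0 ax s by (subst (asm) ennreal_le_iff) auto
        also have "U * (2 * win x * s) \<le> U * (win x * (x / 8))"
          using U0 ax XA xX by (intro mult_left_mono) auto
        finally have "x * p x \<le> x * ((U / 4 + 2) * win x)" by (simp add: algebra_simps)
        then have "p x \<le> (U / 4 + 2) * win x" using x2 by simp
        also have "\<dots> \<le> max K0 (U / 4 + 2) * win x" using ax by (intro mult_right_mono) auto
        finally show ?thesis .
      qed
      then show "p x / win x \<le> max K0 (U / 4 + 2)" using ax by (simp add: field_simps)
    qed
    then have "U \<le> K" unfolding K_def by (auto simp: max_def split: if_splits)
    have "p t \<le> U * win t" using U[of t] t by (auto simp: Z_def)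
    also have "\<dots> \<le> K * win t" using \<open>U \<le> K\<close> win_nonneg by (intro mult_right_mono)
    finally show ?thesis .
  qed
  then show ?thesis
    by (intro exI[of _ K]) (auto simp: K_def eventually_at_top_linorder intro!: exI[of _ A])
qed

text \<open>
  With the ratio \<open>p / win\<close> known to be bounded, the near and the middle part of Steutel's identity are negligible, and the
  far part is asymptotic to \<open>x win x\<close>.
\<close>

lemma density_asymp_window:
  assumes L: "\<rho> \<in> loc_long_tailed" and mid: middle_negligible
  shows "p \<simeq> win"
  unfolding asymp_pos_iff
proof (intro conjI allI impI)
  have al: "win \<in> long_tailed" by (rule win_long_tailed[OF L])
  show "\<forall>\<^sub>F x in at_top. 0 < win x" by (rule long_tailedD(4)[OF al])
  fix e :: real assume "0 < e"
  define d where "d = min (1 / 2) (e / 4)"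
  have d: "0 < d" "d \<le> 1 / 2" "4 * d \<le> e" using \<open>0 < e\<close> by (auto simp: d_def)
  obtain K B where K: "0 < K" "\<And>x. B \<le> x \<Longrightarrow> p x \<le> K * win x"
    using density_window_bound[OF L mid] by (auto simp: eventually_at_top_linorder)
  obtain A1 where A1: "\<And>A. A1 \<le> A \<Longrightarrow> \<forall>\<^sub>F x in at_top.
      ennreal ((1 - d) * win x) \<le> far_part p \<nu> A x \<and>
      far_part p \<nu> A x \<le> ennreal ((1 + d) * win x)"
    using far_part_window[OF L d(1)] by blast
  obtain A2 where A2: "\<And>A. A2 \<le> A \<Longrightarrow> \<forall>\<^sub>F x in at_top.
      middle_part win \<nu> A x \<le> ennreal (d / K * win x)"
    using mid[unfolded middle_negligible_def, rule_format, of "d / K"] d(1) K(1) by auto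
  define A where "A = max (max B 1) (max A1 A2)"
  have A: "B \<le> A" "1 \<le> A" "A1 \<le> A" "A2 \<le> A" by (auto simp: A_def)
  define s where "s = enn2real (emeasure \<sigma> {0..A})"
  have s: "emeasure \<sigma> {0..A} = ennreal s" "0 \<le> s"
    using sigma_bounded[of "{0..A}" A] by (auto simp: s_def less_top[symmetric])
  show "\<forall>\<^sub>F x in at_top. \<bar>p x - win x\<bar> \<le> e * win x"
    using A1[OF A(3)] A2[OF A(4)] near_part_upper[OF al zero_less_one sets_sigma, of A] long_tailedD(4)[OF al]
      eventually_gt_at_top[of "2 * A"] eventually_ge_at_top[of "2 * K * s / d"] eventually_ge_at_top[of "A / d"]
  proof eventually_elim
    case (elim x)
    have ax: "0 < win x" by fact
    have x2: "2 * A < x" "0 < A" "0 < x" using elim(5) A(2) by auto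
    have xs: "2 * K * s \<le> d * x" "A \<le> d * x" using elim(6,7) d(1) by (simp_all add: field_simps)
    have "near_part p \<sigma> A x \<le> (\<integral>\<^sup>+y. ennreal K * (ennreal (win (x - y)) * indicator {0..A} y) \<partial>\<sigma>)"
    proof (rule nn_integral_mono)
      fix y
      show "ennreal (p (x - y)) * indicator {0..A} y \<le> ennreal K * (ennreal (win (x - y)) * indicator {0..A} y)"
        using K(2)[of "x - y"] x2 A(1) K(1) by (auto simp: indicator_def ennreal_mult[symmetric] win_nonneg intro!: ennreal_leI)
    qed
    also have "\<dots> = ennreal K * near_part win \<sigma> A x" by (rule nn_integral_cmult) measurable
    also have "\<dots> \<le> ennreal K * (ennreal ((1 + 1) * win x) * emeasure \<sigma> {0..A})" using elim(3) by (intro mult_left_mono) auto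
    also have "\<dots> = ennreal (K * (2 * win x * s))" unfolding s(1) using K(1) ax s(2) by (simp add: ennreal_mult)
    finally have 1: "near_part p \<sigma> A x \<le> ennreal (K * (2 * win x * s))" .
    have "middle_part p \<sigma> A x \<le> ennreal x * middle_part p \<nu> A x"
      by (rule nn_integral_sigma_upper) (use x2 in auto)
    also have "middle_part p \<nu> A x \<le> (\<integral>\<^sup>+y. ennreal K * (ennreal (win (x - y)) * indicator {A<..<x - A} y) \<partial>\<nu>)"
    proof (rule nn_integral_mono)
      fix y
      show "ennreal (p (x - y)) * indicator {A<..<x - A} y \<le> ennreal K * (ennreal (win (x - y)) * indicator {A<..<x - A} y)"
        using K(2)[of "x - y"] x2 A(1) K(1) by (auto simp: indicator_def ennreal_mult[symmetric] win_nonneg intro!: ennreal_leI)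
    qed
    also have "\<dots> = ennreal K * middle_part win \<nu> A x" by (rule nn_integral_cmult) measurable
    also have "\<dots> \<le> ennreal K * ennreal (d / K * win x)" by (intro mult_left_mono elim) auto
    also have "\<dots> = ennreal (d * win x)" using K(1) d(1) ax by (simp add: ennreal_mult[symmetric])
    finally have 2: "middle_part p \<sigma> A x \<le> ennreal (x * (d * win x))"
      using x2 d(1) ax by (simp add: ennreal_mult[symmetric] mult_left_mono)
    have "far_part p \<sigma> A x \<le> ennreal x * far_part p \<nu> A x"
      by (rule far_part_sigma) (use x2 in auto)
    also have "\<dots> \<le> ennreal x * ennreal ((1 + d) * win x)" by (intro mult_left_mono elim(1)[THEN conjunct2]) auto
    finally have 3: "far_part p \<sigma> A x \<le> ennreal (x * ((1 + d) * win x))"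
      using x2 ax d(1) by (simp add: ennreal_mult)
    have "ennreal (x * p x) \<le> ennreal (K * (2 * win x * s)) + ennreal (x * (d * win x)) + ennreal (x * ((1 + d) * win x))"
      unfolding steutel_split[OF x2(2,1)] by (intro add_mono 1 2 3)
    also have "\<dots> = ennreal (K * (2 * win x * s) + x * (d * win x) + x * ((1 + d) * win x))"
      using x2 K(1) ax s d(1) by (simp add: ennreal_plus)
    finally have "x * p x \<le> K * (2 * win x * s) + x * (d * win x) + x * ((1 + d) * win x)"
      using x2 K(1) ax s d(1) by (subst (asm) ennreal_le_iff) auto
    also have "K * (2 * win x * s) = (2 * K * s) * win x" by simp
    also have "\<dots> \<le> (d * x) * win x" using xs(1) ax by (intro mult_right_mono) auto
    finally have "x * p x \<le> x * ((1 + 3 * d) * win x)" by (simp add: algebra_simps)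
    then have u: "p x \<le> (1 + 3 * d) * win x" using x2 by simp
    have "ennreal ((x - A) * ((1 - d) * win x)) = ennreal (x - A) * ennreal ((1 - d) * win x)"
      using x2 d ax by (intro ennreal_mult) auto
    also have "\<dots> \<le> ennreal (x - A) * far_part p \<nu> A x"
      by (intro mult_left_mono elim(1)[THEN conjunct1]) auto
    also have "\<dots> \<le> far_part p \<sigma> A x" by (rule far_part_sigma) (use x2 in auto)
    also have "\<dots> \<le> ennreal (x * p x)" unfolding steutel_split[OF x2(2,1)] by simp
    finally have "(x - A) * ((1 - d) * win x) \<le> x * p x"
      using x2 p_nonneg[of x] by (subst (asm) ennreal_le_iff) auto
    moreover have "(x - d * x) * ((1 - d) * win x) \<le> (x - A) * ((1 - d) * win x)"
      using xs(2) d ax by (intro mult_right_mono) auto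
    ultimately have "x * ((1 - d) * ((1 - d) * win x)) \<le> x * p x" by (simp add: algebra_simps)
    then have l: "(1 - d) * ((1 - d) * win x) \<le> p x" using x2 by simp
    have "(1 - d) * ((1 - d) * win x) = win x - 2 * (d * win x) + d * d * win x" by (simp add: algebra_simps)
    moreover have "0 \<le> d * d * win x" using ax by simp
    moreover have "4 * d * win x \<le> e * win x" using d ax by (intro mult_right_mono) auto
    moreover have "0 \<le> d * win x" using d ax by simp
    ultimately show ?case using u l by (auto simp: abs_le_iff algebra_simps)
  qed
qed

end

context steutel_density
begin

section \<open>From window asymptotics to subexponentiality\<close>

lemma far_part_sigma_lower:
  assumes L: "\<rho> \<in> loc_long_tailed" and "0 < d" "d < 1"
  shows "\<exists>A0. \<forall>A\<ge>A0. \<forall>\<^sub>F x in at_top.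
    ennreal (x * ((1 - d) * ((1 - d) * win x))) \<le> far_part p \<sigma> A x"
proof -
  obtain A0 where A0: "\<And>A. A0 \<le> A \<Longrightarrow> \<forall>\<^sub>F x in at_top.
      ennreal ((1 - d) * win x) \<le> far_part p \<nu> A x"
    using far_part_window[OF L \<open>0 < d\<close>] unfolding eventually_conj_iff by blast
  show ?thesis
  proof (intro exI[of _ "max A0 1"] allI impI)
    fix A assume "max A0 1 \<le> A"
    then have A: "A0 \<le> A" "0 < A" by auto
    show "\<forall>\<^sub>F x in at_top.
      ennreal (x * ((1 - d) * ((1 - d) * win x))) \<le> far_part p \<sigma> A x"
      using A0[OF A(1)] eventually_gt_at_top[of A] eventually_ge_at_top[of "A / d"]
    proof eventually_elim
      case (elim x)
      have "A \<le> d * x" using elim(3) \<open>0 < d\<close> by (simp add: field_simps)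
      then have "x * (1 - d) \<le> x - A" by (simp add: algebra_simps)
      moreover have "0 \<le> (1 - d) * win x" using assms(3) win_nonneg[of x] by (intro mult_nonneg_nonneg) auto
      ultimately have "x * (1 - d) * ((1 - d) * win x) \<le> (x - A) * ((1 - d) * win x)"
        by (rule mult_right_mono)
      then have "ennreal (x * ((1 - d) * ((1 - d) * win x))) \<le> ennreal ((x - A) * ((1 - d) * win x))"
        by (intro ennreal_leI) (simp add: mult_ac)
      also have "\<dots> = ennreal (x - A) * ennreal ((1 - d) * win x)"
        using elim(2) assms(3) win_nonneg[of x] by (intro ennreal_mult) auto
      also have "\<dots> \<le> ennreal (x - A) * far_part p \<nu> A x"
        by (rule mult_left_mono[OF elim(1)]) simp
      also have "\<dots> \<le> far_part p \<sigma> A x"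
        by (rule far_part_sigma(2)[OF A(2) elim(2)])
      finally show ?case .
    qed
  qed
qed

text \<open>
  The far part of Steutel's identity gives \<open>C \<ge> 1\<close>, the weighted identity gives \<open>C \<le> 1\<close>.
\<close>

lemma asymp_constant_eq_one:
  assumes L: "\<rho> \<in> loc_long_tailed" and C: "0 < C" and pa: "p \<simeq> (\<lambda>x. C * win x)"
  shows "C = 1"
proof (rule antisym)
  have al: "win \<in> long_tailed" by (rule win_long_tailed[OF L])
  have pl: "p \<in> long_tailed"
    by (rule long_tailed_asymp[OF long_tailed_cmult[OF al C] pa]) (auto simp: p_nonneg)
  have pa': "\<forall>\<^sub>F x in at_top. \<bar>p x - C * win x\<bar> \<le> d * (C * win x)" if "0 < d" for d
    using pa that unfolding asymp_pos_iff by blast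
  have ap: "\<forall>\<^sub>F x in at_top. 0 < win x" by (rule long_tailedD(4)[OF al])
  have "\<forall>\<^sub>F d in at_right (0::real). d < 1"
    by (rule order_tendstoD(2)[OF tendsto_ident_at zero_less_one])
  then have small: "\<forall>\<^sub>F d in at_right (0::real). 0 < d \<and> d < 1"
    using eventually_at_right_less[of "0::real"] by eventually_elim auto
  have le1: "(1 - d) * C \<le> 1" if d: "0 < d" "d < 1" for d
  proof -
    have "1 \<le> 1 / ((1 - d) * C)"
    proof (rule window_ratio_ge_one[OF pl])
      show "\<forall>\<^sub>F x in at_top. win x \<le> 1 / ((1 - d) * C) * p x"
        using pa'[OF d(1)]
      proof eventually_elim
        case (elim x)
        then have "(1 - d) * C * win x \<le> p x" by (simp add: abs_le_iff algebra_simps)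
        then show ?case using d C by (simp add: field_simps)
      qed
    qed (use d C in simp)
    then show ?thesis using d C by (simp add: field_simps)
  qed
  have "((\<lambda>d. (1 - d) * C) \<longlongrightarrow> (1 - 0) * C) (at_right 0)" by (intro tendsto_intros)
  moreover have "\<forall>\<^sub>F d in at_right 0. (1 - d) * C \<le> 1"
    using small by eventually_elim (simp add: le1)
  ultimately have "(1 - 0) * C \<le> 1" by (rule tendsto_upperbound) simp
  then show "C \<le> 1" by simp
  have ge1: "(1 - d) * (1 - d) \<le> (1 + d) * C" if d: "0 < d" "d < 1" for d
  proof -
    obtain A0 where A0: "\<And>A. A0 \<le> A \<Longrightarrow> \<forall>\<^sub>F x in at_top.
        ennreal (x * ((1 - d) * ((1 - d) * win x))) \<le> far_part p \<sigma> A x"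
      using far_part_sigma_lower[OF L d] by blast
    define A where "A = max A0 1"
    have A: "A0 \<le> A" "0 < A" by (auto simp: A_def)
    have "\<forall>\<^sub>F x in at_top. (1 - d) * (1 - d) * win x \<le> (1 + d) * C * win x \<and> 0 < win x"
      using A0[OF A(1)] pa'[OF d(1)] ap eventually_gt_at_top[of "2 * A"]
    proof eventually_elim
      case (elim x)
      have "ennreal (x * ((1 - d) * ((1 - d) * win x))) \<le> ennreal (x * p x)"
        unfolding steutel_split[OF A(2) elim(4)] using elim(1) by (simp add: add_increasing)
      then have "x * ((1 - d) * ((1 - d) * win x)) \<le> x * p x"
        using p_nonneg[of x] elim(4) A(2) by (subst (asm) ennreal_le_iff) auto
      then have "(1 - d) * ((1 - d) * win x) \<le> p x" using elim(4) A(2) by simp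
      also have "p x \<le> (1 + d) * (C * win x)" using elim(2) by (simp add: abs_le_iff algebra_simps)
      finally show ?case using elim(3) by (simp add: mult.assoc)
    qed
    from eventually_happens[OF this] show ?thesis by auto
  qed
  have "((\<lambda>d. (1 + d) * C) \<longlongrightarrow> (1 + 0) * C) (at_right 0)"
    "((\<lambda>d. (1 - d) * (1 - d)) \<longlongrightarrow> (1 - 0) * (1 - 0)) (at_right (0::real))" by (intro tendsto_intros)+
  moreover have "\<forall>\<^sub>F d in at_right 0. (1 - d) * (1 - d) \<le> (1 + d) * C"
    using small by eventually_elim (simp add: ge1)
  ultimately have "(1 - 0) * (1 - 0) \<le> (1 + 0) * C" by (intro tendsto_le[of "at_right (0::real)"]) auto
  then show "1 \<le> C" by simp
qed

text \<open>
  The far part takes up nearly all of \<open>x p x\<close>, so the middle part against \<open>\<sigma>\<close> is negligible. Its windows dominate \<open>z p z\<close>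
  up to a constant, and by symmetry \<open>x\<close> times the middle part of \<open>p\<close> against itself is twice the
  integral that carries the weight \<open>z\<close>.
\<close>

lemma asymp_window_imp_subexp:
  assumes L: "\<rho> \<in> loc_long_tailed" and pa: "p \<simeq> win"
  shows "p \<in> subexp_densities"
proof -
  have al: "win \<in> long_tailed" by (rule win_long_tailed[OF L])
  have pl: "p \<in> long_tailed"
    by (rule long_tailed_asymp[OF al pa]) (auto simp: p_nonneg)
  have pa': "\<forall>\<^sub>F x in at_top. \<bar>p x - win x\<bar> \<le> d * win x" if "0 < d" for d
    using pa that unfolding asymp_pos_iff by blast
  show ?thesis
  proof (rule subexponentialI[OF pl])
    fix e :: real assume "0 < e"
    define d where "d = min (1 / 2) (e / 24)"
    have d: "0 < d" "d < 1" "24 * d \<le> e" using \<open>0 < e\<close> by (auto simp: d_def)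
    obtain A1 where A1: "\<And>A. A1 \<le> A \<Longrightarrow> \<forall>\<^sub>F x in at_top.
        ennreal (x * ((1 - d) * ((1 - d) * win x))) \<le> far_part p \<sigma> A x"
      using far_part_sigma_lower[OF L d(1,2)] by blast
    obtain b where b: "\<And>x. b \<le> x \<Longrightarrow> p x \<le> 2 * win x"
      using pa'[OF zero_less_one] by (auto simp: eventually_at_top_linorder abs_le_iff)
    (* The cut at 0 only makes g nonnegative without using the support of p. *)
    define g where "g z = (if 0 \<le> z then z * p z else 0)" for z
    have [measurable]: "g \<in> borel_measurable borel" unfolding g_def by measurable
    have "\<exists>A2. \<forall>A\<ge>A2. \<forall>x. (\<integral>\<^sup>+z\<in>{A<..<x - A - 1}. ennreal (p (x - z)) * ennreal (g z) \<partial>lborel)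
      \<le> ennreal ((1 + 1) * 2) * middle_part p \<sigma> A x"
    proof (rule middle_part_lower[OF sigma_finite_sigma sets_sigma pl])
      fix z assume z: "max b 1 \<le> z"
      then have "0 < z" by simp
      have "ennreal (g z) \<le> ennreal (2 * (z * win z))"
        using b[of z] z by (intro ennreal_leI) (auto simp: g_def)
      also have "\<dots> = ennreal 2 * (ennreal z * emeasure \<nu> {z<..z + 1})"
        using z win_nonneg[of z] by (simp add: nu_unit_window ennreal_mult)
      also have "\<dots> \<le> ennreal 2 * emeasure \<sigma> {z<..z + 1}"
        by (intro mult_left_mono sigma_window_lower) auto
      finally show "ennreal (g z) \<le> ennreal 2 * emeasure \<sigma> {z<..z + 1}" .
    qed auto
    then obtain A2 where A2: "\<And>A x. A2 \<le> A \<Longrightarrow> (\<integral>\<^sup>+z\<in>{A<..<x - A - 1}. ennreal (p (x - z)) * ennreal (g z) \<partial>lborel)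
      \<le> ennreal ((1 + 1) * 2) * middle_part p \<sigma> A x" by blast
    show "\<exists>A0. \<forall>A\<ge>A0. \<forall>\<^sub>F x in at_top. middle_part p \<mu> A x \<le> ennreal (e * p x)"
    proof (intro exI[of _ "max 1 (max A1 A2) + 1"] allI impI)
      fix A' assume A': "max 1 (max A1 A2) + 1 \<le> A'"
      define A where "A = A' - 1"
      have A: "A1 \<le> A" "A2 \<le> A" "1 \<le> A" "A' = A + 1" using A' by (auto simp: A_def)
      show "\<forall>\<^sub>F x in at_top. middle_part p \<mu> A' x \<le> ennreal (e * p x)"
        using A1[OF A(1)] pa'[OF d(1)] long_tailedD(4)[OF pl] eventually_gt_at_top[of "2 * A"]
      proof eventually_elim
        case (elim x)
        have x: "0 < x" "2 * A < x" "0 < A" using elim(4) A(3) by auto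
        have px: "0 < p x" by fact
        have "(1 - d) * p x \<le> win x"
        proof -
          have "p x \<le> (1 + d) * win x" using elim(2) by (simp add: abs_le_iff algebra_simps)
          then have "(1 - d) * p x \<le> (1 - d) * ((1 + d) * win x)" using d by (intro mult_left_mono) auto
          also have "\<dots> = win x - d * d * win x" by (simp add: algebra_simps)
          also have "\<dots> \<le> win x" using win_nonneg[of x] by simp
          finally show ?thesis .
        qed
        then have "x * ((1 - d) * ((1 - d) * ((1 - d) * p x))) \<le> x * ((1 - d) * ((1 - d) * win x))"
          using d x by (intro mult_left_mono) auto
        then have "ennreal (x * ((1 - d) * ((1 - d) * ((1 - d) * p x)))) \<le> ennreal (x * ((1 - d) * ((1 - d) * win x)))"
          by (rule ennreal_leI)
        also have "\<dots> \<le> far_part p \<sigma> A x" by (rule elim(1))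
        finally have "ennreal (x * ((1 - d) * ((1 - d) * ((1 - d) * p x)))) + middle_part p \<sigma> A x
            \<le> far_part p \<sigma> A x + middle_part p \<sigma> A x"
          by (rule add_right_mono)
        also have "\<dots> \<le> ennreal (x * p x)"
          unfolding steutel_split[OF x(3,2)] by (simp only: add.assoc) (simp only: add.commute add_increasing zero_le order_refl)
        finally have "middle_part p \<sigma> A x
            \<le> ennreal (x * p x - x * ((1 - d) * ((1 - d) * ((1 - d) * p x))))"
          by (rule ennreal_le_diffI) (use d x px in auto)
        also have "\<dots> \<le> ennreal (3 * d * (x * p x))"
        proof (rule ennreal_leI)
          have "x * p x - x * ((1 - d) * ((1 - d) * ((1 - d) * p x))) = (3 * d - d * d * (3 - d)) * (x * p x)"
            by (simp add: algebra_simps)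
          also have "\<dots> \<le> 3 * d * (x * p x)" using d x px by (intro mult_right_mono) auto
          finally show "x * p x - x * ((1 - d) * ((1 - d) * ((1 - d) * p x))) \<le> 3 * d * (x * p x)" .
        qed
        finally have mid: "middle_part p \<sigma> A x \<le> ennreal (3 * d * (x * p x))" .
        let ?J = "{A'<..<x - A'}"
        have "(\<integral>\<^sup>+z\<in>?J. ennreal (p (x - z)) * ennreal (z * p z) \<partial>lborel)
            \<le> (\<integral>\<^sup>+z\<in>{A<..<x - A - 1}. ennreal (p (x - z)) * ennreal (g z) \<partial>lborel)"
          by (rule nn_integral_mono) (use A in \<open>auto simp: indicator_def g_def\<close>)
        also have "\<dots> \<le> ennreal ((1 + 1) * 2) * middle_part p \<sigma> A x"
          by (rule A2[OF A(2)])
        also have "\<dots> \<le> ennreal ((1 + 1) * 2) * ennreal (3 * d * (x * p x))"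
          by (rule mult_left_mono[OF mid]) simp
        also have "\<dots> = ennreal (12 * d * (x * p x))"
          using d x px by (subst ennreal_mult[symmetric]) auto
        finally have half: "(\<integral>\<^sup>+z\<in>?J. ennreal (p (x - z)) * ennreal (z * p z) \<partial>lborel) \<le> ennreal (12 * d * (x * p x))" .
        have refl: "(\<integral>\<^sup>+z\<in>?J. ennreal ((x - z) * p (x - z)) * ennreal (p z) \<partial>lborel)
            = (\<integral>\<^sup>+z\<in>?J. ennreal (p (x - z)) * ennreal (z * p z) \<partial>lborel)"
          by (subst nn_integral_real_affine[where c="-1" and t=x])
            (auto intro!: nn_integral_cong simp: indicator_def mult.commute)
        have "ennreal x * (\<integral>\<^sup>+y\<in>?J. ennreal (p (x - y)) \<partial>\<mu>)
            = ennreal x * (\<integral>\<^sup>+z. ennreal (p z) * (ennreal (p (x - z)) * indicator ?J z) \<partial>lborel)"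
          by (subst nn_integral_mu) auto
        also have "\<dots> = (\<integral>\<^sup>+z. ennreal x * (ennreal (p z) * (ennreal (p (x - z)) * indicator ?J z)) \<partial>lborel)"
          by (rule nn_integral_cmult[symmetric]) measurable
        also have "\<dots> = (\<integral>\<^sup>+z. ennreal (p (x - z)) * ennreal (z * p z) * indicator ?J z
            + ennreal ((x - z) * p (x - z)) * ennreal (p z) * indicator ?J z \<partial>lborel)"
        proof (rule nn_integral_cong)
          fix z
          show "ennreal x * (ennreal (p z) * (ennreal (p (x - z)) * indicator ?J z))
            = ennreal (p (x - z)) * ennreal (z * p z) * indicator ?J z
            + ennreal ((x - z) * p (x - z)) * ennreal (p z) * indicator ?J z"
          proof (cases "z \<in> ?J")
            case True
            then have z: "0 \<le> z" "0 \<le> x - z" using A by auto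
            then have nn: "0 \<le> p (x - z) * (z * p z)" "0 \<le> (x - z) * p (x - z) * p z"
              using p_nonneg by auto
            have "x * (p z * p (x - z)) = p (x - z) * (z * p z) + (x - z) * p (x - z) * p z"
              by (simp add: algebra_simps)
            then have "ennreal (x * (p z * p (x - z))) = ennreal (p (x - z) * (z * p z)) + ennreal ((x - z) * p (x - z) * p z)"
              using ennreal_plus[OF nn] by simp
            then show ?thesis using True z x p_nonneg by (simp add: ennreal_mult)
          qed simp
        qed
        also have "\<dots> = (\<integral>\<^sup>+z\<in>?J. ennreal (p (x - z)) * ennreal (z * p z) \<partial>lborel)
            + (\<integral>\<^sup>+z\<in>?J. ennreal ((x - z) * p (x - z)) * ennreal (p z) \<partial>lborel)"
          by (rule nn_integral_add) measurable
        also have "\<dots> \<le> ennreal (12 * d * (x * p x)) + ennreal (12 * d * (x * p x))"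
          unfolding refl by (intro add_mono half)
        also have "\<dots> = ennreal (x * (24 * d * p x))"
          using d x px by (subst ennreal_plus[symmetric]) (auto simp: algebra_simps)
        finally have "(\<integral>\<^sup>+y\<in>?J. ennreal (p (x - y)) \<partial>\<mu>) \<le> ennreal (24 * d * p x)"
          using x(1) by (rule ennreal_mult_le_cancelD)
        also have "\<dots> \<le> ennreal (e * p x)" using d(3) px by (intro ennreal_leI mult_right_mono) auto
        finally show ?case .
      qed
    qed
  qed
qed

text \<open>
  Windows of the normalized Levy measure and values of \<open>p\<close> are comparable, so the middle part of its convolution
  square is controlled by that of \<open>p\<close>; near and far part contribute one window each.
\<close>

lemma asymp_window_imp_loc_subexp:
  assumes S: "p \<in> subexp_densities" and L: "\<rho> \<in> loc_long_tailed" and pa: "p \<simeq> win"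
  shows "\<rho> \<in> loc_subexp"
proof -
  have pl: "p \<in> long_tailed" and pp: "density_conv p p \<simeq> (\<lambda>x. 2 * p x)"
    using S by (auto simp: subexp_densities_def long_tailed_densities_def)
  interpret rho: real_distribution \<rho> by (rule rho_distribution)
  interpret RR: real_distribution "\<rho> \<star> \<rho>"
    by (rule half_line_distributionD[OF half_line_distribution_convolution[OF rho_half_line rho_half_line]])
  have "(\<lambda>x. measure (\<rho> \<star> \<rho>) {x<..x + c}) \<simeq> (\<lambda>x. 2 * measure \<rho> {x<..x + c})" if "0 < c" for c
  proof -
    define r where "r x = measure \<rho> {x<..x + c}" for x
    have rl: "r \<in> long_tailed" unfolding r_def[abs_def] by (rule loc_long_tailedD[OF L \<open>0 < c\<close>])
    note [measurable] = long_tailedD(1)[OF rl]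
    have r0: "0 \<le> r x" for x by (simp add: r_def)
    have p_rho: "p \<simeq> (\<lambda>x. tail_mass * measure \<rho> {x<..x + 1})"
      by (rule asymp_pos_trans[OF pa win_rho_asymp[OF L]])
    have "r \<simeq> (\<lambda>x. c * measure \<rho> {x<..x + 1})"
      unfolding r_def[abs_def] by (rule window_linear[OF rho.finite_measure_axioms sets_rho loc_long_tailedD[OF L] \<open>0 < c\<close>])
    moreover have "(\<lambda>x. c / tail_mass * p x) \<simeq> (\<lambda>x. c / tail_mass * (tail_mass * measure \<rho> {x<..x + 1}))"
      by (rule asymp_pos_cmult[OF p_rho]) (use \<open>0 < c\<close> lambda_pos in simp)
    then have "(\<lambda>x. c / tail_mass * p x) \<simeq> (\<lambda>x. c * measure \<rho> {x<..x + 1})"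
      using lambda_pos by simp
    ultimately have rp: "r \<simeq> (\<lambda>x. c / tail_mass * p x)"
      using asymp_pos_sym asymp_pos_trans by blast
    define k where "k = 2 * c / tail_mass"
    have k: "0 < k" using \<open>0 < c\<close> lambda_pos by (simp add: k_def)
    have "\<forall>\<^sub>F x in at_top. \<bar>r x - c / tail_mass * p x\<bar> \<le> 1 * (c / tail_mass * p x)"
      using rp zero_less_one unfolding asymp_pos_iff by blast
    then have "\<forall>\<^sub>F x in at_top. r x \<le> k * p x"
      by eventually_elim (simp add: k_def abs_le_iff)
    then obtain b1 where b1: "\<And>x. b1 \<le> x \<Longrightarrow> r x \<le> k * p x"
      unfolding eventually_at_top_linorder by blast
    have "\<forall>\<^sub>F x in at_top. \<bar>c / tail_mass * p x - r x\<bar> \<le> 1 * r x"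
      using asymp_pos_sym[OF rp] zero_less_one unfolding asymp_pos_iff by blast
    then have p_r: "\<forall>\<^sub>F x in at_top. p x \<le> 4 / k * r x"
    proof eventually_elim
      case (elim x)
      then have "c / tail_mass * p x \<le> 2 * r x" by (simp add: abs_le_iff)
      then show ?case using \<open>0 < c\<close> lambda_pos by (simp add: k_def field_simps)
    qed
    have "\<forall>\<^sub>F x in at_top. \<bar>tail_mass * measure \<rho> {x<..x + 1} - p x\<bar> \<le> 1 * p x"
      using asymp_pos_sym[OF p_rho] zero_less_one unfolding asymp_pos_iff by blast
    then have "\<forall>\<^sub>F x in at_top. tail_mass * measure \<rho> {x<..x + 1} \<le> 2 * p x"
      by eventually_elim (simp add: abs_le_iff)
    then obtain b2 where b2: "\<And>x. b2 \<le> x \<Longrightarrow> tail_mass * measure \<rho> {x<..x + 1} \<le> 2 * p x"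
      unfolding eventually_at_top_linorder by blast
    define k2 where "k2 = 2 / tail_mass"
    have k2: "0 < k2" using lambda_pos by (simp add: k2_def)
    have "\<exists>A1. \<forall>A\<ge>A1. \<forall>x. middle_part r \<rho> A x
        \<le> ennreal ((1 + 1) * k2) * (\<integral>\<^sup>+z\<in>{A - 1<..<x - A}. ennreal (r (x - z)) * ennreal (p z) \<partial>lborel)"
    proof (rule middle_part_upper[OF rho.sigma_finite_measure_axioms sets_rho rl])
      fix z assume "b2 \<le> z"
      then have "measure \<rho> {z<..z + 1} \<le> k2 * p z"
        using b2[of z] lambda_pos by (simp add: k2_def field_simps)
      then show "emeasure \<rho> {z<..z + 1} \<le> ennreal (k2 * p z)"
        unfolding rho.emeasure_eq_measure by (rule ennreal_leI)
    qed (use k2 in auto)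
    then obtain A1 where A1: "\<And>A x. A1 \<le> A \<Longrightarrow> middle_part r \<rho> A x
        \<le> ennreal ((1 + 1) * k2) * (\<integral>\<^sup>+z\<in>{A - 1<..<x - A}. ennreal (r (x - z)) * ennreal (p z) \<partial>lborel)" by blast
    show ?thesis
      unfolding r_def[symmetric] asymp_pos_iff
    proof (intro conjI allI impI)
      show "\<forall>\<^sub>F x in at_top. 0 < 2 * r x" using long_tailedD(4)[OF rl] by simp
      fix e :: real assume "0 < e"
      define d where "d = min (1 / 2) (e / 2)"
      have d: "0 < d" "d \<le> 1 / 2" "2 * d \<le> e" using \<open>0 < e\<close> by (auto simp: d_def)
      define d' where "d' = d / (4 * k2)"
      have d': "0 < d'" using d k2 by (simp add: d'_def)
      obtain A2 where A2: "\<And>A. A2 \<le> A \<Longrightarrow> \<forall>\<^sub>F x in at_top. middle_part p \<mu> A x \<le> ennreal (d' * p x)"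
        using density_middle_small[OF pl pp d'] by blast
      obtain A3 where A3: "\<And>A. A3 \<le> A \<Longrightarrow> ennreal (1 - d) \<le> emeasure \<rho> {0..A}"
        using distribution_mass[OF rho_distribution half_line_distributionD(7)[OF rho_half_line] d(1)]
        by (auto simp: eventually_at_top_linorder)
      define A where "A = max (max 1 A1) (max (max A2 A3 + 1) b1)"
      have A: "0 < A" "A1 \<le> A" "A2 \<le> A - 1" "A3 \<le> A" "b1 \<le> A" by (auto simp: A_def)
      show "\<forall>\<^sub>F x in at_top. \<bar>measure (\<rho> \<star> \<rho>) {x<..x + c} - 2 * r x\<bar> \<le> e * (2 * r x)"
        using A2[OF A(3)] near_part_upper[OF rl d(1) sets_rho, of A] near_part_upper[OF rl d(1) sets_rho, of "A + c"]
          near_part_lower[OF rl d(1) sets_rho, of A] eventually_gt_at_top[of "2 * A"] long_tailedD(4)[OF rl] p_r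
      proof eventually_elim
        case (elim x)
        have rx: "0 < r x" by fact
        let ?N = "\<lambda>A. \<integral>\<^sup>+y\<in>{0..A}. ennreal (r (x - y)) \<partial>\<rho>"
        let ?M = "\<integral>\<^sup>+y\<in>{A<..<x - A}. ennreal (r (x - y)) \<partial>\<rho>"
        let ?F = "\<integral>\<^sup>+y\<in>{x - A..}. ennreal (r (x - y)) \<partial>\<rho>"
        have split: "ennreal (measure (\<rho> \<star> \<rho>) {x<..x + c}) = ?N A + ?M + ?F"
        proof -
          have "ennreal (measure (\<rho> \<star> \<rho>) {x<..x + c}) = (\<integral>\<^sup>+y. ennreal (r (x - y)) \<partial>\<rho>)"
            unfolding RR.emeasure_eq_measure[symmetric] r_def
            by (rule half_line_convolution_window[OF rho_half_line \<open>0 < c\<close>])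
          also have "\<dots> = ?N A + ?M + ?F"
            by (rule nn_integral_split3) (use elim(5) A(1) half_line_distributionD(7)[OF rho_half_line] in auto)
          finally show ?thesis .
        qed
        have Nu: "?N A' \<le> ennreal ((1 + d) * r x)" if "?N A' \<le> ennreal ((1 + d) * r x) * emeasure \<rho> {0..A'}" for A'
        proof -
          note that
          also have "ennreal ((1 + d) * r x) * emeasure \<rho> {0..A'} \<le> ennreal ((1 + d) * r x) * 1"
            by (intro mult_left_mono rho.emeasure_le_1) auto
          finally show ?thesis by simp
        qed
        have Fu: "?F \<le> ennreal ((1 + d) * r x)"
          using half_line_near_far(2)[OF rho_half_line \<open>0 < c\<close>, of x A] Nu[OF elim(3)]
          unfolding r_def[symmetric] by (rule order_trans)
        have "(\<integral>\<^sup>+z\<in>{A - 1<..<x - A}. ennreal (r (x - z)) * ennreal (p z) \<partial>lborel)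
            \<le> (\<integral>\<^sup>+z. ennreal k * (ennreal (p z) * (ennreal (p (x - z)) * indicator {A - 1<..<x - (A - 1)} z)) \<partial>lborel)"
        proof (rule nn_integral_mono)
          fix z
          show "ennreal (r (x - z)) * ennreal (p z) * indicator {A - 1<..<x - A} z
            \<le> ennreal k * (ennreal (p z) * (ennreal (p (x - z)) * indicator {A - 1<..<x - (A - 1)} z))"
          proof (cases "z \<in> {A - 1<..<x - A}")
            case True
            have "ennreal (r (x - z)) \<le> ennreal (k * p (x - z))"
              using b1[of "x - z"] True A(5) by (intro ennreal_leI) auto
            then have "ennreal (r (x - z)) * ennreal (p z) \<le> ennreal (k * p (x - z)) * ennreal (p z)"
              by (rule mult_right_mono) simp
            then show ?thesis using True k p_nonneg by (simp add: ennreal_mult mult_ac)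
          qed simp
        qed
        also have "\<dots> = ennreal k * (\<integral>\<^sup>+z. ennreal (p z) * (ennreal (p (x - z)) * indicator {A - 1<..<x - (A - 1)} z) \<partial>lborel)"
          by (rule nn_integral_cmult) measurable
        also have "\<dots> = ennreal k * middle_part p \<mu> (A - 1) x"
          by (subst nn_integral_mu) auto
        also have "\<dots> \<le> ennreal k * ennreal (d' * p x)" by (rule mult_left_mono[OF elim(1)]) simp
        finally have "(\<integral>\<^sup>+z\<in>{A - 1<..<x - A}. ennreal (r (x - z)) * ennreal (p z) \<partial>lborel) \<le> ennreal k * ennreal (d' * p x)" .
        then have "?M \<le> ennreal ((1 + 1) * k2) * (ennreal k * ennreal (d' * p x))"
          using A1[OF A(2), of x] by (meson mult_left_mono order_trans zero_le)
        also have "\<dots> = ennreal ((1 + 1) * k2 * (k * (d' * p x)))"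
          using k k2 d' p_nonneg[of x] by (simp add: ennreal_mult)
        also have "\<dots> \<le> ennreal (2 * d * r x)"
        proof (rule ennreal_leI)
          have "(1 + 1) * k2 * (k * (d' * p x)) = k * (d / 2) * p x" using k2 by (simp add: d'_def)
          also have "\<dots> \<le> k * (d / 2) * (4 / k * r x)" using elim(7) k d(1) by (intro mult_left_mono) auto
          also have "\<dots> = 2 * d * r x" using k by simp
          finally show "(1 + 1) * k2 * (k * (d' * p x)) \<le> 2 * d * r x" .
        qed
        finally have Mu: "?M \<le> ennreal (2 * d * r x)" .
        have "ennreal (measure (\<rho> \<star> \<rho>) {x<..x + c}) \<le> ennreal ((1 + d) * r x) + ennreal (2 * d * r x) + ennreal ((1 + d) * r x)"
          unfolding split by (intro add_mono Nu[OF elim(2)] Mu Fu)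
        also have "\<dots> = ennreal ((1 + d) * r x + 2 * d * r x + (1 + d) * r x)"
          using d rx by (simp add: ennreal_plus[symmetric] del: ennreal_plus)
        finally have u: "measure (\<rho> \<star> \<rho>) {x<..x + c} \<le> (1 + d) * r x + 2 * d * r x + (1 + d) * r x"
          using d rx by (subst (asm) ennreal_le_iff) auto
        have "ennreal ((1 - d) * r x * (1 - d)) = ennreal ((1 - d) * r x) * ennreal (1 - d)"
          using d rx by (intro ennreal_mult) auto
        also have "\<dots> \<le> ennreal ((1 - d) * r x) * emeasure \<rho> {0..A}" using A3[OF A(4)] by (intro mult_left_mono) auto
        also have "\<dots> \<le> ?N A" by fact
        finally have Nl: "ennreal ((1 - d) * r x * (1 - d)) \<le> ?N A" .
        have Fl: "?N A \<le> ?F"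
          unfolding r_def by (rule half_line_near_far(1)[OF rho_half_line \<open>0 < c\<close>])
        have "ennreal ((1 - d) * r x * (1 - d)) + 0 + ennreal ((1 - d) * r x * (1 - d)) \<le> ?N A + ?M + ?F"
          by (intro add_mono Nl order_trans[OF Nl Fl]) simp
        then have "ennreal ((1 - d) * r x * (1 - d) + (1 - d) * r x * (1 - d)) \<le> ennreal (measure (\<rho> \<star> \<rho>) {x<..x + c})"
          unfolding split using d rx by (subst ennreal_plus) auto
        then have l: "(1 - d) * r x * (1 - d) + (1 - d) * r x * (1 - d) \<le> measure (\<rho> \<star> \<rho>) {x<..x + c}"
          by (subst (asm) ennreal_le_iff) auto
        have "(1 - d) * r x * (1 - d) = r x - 2 * (d * r x) + d * d * r x" by (simp add: algebra_simps)
        moreover have "0 \<le> d * d * r x" using rx by simp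
        moreover have "2 * d * r x \<le> e * r x" using d rx by (intro mult_right_mono) auto
        ultimately show "\<bar>measure (\<rho> \<star> \<rho>) {x<..x + c} - 2 * r x\<bar> \<le> e * (2 * r x)" using u l
          by (auto simp: abs_le_iff algebra_simps)
      qed
    qed
  qed
  then show ?thesis using L by (simp add: loc_subexp_def loc_long_tailed_def)
qed

end

section \<open>Windows of the size-biased Levy measure\<close>

lemma return_convolution:
  assumes "half_line_distribution M"
  shows "(return borel 0 \<star> M) = M" and "(M \<star> return borel 0) = M"
proof -
  note D = half_line_distributionD[OF assms] half_line_distributionD[OF half_line_distribution_return]
  show *: "(return borel 0 \<star> M) = M"
  proof (rule measure_eqI)
    show "sets (return borel 0 \<star> M) = sets M" by (simp add: D)
    fix B assume "B \<in> sets (return borel 0 \<star> M)"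
    then have [measurable]: "B \<in> sets borel" by simp
    have [measurable_cong]: "sets M = sets borel" by (rule D)
    have "emeasure (return borel 0 \<star> M) B = (\<integral>\<^sup>+x. indicator B x \<partial>(return borel 0 \<star> M))" by simp
    also have "\<dots> = (\<integral>\<^sup>+x. \<integral>\<^sup>+y. indicator B (x + y) \<partial>M \<partial>return borel 0)"
      by (rule nn_integral_convolution_half_line[OF half_line_distribution_return assms]) simp
    also have "\<dots> = (\<integral>\<^sup>+y. indicator B (0 + y) \<partial>M)"
    proof -
      interpret real_distribution M by (rule D)
      show ?thesis by (rule nn_integral_return) auto
    qed
    finally show "emeasure (return borel 0 \<star> M) B = emeasure M B" by (simp add: D)
  qed
  then show "(M \<star> return borel 0) = M"
    using convolution_commutative[of M "return borel 0"] D by simp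
qed

context steutel_density
begin

text \<open>
  The mass of a window under the convolution of the measure \<open>\<sigma>\<close>, which may be infinite, with a distribution.
\<close>

definition sigma_conv :: "real measure \<Rightarrow> real \<Rightarrow> real \<Rightarrow> ennreal" where
  "sigma_conv \<kappa> c x = (\<integral>\<^sup>+u. emeasure \<sigma> {x - u<..x - u + c} \<partial>\<kappa>)"

lemma sigma_window_measurable [measurable]: "(\<lambda>x. emeasure \<sigma> {x<..x + c}) \<in> borel_measurable borel"
  using window_measurable[OF sigma_finite_sigma sets_sigma, of UNIV c] by simp

lemma sigma_conv_measurable [measurable]:
  assumes "half_line_distribution \<kappa>" shows "sigma_conv \<kappa> c \<in> borel_measurable borel"
proof -
  have [measurable_cong]: "sets \<kappa> = sets borel" by (rule half_line_distributionD[OF assms])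
  interpret real_distribution \<kappa> by (rule half_line_distributionD[OF assms])
  have "(\<lambda>(x, u). emeasure \<sigma> {x - u<..x - u + c}) \<in> borel_measurable (borel \<Otimes>\<^sub>M \<kappa>)"
    unfolding split_beta by (rule measurable_compose[OF _ sigma_window_measurable]) measurable
  then show ?thesis unfolding sigma_conv_def by (rule borel_measurable_nn_integral)
qed

lemma sigma_conv_return: "sigma_conv (return borel 0) c x = emeasure \<sigma> {x<..x + c}"
  unfolding sigma_conv_def by (subst nn_integral_return) auto

lemma sigma_conv_bounded:
  assumes "half_line_distribution \<kappa>" "x \<le> R"
  shows "sigma_conv \<kappa> c x \<le> emeasure \<sigma> {..R + c}"
proof -
  note D = half_line_distributionD[OF assms(1)]
  interpret real_distribution \<kappa> by (rule D)
  have "sigma_conv \<kappa> c x \<le> (\<integral>\<^sup>+u. emeasure \<sigma> {..R + c} \<partial>\<kappa>)"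
    unfolding sigma_conv_def
    by (rule nn_integral_mono_AE, use D(7) in eventually_elim)
      (use assms(2) in \<open>auto intro!: emeasure_mono\<close>)
  then show ?thesis by (simp add: emeasure_space_1[simplified])
qed

lemma sigma_conv_zero:
  assumes "half_line_distribution \<kappa>" "x \<le> - c"
  shows "sigma_conv \<kappa> c x = 0"
proof -
  have "emeasure \<sigma> {..0} = 0"
    using sigma_pos by (subst (asm) AE_iff_measurable[OF _ refl]) (auto simp: not_less atMost_def)
  then have "sigma_conv \<kappa> c x \<le> 0"
    using sigma_conv_bounded[OF assms(1) assms(2), of c] by simp
  then show ?thesis by simp
qed

lemma sigma_conv_convolution:
  assumes \<kappa>: "half_line_distribution \<kappa>" and \<pi>: "half_line_distribution \<pi>"
  shows "sigma_conv (\<kappa> \<star> \<pi>) c x = (\<integral>\<^sup>+u. sigma_conv \<kappa> c (x - u) \<partial>\<pi>)"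
proof -
  note D = half_line_distributionD[OF \<kappa>] half_line_distributionD[OF \<pi>]
  have "(\<kappa> \<star> \<pi>) = (\<pi> \<star> \<kappa>)" by (rule convolution_commutative) (auto simp: D)
  then have "sigma_conv (\<kappa> \<star> \<pi>) c x = (\<integral>\<^sup>+u. \<integral>\<^sup>+v. emeasure \<sigma> {x - (u + v)<..x - (u + v) + c} \<partial>\<kappa> \<partial>\<pi>)"
    unfolding sigma_conv_def
    by (simp only:) (rule nn_integral_convolution_half_line[OF \<pi> \<kappa>], rule measurable_compose[OF _ sigma_window_measurable], measurable)
  then show ?thesis by (simp add: sigma_conv_def diff_diff_eq)
qed

text \<open>
  Steutel's identity says that \<open>x p x\<close> is the density of the convolution of \<open>\<sigma>\<close> with \<open>\<mu>\<close>.
\<close>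

lemma sigma_conv_mu: "sigma_conv \<mu> c x = (\<integral>\<^sup>+z\<in>{x<..x + c}. ennreal (z * p z) \<partial>lborel)"
proof -
  interpret sigma: sigma_finite_measure \<sigma> by (rule sigma_finite_sigma)
  interpret pair_sigma_finite lborel \<sigma> ..
  let ?W = "\<lambda>z. if x < z \<and> z \<le> x + c then 1 else 0 :: ennreal"
  have [measurable]: "(\<lambda>u. emeasure \<sigma> {x - u<..x - u + c}) \<in> borel_measurable borel"
    by (rule measurable_compose[OF _ sigma_window_measurable]) measurable
  have W: "emeasure \<sigma> {x - u<..x - u + c} = (\<integral>\<^sup>+y. ?W (u + y) \<partial>\<sigma>)" for u
  proof -
    have "(\<integral>\<^sup>+y. ?W (u + y) \<partial>\<sigma>) = (\<integral>\<^sup>+y. indicator {x - u<..x - u + c} y \<partial>\<sigma>)"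
      by (intro nn_integral_cong) (auto simp: indicator_def)
    then show ?thesis by simp
  qed
  have "sigma_conv \<mu> c x = (\<integral>\<^sup>+u. ennreal (p u) * emeasure \<sigma> {x - u<..x - u + c} \<partial>lborel)"
    unfolding sigma_conv_def by (rule nn_integral_mu) measurable
  also have "\<dots> = (\<integral>\<^sup>+u. (\<integral>\<^sup>+y. ennreal (p u) * ?W (u + y) \<partial>\<sigma>) \<partial>lborel)"
    unfolding W by (intro nn_integral_cong nn_integral_cmult[symmetric]) measurable
  also have "\<dots> = (\<integral>\<^sup>+y. (\<integral>\<^sup>+u. ennreal (p u) * ?W (u + y) \<partial>lborel) \<partial>\<sigma>)"
    by (rule Fubini'[symmetric]) measurable
  also have "\<dots> = (\<integral>\<^sup>+y. (\<integral>\<^sup>+z. ennreal (p (z - y)) * ?W z \<partial>lborel) \<partial>\<sigma>)"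
  proof (rule nn_integral_cong)
    fix y
    show "(\<integral>\<^sup>+u. ennreal (p u) * ?W (u + y) \<partial>lborel) = (\<integral>\<^sup>+z. ennreal (p (z - y)) * ?W z \<partial>lborel)"
      by (subst nn_integral_real_affine[where c=1 and t="- y"]) (auto simp: add.commute)
  qed
  also have "\<dots> = (\<integral>\<^sup>+z. (\<integral>\<^sup>+y. ennreal (p (z - y)) * ?W z \<partial>\<sigma>) \<partial>lborel)"
    by (rule Fubini') measurable
  also have "\<dots> = (\<integral>\<^sup>+z. (\<integral>\<^sup>+y. ennreal (p (z - y)) \<partial>\<sigma>) * ?W z \<partial>lborel)"
    by (intro nn_integral_cong nn_integral_multc) measurable
  also have "\<dots> = (\<integral>\<^sup>+z\<in>{x<..x + c}. ennreal (z * p z) \<partial>lborel)"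
    unfolding steutel_sigma[symmetric] by (intro nn_integral_cong) (auto simp: indicator_def)
  finally show ?thesis .
qed

lemma xp_long_tailed:
  assumes p: "p \<in> long_tailed" shows "(\<lambda>x. x * p x) \<in> long_tailed"
proof -
  have "(\<lambda>x. (x + t) * p (x + t)) \<simeq> (\<lambda>x. x * p x)" for t
  proof -
    have "((\<lambda>x::real. 1 + t / x) \<longlongrightarrow> 1 + 0) at_top"
      by (intro tendsto_add tendsto_const tendsto_divide_0[OF tendsto_const]) (simp add: filterlim_at_top_imp_at_infinity filterlim_ident)
    moreover have "\<forall>\<^sub>F x::real in at_top. 1 + t / x = (x + t) / x"
      using eventually_gt_at_top[of 0] by eventually_elim (simp add: field_simps)
    ultimately have "((\<lambda>x::real. (x + t) / x) \<longlongrightarrow> 1) at_top"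
      using tendsto_cong by force
    then have eq: "(\<lambda>x::real. x + t) \<sim>[at_top] (\<lambda>x. x)" by (rule asymp_equivI')
    have p_eq: "\<forall>\<^sub>F x in at_top. 0 < p (x + t)" "\<forall>\<^sub>F x in at_top. 0 < p x" "(\<lambda>x. p (x + t)) \<sim>[at_top] p"
      using long_tailedD(3)[OF p, of t] unfolding asymp_pos_def by blast+
    show ?thesis
      unfolding asymp_pos_def
    proof (intro conjI)
      show "\<forall>\<^sub>F x in at_top. 0 < (x + t) * p (x + t)"
        using p_eq(1) eventually_gt_at_top[of "- t"] by eventually_elim simp
      show "\<forall>\<^sub>F x in at_top. 0 < x * p x"
        using p_eq(2) eventually_gt_at_top[of 0] by eventually_elim simp
      show "(\<lambda>x. (x + t) * p (x + t)) \<sim>[at_top] (\<lambda>x. x * p x)"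
        by (rule asymp_equiv_mult[OF eq p_eq(3)])
    qed
  qed
  moreover have "0 \<le> x * p x" for x using p_nonneg[of x] p_nonpos[of x] by (cases "x \<le> 0") auto
  ultimately show ?thesis by (simp add: long_tailed_def)
qed

lemma long_tailed_window_average:
  assumes h: "h \<in> long_tailed" and "0 < c" "0 < e"
  shows "\<forall>\<^sub>F x in at_top. ennreal ((1 - e) * c * h x) \<le> (\<integral>\<^sup>+z\<in>{x<..x + c}. ennreal (h z) \<partial>lborel) \<and>
    (\<integral>\<^sup>+z\<in>{x<..x + c}. ennreal (h z) \<partial>lborel) \<le> ennreal ((1 + e) * c * h x)"
proof -
  have "(\<integral>\<^sup>+z\<in>{x<..x + c}. ennreal (h z) \<partial>lborel) = (\<integral>\<^sup>+z\<in>{x..<x + c}. ennreal (h z) \<partial>lborel)" for x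
  proof (rule nn_integral_cong_AE)
    have "AE z in lborel. z \<noteq> x" "AE z in lborel. z \<noteq> x + c" by (rule AE_lborel_singleton)+
    then show "AE z in lborel. ennreal (h z) * indicator {x<..x + c} z = ennreal (h z) * indicator {x..<x + c} z"
      by eventually_elim (auto simp: indicator_def)
  qed
  then show ?thesis using long_tailed_average[OF assms] by simp
qed

lemma sigma_conv_mu_asymp:
  assumes p: "p \<in> long_tailed" and "0 < c" "0 < e"
  shows "\<forall>\<^sub>F x in at_top. ennreal ((1 - e) * c * (x * p x)) \<le> sigma_conv \<mu> c x \<and>
    sigma_conv \<mu> c x \<le> ennreal ((1 + e) * c * (x * p x))"
  unfolding sigma_conv_mu by (rule long_tailed_window_average[OF xp_long_tailed[OF p] assms(2,3)])

lemma half_line_median: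
  assumes "half_line_distribution \<tau>"
  shows "\<exists>L>0. ennreal (1 / 2) \<le> emeasure \<tau> {0..L}"
proof -
  have "\<forall>\<^sub>F L in at_top. ennreal (1 - 1 / 2) \<le> emeasure \<tau> {0..L}"
    by (rule distribution_mass) (use half_line_distributionD[OF assms] in auto)
  then have "\<forall>\<^sub>F L in at_top. ennreal (1 / 2) \<le> emeasure \<tau> {0..L} \<and> 0 < L"
    using eventually_gt_at_top[of 0] by eventually_elim simp
  from eventually_happens[OF this] show ?thesis by auto
qed

text \<open>
  The second factor is with probability at least one half in a bounded interval, so a window of the
  first convolution is at most twice a longer window of the full one.
\<close>

lemma sigma_conv_factor_bound:
  assumes p: "p \<in> long_tailed" and \<kappa>: "half_line_distribution \<kappa>" and \<tau>: "half_line_distribution \<tau>"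
    and \<mu>: "\<mu> = (\<kappa> \<star> \<tau>)" and "0 < c"
  shows "\<exists>K>0. \<forall>\<^sub>F x in at_top. sigma_conv \<kappa> c x \<le> ennreal (K * (x * p x))"
proof -
  obtain L where L: "0 < L" "ennreal (1 / 2) \<le> emeasure \<tau> {0..L}" using half_line_median[OF \<tau>] by blast
  note D = half_line_distributionD[OF \<kappa>] half_line_distributionD[OF \<tau>]
  have [measurable_cong]: "sets \<kappa> = sets borel" "sets \<tau> = sets borel" by (rule D)+
  have "0 < c + L" using L \<open>0 < c\<close> by simp
  have "\<forall>\<^sub>F x in at_top. sigma_conv \<kappa> c x \<le> ennreal (4 * (c + L) * (x * p x))"
    using sigma_conv_mu_asymp[OF p \<open>0 < c + L\<close> zero_less_one] eventually_gt_at_top[of 0]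
  proof eventually_elim
    case (elim x)
    have "ennreal (1 / 2) * sigma_conv \<kappa> c x \<le> emeasure \<tau> {0..L} * sigma_conv \<kappa> c x"
      by (rule mult_right_mono[OF L(2)]) simp
    also have "\<dots> = (\<integral>\<^sup>+u. sigma_conv \<kappa> c x * indicator {0..L} u \<partial>\<tau>)"
      by (subst nn_integral_cmult_indicator) (auto simp: mult.commute D)
    also have "\<dots> \<le> (\<integral>\<^sup>+u. sigma_conv \<kappa> (c + L) (x - u) \<partial>\<tau>)"
    proof (rule nn_integral_mono)
      fix u
      show "sigma_conv \<kappa> c x * indicator {0..L} u \<le> sigma_conv \<kappa> (c + L) (x - u)"
      proof (cases "u \<in> {0..L}")
        case True
        have "sigma_conv \<kappa> c x \<le> sigma_conv \<kappa> (c + L) (x - u)"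
          unfolding sigma_conv_def by (intro nn_integral_mono emeasure_mono) (use True in auto)
        then show ?thesis using True by simp
      qed simp
    qed
    also have "\<dots> = sigma_conv \<mu> (c + L) x" unfolding \<mu> by (rule sigma_conv_convolution[OF \<kappa> \<tau>, symmetric])
    also have "\<dots> \<le> ennreal ((1 + 1) * (c + L) * (x * p x))" using elim by blast
    also have "\<dots> = ennreal (1 / 2 * (4 * (c + L) * (x * p x)))" by (simp add: algebra_simps)
    finally show ?case by (rule ennreal_mult_le_cancelD) simp
  qed
  then show ?thesis using \<open>0 < c + L\<close> by (intro exI[of _ "4 * (c + L)"]) auto
qed

lemma factor_window_bound:
  assumes p: "p \<in> long_tailed" and \<pi>: "half_line_distribution \<pi>" and \<tau>: "half_line_distribution \<tau>"
    and \<mu>: "\<mu> = (\<pi> \<star> \<tau>)" and "0 < l"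
  shows "\<exists>K>0. \<forall>\<^sub>F x in at_top. emeasure \<pi> {x<..x + l} \<le> ennreal (K * p x)"
proof -
  obtain L where L: "0 < L" "ennreal (1 / 2) \<le> emeasure \<tau> {0..L}" using half_line_median[OF \<tau>] by blast
  note D = half_line_distributionD[OF \<pi>] half_line_distributionD[OF \<tau>]
  have [measurable_cong]: "sets \<pi> = sets borel" "sets \<tau> = sets borel" by (rule D)+
  have "0 < l + L" using L \<open>0 < l\<close> by simp
  have comm: "(\<pi> \<star> \<tau>) = (\<tau> \<star> \<pi>)" by (rule convolution_commutative) (auto simp: D)
  have "\<forall>\<^sub>F x in at_top. emeasure \<pi> {x<..x + l} \<le> ennreal (4 * (l + L) * p x)"
    using long_tailed_window_average[OF p \<open>0 < l + L\<close> zero_less_one]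
  proof eventually_elim
    case (elim x)
    have "ennreal (1 / 2) * emeasure \<pi> {x<..x + l} \<le> emeasure \<tau> {0..L} * emeasure \<pi> {x<..x + l}"
      by (rule mult_right_mono[OF L(2)]) simp
    also have "\<dots> = (\<integral>\<^sup>+u. emeasure \<pi> {x<..x + l} * indicator {0..L} u \<partial>\<tau>)"
      by (subst nn_integral_cmult_indicator) (auto simp: mult.commute D)
    also have "\<dots> \<le> (\<integral>\<^sup>+u. emeasure \<pi> {v. v + u \<in> {x<..x + (l + L)}} \<partial>\<tau>)"
    proof (rule nn_integral_mono)
      fix u
      show "emeasure \<pi> {x<..x + l} * indicator {0..L} u \<le> emeasure \<pi> {v. v + u \<in> {x<..x + (l + L)}}"
      proof (cases "u \<in> {0..L}")
        case True
        have "{v. v + u \<in> {x<..x + (l + L)}} = {x - u<..x - u + (l + L)}" by auto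
        moreover have "emeasure \<pi> {x<..x + l} \<le> emeasure \<pi> {x - u<..x - u + (l + L)}"
          by (intro emeasure_mono) (use True in \<open>auto simp: D\<close>)
        ultimately show ?thesis using True by simp
      qed simp
    qed
    also have "\<dots> = emeasure (\<tau> \<star> \<pi>) {x<..x + (l + L)}"
      by (rule convolution_emeasure[symmetric]) (auto simp: D)
    also have "\<dots> = emeasure \<mu> {x<..x + (l + L)}" unfolding \<mu> comm ..
    also have "\<dots> = (\<integral>\<^sup>+z\<in>{x<..x + (l + L)}. ennreal (p z) \<partial>lborel)"
      unfolding \<mu>_def by (rule emeasure_density) auto
    also have "\<dots> \<le> ennreal ((1 + 1) * (l + L) * p x)" using elim by blast
    also have "\<dots> = ennreal (1 / 2 * (4 * (l + L) * p x))" by (simp add: algebra_simps)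
    finally show ?case by (rule ennreal_mult_le_cancelD) simp
  qed
  then show ?thesis using \<open>0 < l + L\<close> by (intro exI[of _ "4 * (l + L)"]) auto
qed

text \<open>
  For a jump \<open>u\<close> between \<open>A\<close> and \<open>x - A\<close> the window is at most a multiple of \<open>x p (x - u)\<close>, and subexponentiality
  applies. For \<open>u\<close> beyond \<open>x - A\<close> the window of \<open>\<sigma>\<close> near zero is bounded while \<open>\<pi>\<close> has mass of order \<open>p x\<close> there;
  the missing factor \<open>x\<close> makes this contribution negligible.
\<close>

lemma sigma_conv_tail_negligible:
  assumes S: "p \<in> subexp_densities" and \<kappa>: "half_line_distribution \<kappa>" and \<pi>: "half_line_distribution \<pi>" and "0 < c"
    and K: "0 < K" "\<forall>\<^sub>F x in at_top. sigma_conv \<kappa> c x \<le> ennreal (K * (x * p x))"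
    and win: "\<And>l. 0 < l \<Longrightarrow> \<exists>k>0. \<forall>\<^sub>F x in at_top. emeasure \<pi> {x<..x + l} \<le> ennreal (k * p x)"
    and "0 < e"
  shows "\<exists>A0. \<forall>A\<ge>A0. \<forall>\<^sub>F x in at_top. (\<integral>\<^sup>+u\<in>{A<..}. sigma_conv \<kappa> c (x - u) \<partial>\<pi>) \<le> ennreal (e * (x * p x))"
proof -
  have pl: "p \<in> long_tailed" and pp: "density_conv p p \<simeq> (\<lambda>x. 2 * p x)"
    using S by (auto simp: subexp_densities_def long_tailed_densities_def)
  note D = half_line_distributionD[OF \<pi>]
  have [measurable_cong]: "sets \<pi> = sets borel" by (rule D)
  have [measurable]: "(\<lambda>u. sigma_conv \<kappa> c (x - u)) \<in> borel_measurable borel" for x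
    by (rule measurable_compose[OF _ sigma_conv_measurable[OF \<kappa>]]) measurable
  obtain B where B: "\<And>x. B \<le> x \<Longrightarrow> sigma_conv \<kappa> c x \<le> ennreal (K * (x * p x))"
    using K(2) unfolding eventually_at_top_linorder by blast
  obtain k where k: "0 < k" "\<forall>\<^sub>F x in at_top. emeasure \<pi> {x<..x + 1} \<le> ennreal (k * p x)"
    using win[of 1] by auto
  obtain b where b: "\<And>x. b \<le> x \<Longrightarrow> emeasure \<pi> {x<..x + 1} \<le> ennreal (k * p x)"
    using k(2) unfolding eventually_at_top_linorder by blast
  define d where "d = e / (4 * K * k)"
  have d: "0 < d" using \<open>0 < e\<close> K(1) k(1) by (simp add: d_def)
  obtain A1 where A1: "\<And>A x. A1 \<le> A \<Longrightarrow> middle_part p \<pi> A x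
      \<le> ennreal ((1 + 1) * k) * (\<integral>\<^sup>+z\<in>{A - 1<..<x - A}. ennreal (p (x - z)) * ennreal (p z) \<partial>lborel)"
    using middle_part_upper[OF D(4,5) pl p_borel less_imp_le[OF k(1)] zero_less_one b] by blast
  obtain A2 where A2: "\<And>A. A2 \<le> A \<Longrightarrow> \<forall>\<^sub>F x in at_top. middle_part p \<mu> A x \<le> ennreal (d * p x)"
    using density_middle_small[OF pl pp d] by blast
  show ?thesis
  proof (intro exI[of _ "max (max A1 (A2 + 1)) (max B 1)"] allI impI)
    fix A assume "max (max A1 (A2 + 1)) (max B 1) \<le> A"
    then have A: "A1 \<le> A" "A2 \<le> A - 1" "B \<le> A" "1 \<le> A" by auto
    define t where "t = enn2real (emeasure \<sigma> {..A + c})"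
    have t: "emeasure \<sigma> {..A + c} = ennreal t" "0 \<le> t"
      using sigma_finite_below[of "A + c"] by (auto simp: t_def less_top[symmetric])
    have "0 < A + 1 + c" using A(4) \<open>0 < c\<close> by simp
    (* The interval (x - A - 1, x + c] contains all u >= x - A for which the window of sigma meets the half line. *)
    then obtain k' where k': "0 < k'" "\<forall>\<^sub>F x in at_top. emeasure \<pi> {x<..x + (A + 1 + c)} \<le> ennreal (k' * p x)"
      using win[of "A + 1 + c"] by blast
    have shift: "filterlim (\<lambda>x::real. x - (A + 1)) at_top at_top"
    proof -
      have "(\<lambda>x::real. x - (A + 1)) = (\<lambda>x. - (A + 1) + x)" by auto
      then show ?thesis
        by (simp only:) (rule filterlim_tendsto_add_at_top[OF tendsto_const filterlim_ident])
    qed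
    show "\<forall>\<^sub>F x in at_top. (\<integral>\<^sup>+u\<in>{A<..}. sigma_conv \<kappa> c (x - u) \<partial>\<pi>) \<le> ennreal (e * (x * p x))"
      using A2[OF A(2)] eventually_compose_filterlim[OF k'(2) shift] long_tailed_uniform[OF pl zero_less_one, of "A + 1"]
        eventually_gt_at_top[of "2 * A"] eventually_ge_at_top[of "4 * t * k' / e"]
    proof eventually_elim
      case (elim x)
      have x: "0 < x" "2 * A < x" "0 < A" using elim(4) A(4) by auto
      have px: "0 < p x" using elim(3) by blast
      have "(\<integral>\<^sup>+u\<in>{A<..<x - A}. sigma_conv \<kappa> c (x - u) \<partial>\<pi>)
          \<le> (\<integral>\<^sup>+u. ennreal (K * x) * (ennreal (p (x - u)) * indicator {A<..<x - A} u) \<partial>\<pi>)"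
      proof (rule nn_integral_mono)
        fix u
        show "sigma_conv \<kappa> c (x - u) * indicator {A<..<x - A} u \<le> ennreal (K * x) * (ennreal (p (x - u)) * indicator {A<..<x - A} u)"
        proof (cases "u \<in> {A<..<x - A}")
          case True
          have "sigma_conv \<kappa> c (x - u) \<le> ennreal (K * ((x - u) * p (x - u)))" using True A(3) by (intro B) auto
          also have "\<dots> \<le> ennreal (K * (x * p (x - u)))"
            using True x K(1) p_nonneg by (intro ennreal_leI mult_left_mono mult_right_mono) auto
          also have "\<dots> = ennreal (K * x) * ennreal (p (x - u))"
            using K(1) x p_nonneg by (subst ennreal_mult[symmetric]) (auto simp: mult.assoc)
          finally show ?thesis using True by simp
        qed simp
      qed
      also have "\<dots> = ennreal (K * x) * middle_part p \<pi> A x"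
        by (rule nn_integral_cmult) measurable
      also have "middle_part p \<pi> A x
          \<le> ennreal ((1 + 1) * k) * (\<integral>\<^sup>+z\<in>{A - 1<..<x - A}. ennreal (p (x - z)) * ennreal (p z) \<partial>lborel)"
        by (rule A1[OF A(1)])
      also have "(\<integral>\<^sup>+z\<in>{A - 1<..<x - A}. ennreal (p (x - z)) * ennreal (p z) \<partial>lborel)
          \<le> (\<integral>\<^sup>+z. ennreal (p z) * (ennreal (p (x - z)) * indicator {A - 1<..<x - (A - 1)} z) \<partial>lborel)"
        by (rule nn_integral_mono) (auto simp: indicator_def mult.commute)
      also have "\<dots> = middle_part p \<mu> (A - 1) x"
        by (rule nn_integral_mu[symmetric]) measurable
      also have "\<dots> \<le> ennreal (d * p x)" by (rule elim(1))
      finally have "(\<integral>\<^sup>+u\<in>{A<..<x - A}. sigma_conv \<kappa> c (x - u) \<partial>\<pi>)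
          \<le> ennreal (K * x) * (ennreal ((1 + 1) * k) * ennreal (d * p x))"
        by (simp add: mult_left_mono)
      also have "\<dots> = ennreal (K * x * ((1 + 1) * k * (d * p x)))"
        using K(1) k(1) x d px by (simp add: ennreal_mult)
      also have "K * x * ((1 + 1) * k * (d * p x)) = e / 2 * (x * p x)"
        using K(1) k(1) by (simp add: d_def)
      finally have 1: "(\<integral>\<^sup>+u\<in>{A<..<x - A}. sigma_conv \<kappa> c (x - u) \<partial>\<pi>) \<le> ennreal (e / 2 * (x * p x))" .
      have "(\<integral>\<^sup>+u\<in>{x - A..}. sigma_conv \<kappa> c (x - u) \<partial>\<pi>)
          \<le> (\<integral>\<^sup>+u. ennreal t * indicator {x - (A + 1)<..x - (A + 1) + (A + 1 + c)} u \<partial>\<pi>)"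
      proof (rule nn_integral_mono)
        fix u
        show "sigma_conv \<kappa> c (x - u) * indicator {x - A..} u \<le> ennreal t * indicator {x - (A + 1)<..x - (A + 1) + (A + 1 + c)} u"
        proof (cases "x - A \<le> u \<and> u \<le> x + c")
          case True
          then have "sigma_conv \<kappa> c (x - u) \<le> ennreal t"
            using sigma_conv_bounded[OF \<kappa>, of "x - u" A c] t(1) by simp
          then show ?thesis using True by (auto simp: indicator_def)
        next
          case False
          then show ?thesis using sigma_conv_zero[OF \<kappa>, of "x - u" c] by (auto simp: indicator_def)
        qed
      qed
      also have "\<dots> = ennreal t * emeasure \<pi> {x - (A + 1)<..x - (A + 1) + (A + 1 + c)}"
        by (rule nn_integral_cmult_indicator) measurable
      also have "\<dots> \<le> ennreal t * ennreal (k' * p (x - (A + 1)))" by (rule mult_left_mono[OF elim(2)]) simp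
      also have "\<dots> = ennreal (t * (k' * p (x - (A + 1))))"
        using t k'(1) p_nonneg by (intro ennreal_mult[symmetric]) auto
      also have "\<dots> \<le> ennreal (e / 2 * (x * p x))"
      proof (rule ennreal_leI)
        have "\<bar>- (A + 1)\<bar> \<le> A + 1" using x by simp
        then have "\<bar>p (x + - (A + 1)) - p x\<bar> \<le> 1 * p x" using elim(3) by blast
        then have "p (x - (A + 1)) \<le> 2 * p x" by (simp only: abs_le_iff diff_conv_add_uminus) linarith
        then have "t * (k' * p (x - (A + 1))) \<le> t * (k' * (2 * p x))"
          using t k'(1) by (intro mult_left_mono) auto
        also have "\<dots> = (2 * t * k') * p x" by simp
        also have "\<dots> \<le> (e / 2 * x) * p x"
          using elim(5) \<open>0 < e\<close> px by (intro mult_right_mono) (auto simp: field_simps)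
        finally show "t * (k' * p (x - (A + 1))) \<le> e / 2 * (x * p x)" by simp
      qed
      finally have 2: "(\<integral>\<^sup>+u\<in>{x - A..}. sigma_conv \<kappa> c (x - u) \<partial>\<pi>) \<le> ennreal (e / 2 * (x * p x))" .
      have "(\<integral>\<^sup>+u\<in>{A<..}. sigma_conv \<kappa> c (x - u) \<partial>\<pi>)
          = (\<integral>\<^sup>+u. sigma_conv \<kappa> c (x - u) * indicator {A<..<x - A} u + sigma_conv \<kappa> c (x - u) * indicator {x - A..} u \<partial>\<pi>)"
        by (intro nn_integral_cong) (use x in \<open>auto simp: indicator_def\<close>)
      also have "\<dots> = (\<integral>\<^sup>+u\<in>{A<..<x - A}. sigma_conv \<kappa> c (x - u) \<partial>\<pi>) + (\<integral>\<^sup>+u\<in>{x - A..}. sigma_conv \<kappa> c (x - u) \<partial>\<pi>)"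
        by (rule nn_integral_add) measurable
      also have "\<dots> \<le> ennreal (e / 2 * (x * p x)) + ennreal (e / 2 * (x * p x))" by (rule add_mono[OF 1 2])
      also have "\<dots> = ennreal (e * (x * p x))"
        using \<open>0 < e\<close> x px by (subst ennreal_plus[symmetric]) (auto simp: field_simps)
      finally show ?case .
    qed
  qed
qed

end

section \<open>Deconvolution\<close>

text \<open>
  Isolate the atom of \<open>\<pi>\<close> at zero in \<open>\<integral> (T (x - u) - c q x) \<pi>(du)\<close>: the whole integral is \<open>o(q x)\<close>, jumps in \<open>(0, A]\<close> contribute
  at most their mass times the current error \<open>D\<close>, and larger jumps are negligible.
\<close>

lemma deconvolution_step:
  fixes T q :: "real \<Rightarrow> real"
  assumes q: "q \<in> long_tailed" and \<pi>: "half_line_distribution \<pi>"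
    and T [measurable]: "T \<in> borel_measurable borel" and T0: "\<And>x. 0 \<le> T x" and T_bdd: "\<And>R. \<exists>b. \<forall>x\<le>R. T x \<le> b"
    and conv: "\<And>e. 0 < e \<Longrightarrow> \<forall>\<^sub>F x in at_top. \<bar>(LINT u|\<pi>. T (x - u)) - c * q x\<bar> \<le> e * q x"
    and tail: "\<And>e. 0 < e \<Longrightarrow> \<exists>A0. \<forall>A\<ge>A0. \<forall>\<^sub>F x in at_top. (LINT u|\<pi>. T (x - u) * indicator {A<..} u) \<le> e * q x"
    and "0 < c" "0 \<le> D" "0 < e" and bound: "\<forall>\<^sub>F x in at_top. \<bar>T x - c * q x\<bar> \<le> D * q x"
  shows "\<forall>\<^sub>F x in at_top. measure \<pi> {0} * \<bar>T x - c * q x\<bar> \<le> ((1 - measure \<pi> {0}) * D + e) * q x"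
proof -
  note P = half_line_distributionD[OF \<pi>]
  interpret real_distribution \<pi> by (rule P)
  define \<pi>0 where "\<pi>0 = measure \<pi> {0}"
  (* The errors collected below add up to d (D + 2 c + 2). *)
  define d where "d = min 1 (e / (D + 2 * c + 2))"
  have pos: "0 < D + 2 * c + 2" using assms by simp
  have d: "0 < d" "d * (D + 2 * c + 2) \<le> e"
  proof -
    show "0 < d" using pos \<open>0 < e\<close> by (simp add: d_def)
    have "d \<le> e / (D + 2 * c + 2)" by (simp add: d_def)
    then show "d * (D + 2 * c + 2) \<le> e" using pos by (simp add: field_simps)
  qed
  obtain A1 where A1: "\<And>A. A1 \<le> A \<Longrightarrow> \<forall>\<^sub>F x in at_top. (LINT u|\<pi>. T (x - u) * indicator {A<..} u) \<le> d * q x"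
    using tail[OF d(1)] by blast
  obtain A2 where A2: "\<And>A. A2 \<le> A \<Longrightarrow> ennreal (1 - d) \<le> emeasure \<pi> {0..A}"
    using distribution_mass[OF P(1,7) d(1)] by (auto simp: eventually_at_top_linorder)
  define A where "A = max 1 (max A1 A2)"
  have A: "0 < A" "A1 \<le> A" "A2 \<le> A" by (auto simp: A_def)
  have far: "measure \<pi> {A<..} \<le> d"
  proof -
    have "1 - d \<le> measure \<pi> {0..A}" using A2[OF A(3)] by (simp add: emeasure_eq_measure)
    moreover have "measure \<pi> {0..A} + measure \<pi> {A<..} = measure \<pi> ({0..A} \<union> {A<..})"
      by (rule finite_measure_Union[symmetric]) auto
    moreover have "\<dots> \<le> 1" by simp
    ultimately show ?thesis by linarith
  qed
  have near: "measure \<pi> {0<..A} \<le> 1 - \<pi>0"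
  proof -
    have "\<pi>0 + measure \<pi> {0<..A} = measure \<pi> ({0} \<union> {0<..A})"
      unfolding \<pi>0_def by (rule finite_measure_Union[symmetric]) auto
    moreover have "\<dots> \<le> 1" by simp
    ultimately show ?thesis by linarith
  qed
  obtain B where B: "\<And>x. B \<le> x \<Longrightarrow> \<bar>T x - c * q x\<bar> \<le> D * q x"
    using bound unfolding eventually_at_top_linorder by blast
  show ?thesis
    unfolding \<pi>0_def[symmetric]
    using conv[OF d(1)] A1[OF A(2)] long_tailed_uniform[OF q d(1), of A] eventually_ge_at_top[of "B + A"]
  proof eventually_elim
    case (elim x)
    have qx: "0 < q x" using elim(3) by blast
    obtain b where b: "\<And>s. s \<le> x \<Longrightarrow> T s \<le> b" using T_bdd[of x] by blast
    define f where "f u = T (x - u) - c * q x" for u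
    have int_T: "integrable \<pi> (\<lambda>u. T (x - u))"
      by (rule integrable_const_bound[of _ b], use P(7) in eventually_elim) (use b T0 in auto)
    have int_TI: "integrable \<pi> (\<lambda>u. T (x - u) * indicator B u)" if "B \<in> sets borel" for B
      by (rule Bochner_Integration.integrable_bound[OF int_T]) (use that T0 in \<open>auto simp: indicator_def\<close>)
    have int_f: "integrable \<pi> (\<lambda>u. f u * indicator B u)" if [measurable]: "B \<in> sets borel" for B
    proof -
      have "integrable \<pi> (\<lambda>u. T (x - u) * indicator B u - c * q x * indicator B u)"
        by (intro Bochner_Integration.integrable_diff int_TI that)
          (auto intro!: integrable_mult_right integrable_real_indicator simp: emeasure_eq_measure)
      then show ?thesis by (simp add: f_def left_diff_distrib)
    qed
    have "(LINT u|\<pi>. f u) = (LINT u|\<pi>. T (x - u)) - c * q x"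
      unfolding f_def using int_T by (simp add: prob_space[simplified])
    moreover have "(LINT u|\<pi>. f u) = (LINT u|\<pi>. f u * indicator {0} u + (f u * indicator {0<..A} u + f u * indicator {A<..} u))"
    proof (rule integral_cong_AE)
      show "AE u in \<pi>. f u = f u * indicator {0} u + (f u * indicator {0<..A} u + f u * indicator {A<..} u)"
        using P(7)
      proof eventually_elim
        case (elim u)
        consider "u = 0" | "0 < u" "u \<le> A" | "A < u" using elim by linarith
        then show ?case using A(1) by cases (auto simp: indicator_def)
      qed
    qed (auto simp: f_def)
    moreover have "\<dots> = (LINT u|\<pi>. f u * indicator {0} u) + ((LINT u|\<pi>. f u * indicator {0<..A} u) + (LINT u|\<pi>. f u * indicator {A<..} u))"
      by (subst Bochner_Integration.integral_add, rule int_f, simp, rule Bochner_Integration.integrable_add; (intro int_f)?)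
        (auto intro!: Bochner_Integration.integral_add int_f)
    moreover have "(LINT u|\<pi>. f u * indicator {0} u) = \<pi>0 * (T x - c * q x)"
    proof -
      have "(LINT u|\<pi>. f u * indicator {0} u) = (LINT u|\<pi>. (T x - c * q x) * indicator {0} u)"
        by (intro Bochner_Integration.integral_cong) (auto simp: f_def indicator_def)
      then show ?thesis by (simp add: \<pi>0_def mult.commute)
    qed
    ultimately have eq: "\<pi>0 * (T x - c * q x) = ((LINT u|\<pi>. T (x - u)) - c * q x)
        - (LINT u|\<pi>. f u * indicator {0<..A} u) - (LINT u|\<pi>. f u * indicator {A<..} u)" by linarith
    have Q: "0 \<le> (D + d * (D + c)) * q x" using d assms qx by (intro mult_nonneg_nonneg) auto
    have "\<bar>LINT u|\<pi>. f u * indicator {0<..A} u\<bar> \<le> (LINT u|\<pi>. (D + d * (D + c)) * q x * indicator {0<..A} u)"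
    proof (rule integral_abs_bound_integral)
      fix u
      have "\<bar>f u\<bar> \<le> (D + d * (D + c)) * q x" if "u \<in> {0<..A}"
      proof -
        have 1: "\<bar>T (x - u) - c * q (x - u)\<bar> \<le> D * q (x - u)" using B elim(4) that by auto
        have 2: "\<bar>q (x - u) - q x\<bar> \<le> d * q x" using elim(3)[THEN conjunct2, rule_format, of "- u"] that by simp
        have "c * \<bar>q (x - u) - q x\<bar> \<le> c * (d * q x)" using 2 \<open>0 < c\<close> by (intro mult_left_mono) auto
        then have 3: "\<bar>c * q (x - u) - c * q x\<bar> \<le> c * (d * q x)"
          using \<open>0 < c\<close> by (simp add: right_diff_distrib[symmetric] abs_mult)
        have "D * q (x - u) \<le> D * ((1 + d) * q x)"
          using 2 \<open>0 \<le> D\<close> by (intro mult_left_mono) (auto simp: abs_le_iff algebra_simps)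
        then have "\<bar>T (x - u) - c * q x\<bar> \<le> D * ((1 + d) * q x) + c * (d * q x)" using 1 3 by linarith
        then show ?thesis by (simp add: f_def algebra_simps)
      qed
      then show "\<bar>f u * indicator {0<..A} u\<bar> \<le> (D + d * (D + c)) * q x * indicator {0<..A} u"
        by (simp add: indicator_def)
    qed (auto intro!: int_f integrable_mult_right integrable_real_indicator simp: emeasure_eq_measure)
    also have "\<dots> = (D + d * (D + c)) * q x * measure \<pi> {0<..A}" by simp
    also have "\<dots> \<le> (D + d * (D + c)) * q x * (1 - \<pi>0)" by (rule mult_left_mono[OF near Q])
    finally have n: "\<bar>LINT u|\<pi>. f u * indicator {0<..A} u\<bar> \<le> (D + d * (D + c)) * q x * (1 - \<pi>0)" .
    have "(LINT u|\<pi>. f u * indicator {A<..} u) = (LINT u|\<pi>. T (x - u) * indicator {A<..} u) - c * q x * measure \<pi> {A<..}"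
      unfolding f_def left_diff_distrib
      by (subst Bochner_Integration.integral_diff)
        (auto intro!: int_TI integrable_mult_right integrable_real_indicator simp: emeasure_eq_measure)
    moreover have "0 \<le> (LINT u|\<pi>. T (x - u) * indicator {A<..} u)"
      using T0 by (intro Bochner_Integration.integral_nonneg) auto
    moreover have "c * q x * measure \<pi> {A<..} \<le> c * q x * d" using far qx \<open>0 < c\<close> by (intro mult_left_mono) auto
    moreover have "0 \<le> c * q x * measure \<pi> {A<..}" using qx \<open>0 < c\<close> by simp
    moreover have "0 \<le> c * q x * d" using qx \<open>0 < c\<close> d by simp
    moreover have "0 \<le> d * q x" using qx d by simp
    ultimately have t: "\<bar>LINT u|\<pi>. f u * indicator {A<..} u\<bar> \<le> d * q x + c * q x * d" using elim(2) by linarith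
    have "\<pi>0 * \<bar>T x - c * q x\<bar> = \<bar>\<pi>0 * (T x - c * q x)\<bar>" by (simp add: abs_mult \<pi>0_def)
    also have "\<dots> \<le> d * q x + (D + d * (D + c)) * q x * (1 - \<pi>0) + (d * q x + c * q x * d)"
      unfolding eq using elim(1) n t by linarith
    also have "(D + d * (D + c)) * q x * (1 - \<pi>0) \<le> (1 - \<pi>0) * D * q x + d * (D + c) * q x"
    proof -
      have "0 \<le> \<pi>0 * (d * (D + c) * q x)" using d assms qx by (auto simp: \<pi>0_def)
      then show ?thesis by (simp add: algebra_simps)
    qed
    also have "d * q x + ((1 - \<pi>0) * D * q x + d * (D + c) * q x) + (d * q x + c * q x * d)
        = ((1 - \<pi>0) * D + d * (D + 2 * c + 2)) * q x" by (simp add: algebra_simps)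
    also have "\<dots> \<le> ((1 - \<pi>0) * D + e) * q x" using d(2) qx by (intro mult_right_mono) auto
    finally show ?case by simp
  qed
qed

text \<open>
  Since \<open>\<pi>({0}) > 1/2\<close>, the step multiplies the relative error by a factor below one, so its infimum over all
  admissible bounds is zero.
\<close>

lemma deconvolution:
  fixes T q :: "real \<Rightarrow> real"
  assumes q: "q \<in> long_tailed" and \<pi>: "half_line_distribution \<pi>" and half: "1 / 2 < measure \<pi> {0}"
    and T: "T \<in> borel_measurable borel" "\<And>x. 0 \<le> T x" "\<And>R. \<exists>b. \<forall>x\<le>R. T x \<le> b"
    and conv: "\<And>e. 0 < e \<Longrightarrow> \<forall>\<^sub>F x in at_top. \<bar>(LINT u|\<pi>. T (x - u)) - c * q x\<bar> \<le> e * q x"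
    and tail: "\<And>e. 0 < e \<Longrightarrow> \<exists>A0. \<forall>A\<ge>A0. \<forall>\<^sub>F x in at_top. (LINT u|\<pi>. T (x - u) * indicator {A<..} u) \<le> e * q x"
    and "0 < c" and K: "\<forall>\<^sub>F x in at_top. T x \<le> K * q x" and "0 < e"
  shows "\<forall>\<^sub>F x in at_top. \<bar>T x - c * q x\<bar> \<le> e * q x"
proof -
  interpret real_distribution \<pi> by (rule half_line_distributionD[OF \<pi>])
  define r where "r = (1 - measure \<pi> {0}) / measure \<pi> {0}"
  have r: "0 \<le> r" "r < 1" using half by (auto simp: r_def field_simps)
  define S where "S = {D. 0 \<le> D \<and> (\<forall>\<^sub>F x in at_top. \<bar>T x - c * q x\<bar> \<le> D * q x)}"
  have bdd: "bdd_below S" by (auto simp: S_def intro!: bdd_belowI[of _ 0])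
  (* The domination of T is the initial bound for the relative error. *)
  have "\<bar>K\<bar> + c \<in> S"
    unfolding S_def
  proof (intro CollectI conjI)
    show "\<forall>\<^sub>F x in at_top. \<bar>T x - c * q x\<bar> \<le> (\<bar>K\<bar> + c) * q x"
      using K long_tailedD(4)[OF q]
    proof eventually_elim
      case (elim x)
      have "K * q x \<le> \<bar>K\<bar> * q x" "0 \<le> \<bar>K\<bar> * q x" "0 \<le> c * q x" using elim(2) \<open>0 < c\<close> by (auto intro!: mult_right_mono)
      then show ?case using elim(1) T(2)[of x] by (simp add: abs_le_iff distrib_right)
    qed
  qed (use \<open>0 < c\<close> in simp)
  then have ne: "S \<noteq> {}" by blast
  have step: "r * D + \<delta> \<in> S" if "D \<in> S" "0 < \<delta>" for D \<delta>
  proof -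
    have D: "0 \<le> D" "\<forall>\<^sub>F x in at_top. \<bar>T x - c * q x\<bar> \<le> D * q x" using that by (auto simp: S_def)
    have pos: "0 < \<delta> * measure \<pi> {0}" using half that(2) by simp
    have "\<forall>\<^sub>F x in at_top. measure \<pi> {0} * \<bar>T x - c * q x\<bar> \<le> ((1 - measure \<pi> {0}) * D + \<delta> * measure \<pi> {0}) * q x"
      by (rule deconvolution_step[OF q \<pi> T _ _ \<open>0 < c\<close> D(1) pos D(2)]) (erule conv, erule tail)
    then have "\<forall>\<^sub>F x in at_top. \<bar>T x - c * q x\<bar> \<le> (r * D + \<delta>) * q x"
    proof eventually_elim
      case (elim x)
      have "measure \<pi> {0} * r = 1 - measure \<pi> {0}" using half by (simp add: r_def)
      then have "((1 - measure \<pi> {0}) * D + \<delta> * measure \<pi> {0}) * q x = measure \<pi> {0} * ((r * D + \<delta>) * q x)"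
        by (metis (no_types, lifting) distrib_left mult.assoc mult.commute)
      with elim have "measure \<pi> {0} * \<bar>T x - c * q x\<bar> \<le> measure \<pi> {0} * ((r * D + \<delta>) * q x)" by simp
      then show ?case using half by simp
    qed
    then show ?thesis using r D(1) that(2) by (simp add: S_def)
  qed
  have "Inf S \<le> 0"
  proof (rule ccontr)
    assume "\<not> Inf S \<le> 0"
    then have I: "0 < Inf S" by simp
    define \<delta> where "\<delta> = (1 - r) * Inf S / 3"
    have \<delta>: "0 < \<delta>" using r I by (simp add: \<delta>_def)
    obtain D where D: "D \<in> S" "D < Inf S + \<delta>"
      using cInf_lessD[OF ne, of "Inf S + \<delta>"] \<delta> by auto
    have "Inf S \<le> r * D + \<delta>" using step[OF D(1) \<delta>] bdd by (rule cInf_lower)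
    moreover have "r * D \<le> r * (Inf S + \<delta>)" using r D by (intro mult_left_mono) auto
    moreover have "r * \<delta> \<le> 1 * \<delta>" using r \<delta> by (intro mult_right_mono) auto
    moreover have "3 * \<delta> = Inf S - r * Inf S" by (simp add: \<delta>_def left_diff_distrib)
    ultimately show False using \<delta> by (simp add: distrib_left)
  qed
  then have "Inf S < e" using \<open>0 < e\<close> by linarith
  then obtain D where D: "D \<in> S" "D < e" using cInf_lessD[OF ne] by blast
  then have "\<forall>\<^sub>F x in at_top. \<bar>T x - c * q x\<bar> \<le> D * q x" by (auto simp: S_def)
  then show ?thesis
    using long_tailedD(4)[OF q]
  proof eventually_elim
    case (elim x)
    have "D * q x \<le> e * q x" using D(2) elim(2) by (intro mult_right_mono) auto
    then show ?case using elim(1) by linarith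
  qed
qed

lemma conv_power_convolution_assoc:
  assumes "half_line_distribution \<kappa>" "half_line_distribution \<pi>"
  shows "(\<kappa> \<star> conv_power \<pi> (Suc j)) = ((\<kappa> \<star> \<pi>) \<star> conv_power \<pi> j)"
  unfolding conv_power.simps(2)
  by (rule convolution_associative)
    (use half_line_distributionD[OF assms(1)] half_line_distributionD[OF assms(2)]
      half_line_distributionD[OF half_line_distribution_conv_power[OF assms(2)]] in auto)

context steutel_density
begin

text \<open>
  Lebesgue asymptotics at infinity, with intensity \<open>x p x\<close>, of the convolution of \<open>\<sigma>\<close> with \<open>\<kappa>\<close>.
\<close>

definition sigma_asymp :: "real measure \<Rightarrow> bool" where
  "sigma_asymp \<kappa> \<longleftrightarrow> (\<forall>c>0. \<forall>e>0. \<forall>\<^sub>F x in at_top.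
     \<bar>enn2real (sigma_conv \<kappa> c x) - c * (x * p x)\<bar> \<le> e * (x * p x))"

lemma xp_nonneg: "0 \<le> x * p x"
  using p_nonneg[of x] p_nonpos[of x] by (cases "x \<le> 0") auto

lemma sigma_conv_real:
  assumes "half_line_distribution \<kappa>"
  shows "sigma_conv \<kappa> c x = ennreal (enn2real (sigma_conv \<kappa> c x))"
  using sigma_conv_bounded[OF assms order_refl, of c x] sigma_finite_below[of "x + c"]
  by (intro ennreal_enn2real[symmetric]) (auto intro: le_less_trans)

lemma sigma_asymp_mu:
  assumes p: "p \<in> long_tailed" shows "sigma_asymp \<mu>"
  unfolding sigma_asymp_def
proof (intro allI impI)
  fix c e :: real assume "0 < c" "0 < e"
  then have "0 < min 1 (e / c)" by simp
  from sigma_conv_mu_asymp[OF p \<open>0 < c\<close> this]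
  show "\<forall>\<^sub>F x in at_top. \<bar>enn2real (sigma_conv \<mu> c x) - c * (x * p x)\<bar> \<le> e * (x * p x)"
  proof eventually_elim
    case (elim x)
    define d where "d = min 1 (e / c)"
    define w where "w = enn2real (sigma_conv \<mu> c x)"
    have w: "sigma_conv \<mu> c x = ennreal w" "0 \<le> w"
      unfolding w_def by (rule sigma_conv_real[OF mu_half_line]) simp
    have d: "d * c \<le> e" "0 < d"
    proof -
      have "d \<le> e / c" by (simp add: d_def)
      then show "d * c \<le> e" using \<open>0 < c\<close> by (simp add: field_simps)
      show "0 < d" using \<open>0 < c\<close> \<open>0 < e\<close> by (simp add: d_def)
    qed
    have "(1 - d) * c * (x * p x) \<le> w" "w \<le> (1 + d) * c * (x * p x)"
      using elim w(2) \<open>0 < c\<close> d xp_nonneg[of x] unfolding w(1) d_def[symmetric]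
      by (auto simp: ennreal_le_iff)
    moreover have "d * c * (x * p x) \<le> e * (x * p x)" using d(1) xp_nonneg[of x] by (rule mult_right_mono)
    ultimately show ?case unfolding w_def[symmetric] by (auto simp: abs_le_iff algebra_simps)
  qed
qed

text \<open>
  Both \<open>\<kappa>\<close> and \<open>\<pi>\<close> are convolution factors of \<open>\<mu>\<close>, which provides the domination needed for the tail.
\<close>

lemma sigma_asymp_deconvolve:
  assumes S: "p \<in> subexp_densities" and \<kappa>: "half_line_distribution \<kappa>" and \<pi>: "half_line_distribution \<pi>"
    and \<tau>: "half_line_distribution \<tau>" and \<mu>: "\<mu> = ((\<kappa> \<star> \<pi>) \<star> \<tau>)" and half: "1 / 2 < measure \<pi> {0}"
    and asymp: "sigma_asymp (\<kappa> \<star> \<pi>)"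
  shows "sigma_asymp \<kappa>"
  unfolding sigma_asymp_def
proof (intro allI impI)
  fix c e :: real assume "0 < c" "0 < e"
  have pl: "p \<in> long_tailed" using S by (auto simp: subexp_densities_def long_tailed_densities_def)
  note D = half_line_distributionD[OF \<kappa>] half_line_distributionD[OF \<pi>] half_line_distributionD[OF \<tau>]
  have [measurable_cong]: "sets \<pi> = sets borel" by (rule D)
  interpret P: real_distribution \<pi> by (rule D)
  have \<mu>1: "\<mu> = (\<kappa> \<star> (\<pi> \<star> \<tau>))"
    unfolding \<mu> by (rule convolution_associative[symmetric]) (auto simp: D)
  have "(\<kappa> \<star> \<pi>) = (\<pi> \<star> \<kappa>)" by (rule convolution_commutative) (auto simp: D)
  then have \<mu>2: "\<mu> = (\<pi> \<star> (\<kappa> \<star> \<tau>))"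
    unfolding \<mu> by (simp only:) (rule convolution_associative[symmetric]; simp add: D)
  obtain K where K: "0 < K" "\<forall>\<^sub>F x in at_top. sigma_conv \<kappa> c x \<le> ennreal (K * (x * p x))"
    using sigma_conv_factor_bound[OF pl \<kappa> half_line_distribution_convolution[OF \<pi> \<tau>] \<mu>1 \<open>0 < c\<close>] by blast
  define T where "T x = enn2real (sigma_conv \<kappa> c x)" for x
  have T_eq: "sigma_conv \<kappa> c x = ennreal (T x)" for x unfolding T_def by (rule sigma_conv_real[OF \<kappa>])
  have T0: "0 \<le> T x" for x by (simp add: T_def)
  have [measurable]: "T \<in> borel_measurable borel"
    unfolding T_def[abs_def] using sigma_conv_measurable[OF \<kappa>] by measurable
  have T_bdd: "\<exists>b. \<forall>x\<le>R. T x \<le> b" for R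
  proof (intro exI[of _ "enn2real (emeasure \<sigma> {..R + c})"] allI impI)
    fix x assume "x \<le> R"
    then show "T x \<le> enn2real (emeasure \<sigma> {..R + c})"
      unfolding T_def using sigma_conv_bounded[OF \<kappa>] sigma_finite_below[of "R + c"] by (intro enn2real_mono) auto
  qed
  have int_T: "integrable \<pi> (\<lambda>u. T (x - u))" for x
  proof -
    obtain b where b: "\<And>s. s \<le> x \<Longrightarrow> T s \<le> b" using T_bdd[of x] by blast
    show ?thesis
      by (rule P.integrable_const_bound[of _ b], use D(15) in eventually_elim) (use b T0 in auto)
  qed
  have "\<forall>\<^sub>F x in at_top. \<bar>T x - c * (x * p x)\<bar> \<le> e * (x * p x)"
  proof (rule deconvolution[OF xp_long_tailed[OF pl] \<pi> half _ T0 T_bdd _ _ \<open>0 < c\<close> _ \<open>0 < e\<close>])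
    show "T \<in> borel_measurable borel" by measurable
    show "\<forall>\<^sub>F x in at_top. \<bar>(LINT u|\<pi>. T (x - u)) - c * (x * p x)\<bar> \<le> e * (x * p x)" if "0 < e" for e
    proof -
      have "(LINT u|\<pi>. T (x - u)) = enn2real (sigma_conv (\<kappa> \<star> \<pi>) c x)" for x
      proof -
        have "sigma_conv (\<kappa> \<star> \<pi>) c x = (\<integral>\<^sup>+u. ennreal (T (x - u)) \<partial>\<pi>)"
          unfolding sigma_conv_convolution[OF \<kappa> \<pi>] T_eq ..
        also have "\<dots> = ennreal (LINT u|\<pi>. T (x - u))"
          by (rule nn_integral_eq_integral[OF int_T]) (simp add: T0)
        finally show ?thesis using T0 by (simp add: Bochner_Integration.integral_nonneg)
      qed
      then show ?thesis using asymp \<open>0 < c\<close> that unfolding sigma_asymp_def by simp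
    qed
    show "\<exists>A0. \<forall>A\<ge>A0. \<forall>\<^sub>F x in at_top. (LINT u|\<pi>. T (x - u) * indicator {A<..} u) \<le> e * (x * p x)" if "0 < e" for e
    proof -
      have "\<exists>A0. \<forall>A\<ge>A0. \<forall>\<^sub>F x in at_top. (\<integral>\<^sup>+u\<in>{A<..}. sigma_conv \<kappa> c (x - u) \<partial>\<pi>) \<le> ennreal (e * (x * p x))"
        by (rule sigma_conv_tail_negligible[OF S \<kappa> \<pi> \<open>0 < c\<close> K _ that])
          (erule factor_window_bound[OF pl \<pi> half_line_distribution_convolution[OF \<kappa> \<tau>] \<mu>2])
      then obtain A0 where A0: "\<And>A. A0 \<le> A \<Longrightarrow> \<forall>\<^sub>F x in at_top. (\<integral>\<^sup>+u\<in>{A<..}. sigma_conv \<kappa> c (x - u) \<partial>\<pi>) \<le> ennreal (e * (x * p x))"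
        by blast
      have eq: "(\<integral>\<^sup>+u\<in>{A<..}. sigma_conv \<kappa> c (x - u) \<partial>\<pi>) = ennreal (LINT u|\<pi>. T (x - u) * indicator {A<..} u)" for A x
      proof -
        have "(\<integral>\<^sup>+u\<in>{A<..}. sigma_conv \<kappa> c (x - u) \<partial>\<pi>) = (\<integral>\<^sup>+u. ennreal (T (x - u) * indicator {A<..} u) \<partial>\<pi>)"
          unfolding T_eq by (intro nn_integral_cong) (auto simp: indicator_def)
        also have "\<dots> = ennreal (LINT u|\<pi>. T (x - u) * indicator {A<..} u)"
          by (rule nn_integral_eq_integral, rule Bochner_Integration.integrable_bound[OF int_T[of x]])
            (use T0 in \<open>auto simp: indicator_def\<close>)
        finally show ?thesis .
      qed
      have "\<forall>\<^sub>F x in at_top. (LINT u|\<pi>. T (x - u) * indicator {A<..} u) \<le> e * (x * p x)" if "A0 \<le> A" for A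
        using A0[OF that] unfolding eq
        by eventually_elim (use \<open>0 < e\<close> xp_nonneg in \<open>simp add: ennreal_le_iff\<close>)
      then show ?thesis by blast
    qed
    show "\<forall>\<^sub>F x in at_top. T x \<le> K * (x * p x)"
      using K(2) unfolding T_eq
      by eventually_elim (use K(1) xp_nonneg in \<open>simp add: ennreal_le_iff\<close>)
  qed
  then show "\<forall>\<^sub>F x in at_top. \<bar>enn2real (sigma_conv \<kappa> c x) - c * (x * p x)\<bar> \<le> e * (x * p x)"
    by (simp add: T_def)
qed

lemma sigma_asymp_conv_power:
  assumes S: "p \<in> subexp_densities" and \<pi>: "half_line_distribution \<pi>" and half: "1 / 2 < measure \<pi> {0}"
  shows "half_line_distribution \<kappa> \<Longrightarrow> \<mu> = (\<kappa> \<star> conv_power \<pi> j) \<Longrightarrow> sigma_asymp \<kappa>"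
proof (induction j arbitrary: \<kappa>)
  case 0
  then have "\<mu> = \<kappa>" by (simp add: return_convolution)
  moreover have "p \<in> long_tailed" using S by (auto simp: subexp_densities_def long_tailed_densities_def)
  ultimately show ?case using sigma_asymp_mu by simp
next
  case (Suc j)
  have \<mu>: "\<mu> = ((\<kappa> \<star> \<pi>) \<star> conv_power \<pi> j)"
    unfolding Suc.prems(2) by (rule conv_power_convolution_assoc[OF Suc.prems(1) \<pi>])
  have "sigma_asymp (\<kappa> \<star> \<pi>)"
    by (rule Suc.IH[OF half_line_distribution_convolution[OF Suc.prems(1) \<pi>] \<mu>])
  then show ?case
    by (rule sigma_asymp_deconvolve[OF S Suc.prems(1) \<pi> half_line_distribution_conv_power[OF \<pi>] \<mu> half])
qed

text \<open>
  The measure \<open>\<sigma>\<close> is finite near zero, although \<open>\<nu>\<close> need not be.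
\<close>

lemma small_sigma: "0 < e \<Longrightarrow> \<exists>\<epsilon>>0. emeasure \<sigma> {0<..\<epsilon>} < ennreal e"
proof -
  assume "0 < e"
  let ?A = "\<lambda>n. {0<..inverse (real (Suc n))}"
  have "(\<lambda>n. emeasure \<sigma> (?A n)) \<longlonglongrightarrow> emeasure \<sigma> (\<Inter>n. ?A n)"
  proof (rule Lim_emeasure_decseq)
    show "decseq ?A"
    proof (intro antimonoI)
      fix i j :: nat assume "i \<le> j"
      then have "inverse (real (Suc j)) \<le> inverse (real (Suc i))" by (intro le_imp_inverse_le) auto
      then show "?A j \<subseteq> ?A i"
        unfolding subset_iff greaterThanAtMost_iff by (blast intro: order_trans)
    qed
    show "emeasure \<sigma> (?A n) \<noteq> \<infinity>" for n
    proof -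
      have "?A n \<subseteq> {..inverse (real (Suc n))}" by (rule subsetI) simp
      then have "emeasure \<sigma> (?A n) < \<infinity>" by (rule sigma_bounded)
      then show ?thesis by simp
    qed
  qed auto
  moreover have "(\<Inter>n. ?A n) = {}"
  proof -
    have False if "\<And>n. x \<in> ?A n" for x
    proof -
      have "0 < x" using that[of 0] by simp
      then obtain n where "inverse (real (Suc n)) < x" using reals_Archimedean by blast
      then show False using that[of n] by auto
    qed
    then show ?thesis by blast
  qed
  ultimately have "(\<lambda>n. emeasure \<sigma> (?A n)) \<longlonglongrightarrow> 0" by simp
  then have "\<forall>\<^sub>F n in sequentially. emeasure \<sigma> (?A n) < ennreal e"
    by (rule order_tendstoD(2)) (use \<open>0 < e\<close> in simp)
  from eventually_happens[OF this] obtain n where "emeasure \<sigma> (?A n) < ennreal e" by auto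
  then show ?thesis by (intro exI[of _ "inverse (real (Suc n))"]) auto
qed

end

context steutel_density
begin

lemma sigma_window_real: "emeasure \<sigma> {x<..x + c} = ennreal (enn2real (emeasure \<sigma> {x<..x + c}))"
proof -
  have "{x<..x + c} \<subseteq> {..x + c}" by (rule subsetI) simp
  then have "emeasure \<sigma> {x<..x + c} < \<infinity>" by (rule sigma_bounded)
  then show ?thesis by simp
qed

text \<open>
  Write \<open>\<mu>\<close> with a factor \<open>M\<close> whose mass beyond \<open>d\<close> is at most \<open>d\<close>. The asymptotics are known for the
  convolution with \<open>M\<close>; enlarging or shrinking the window by \<open>d\<close> absorbs the jumps of \<open>M\<close> up to \<open>d\<close>, and the larger jumps cost a multiple of
  \<open>d\<close> because windows of \<open>\<sigma>\<close> are dominated with a constant that does not depend on \<open>d\<close>.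
\<close>

lemma subexp_sigma_window:
  assumes S: "p \<in> subexp_densities" and ch: "\<And>t. char \<mu> t = exp (CLINT y:{0<..}|\<nu>. iexp (t * y) - 1)"
    and "0 < c" "0 < e"
  shows "\<forall>\<^sub>F x in at_top. \<bar>enn2real (emeasure \<sigma> {x<..x + c}) - c * (x * p x)\<bar> \<le> e * (x * p x)"
proof -
  have pl: "p \<in> long_tailed" using S by (auto simp: subexp_densities_def long_tailed_densities_def)
  have ql: "(\<lambda>x. x * p x) \<in> long_tailed" by (rule xp_long_tailed[OF pl])
  define s where "s x = enn2real (emeasure \<sigma> {x<..x + c})" for x
  have s: "emeasure \<sigma> {x<..x + c} = ennreal (s x)" "0 \<le> s x" for x
    using sigma_window_real by (auto simp: s_def)
  have "\<mu> = (return borel 0 \<star> \<mu>)" by (rule return_convolution(1)[OF mu_half_line, symmetric])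
  from sigma_conv_factor_bound[OF pl half_line_distribution_return mu_half_line this \<open>0 < c\<close>]
  obtain K where K: "0 < K" "\<forall>\<^sub>F x in at_top. emeasure \<sigma> {x<..x + c} \<le> ennreal (K * (x * p x))"
    unfolding sigma_conv_return by blast
  have K': "\<forall>\<^sub>F x in at_top. sigma_conv (return borel 0) c x \<le> ennreal (K * (x * p x))"
    unfolding sigma_conv_return by (rule K)
  (* In the limit d = 0 both expressions equal c. *)
  obtain d where d: "0 < d" "d < c / 2" "d < 1 / 2" "(c + 2 * d) / (1 - d) < c + e"
    "c - e < (c - d - d) * (1 - d) - 2 * K * d - d"
  proof -
    have "((\<lambda>d. (c + 2 * d) / (1 - d)) \<longlongrightarrow> (c + 2 * 0) / (1 - 0)) (at_right 0)"
      by (intro tendsto_intros) simp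
    then have "\<forall>\<^sub>F d in at_right 0. (c + 2 * d) / (1 - d) < c + e"
      by (rule order_tendstoD(2)) (use \<open>0 < e\<close> in simp)
    moreover have "((\<lambda>d. (c - d - d) * (1 - d) - 2 * K * d - d) \<longlongrightarrow> (c - 0 - 0) * (1 - 0) - 2 * K * 0 - 0) (at_right 0)"
      by (intro tendsto_intros)
    then have "\<forall>\<^sub>F d in at_right 0. c - e < (c - d - d) * (1 - d) - 2 * K * d - d"
      by (rule order_tendstoD(1)) (use \<open>0 < e\<close> in simp)
    moreover have "\<forall>\<^sub>F d in at_right 0. d < c / 2"
      by (rule order_tendstoD(2)[OF tendsto_ident_at]) (use \<open>0 < c\<close> in simp)
    moreover have "\<forall>\<^sub>F d in at_right (0::real). d < 1 / 2"
      by (rule order_tendstoD(2)[OF tendsto_ident_at]) simp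
    moreover have "\<forall>\<^sub>F d in at_right (0::real). 0 < d" by (rule eventually_at_right_less)
    ultimately have "\<forall>\<^sub>F d in at_right 0. 0 < d \<and> d < c / 2 \<and> d < 1 / 2 \<and> (c + 2 * d) / (1 - d) < c + e
        \<and> c - e < (c - d - d) * (1 - d) - 2 * K * d - d"
      by eventually_elim auto
    from eventually_happens[OF this] that show ?thesis by auto
  qed
  obtain \<epsilon> where \<epsilon>: "0 < \<epsilon>" "emeasure \<sigma> {0<..\<epsilon>} < ennreal (d * d)"
    using small_sigma[of "d * d"] d(1) by auto
  obtain M \<pi> k where M: "half_line_distribution M" and \<pi>: "half_line_distribution \<pi>" "1 / 2 < measure \<pi> {0}"
    and \<mu>: "\<mu> = (M \<star> conv_power \<pi> k)"
    and Mt: "\<And>\<eta>. 0 < \<eta> \<Longrightarrow> ennreal \<eta> * emeasure M {\<eta><..} \<le> (\<integral>\<^sup>+y\<in>{0<..\<epsilon>}. ennreal y \<partial>\<nu>)"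
    using levy_factorization[OF mu_half_line ch \<epsilon>(1)] by blast
  note D = half_line_distributionD[OF M]
  interpret M: real_distribution M by (rule D)
  have "ennreal d * emeasure M {d<..} \<le> ennreal (d * d)"
    using Mt[OF d(1)] \<epsilon>(2) by (simp add: emeasure_sigma)
  then have Md: "emeasure M {d<..} \<le> ennreal d" using d(1) by (rule ennreal_mult_le_cancelD)
  have Md0: "ennreal (1 - d) \<le> emeasure M {0..d}"
  proof (rule ennreal_add_geD)
    have "1 = emeasure M UNIV" using M.emeasure_space_1 by simp
    also have "\<dots> = emeasure M ({0..d} \<union> {d<..})"
      by (rule emeasure_eq_AE, use D(7) in eventually_elim) auto
    also have "\<dots> \<le> emeasure M {0..d} + emeasure M {d<..}" by (rule emeasure_subadditive) auto
    also have "\<dots> \<le> emeasure M {0..d} + ennreal d" by (rule add_left_mono[OF Md])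
    finally show "ennreal 1 \<le> ennreal d + emeasure M {0..d}" by (simp add: add.commute)
  qed (use d in simp)
  have asymp: "sigma_asymp M" by (rule sigma_asymp_conv_power[OF S \<pi> M \<mu>])
  have "\<exists>A0. \<forall>A\<ge>A0. \<forall>\<^sub>F x in at_top. (\<integral>\<^sup>+u\<in>{A<..}. sigma_conv (return borel 0) c (x - u) \<partial>M) \<le> ennreal (d * (x * p x))"
    by (rule sigma_conv_tail_negligible[OF S half_line_distribution_return M \<open>0 < c\<close> K(1) K' _ d(1)])
      (erule factor_window_bound[OF pl M half_line_distribution_conv_power[OF \<pi>(1)] \<mu>])
  then obtain A0 where A0: "\<And>A. A0 \<le> A \<Longrightarrow> \<forall>\<^sub>F x in at_top. (\<integral>\<^sup>+u\<in>{A<..}. emeasure \<sigma> {x - u<..x - u + c} \<partial>M) \<le> ennreal (d * (x * p x))"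
    unfolding sigma_conv_return by blast
  define A where "A = max A0 d"
  have A: "A0 \<le> A" "d \<le> A" by (auto simp: A_def)
  have c': "0 < c + d" "0 < c - d" using d by auto
  have up: "\<forall>\<^sub>F x in at_top. \<bar>enn2real (sigma_conv M (c + d) x) - (c + d) * (x * p x)\<bar> \<le> d * (x * p x)"
    using asymp c'(1) d(1) unfolding sigma_asymp_def by blast
  have lo: "\<forall>\<^sub>F x in at_top. \<bar>enn2real (sigma_conv M (c - d) x) - (c - d) * (x * p x)\<bar> \<le> d * (x * p x)"
    using asymp c'(2) d(1) unfolding sigma_asymp_def by blast
  have shift: "filterlim (\<lambda>x::real. x + d) at_top at_top"
    using filterlim_tendsto_add_at_top[OF tendsto_const filterlim_ident, of d] by (simp add: add.commute)
  obtain B where B: "\<And>x. B \<le> x \<Longrightarrow> emeasure \<sigma> {x<..x + c} \<le> ennreal (K * (x * p x))"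
    using K(2) unfolding eventually_at_top_linorder by blast
  have [measurable]: "(\<lambda>u. emeasure \<sigma> {x - u<..x - u + c}) \<in> borel_measurable borel" for x
    by (rule measurable_compose[OF _ sigma_window_measurable]) measurable
  show ?thesis
    unfolding s_def[symmetric]
    using up eventually_compose_filterlim[OF lo shift] A0[OF A(1)] long_tailed_uniform[OF ql d(1), of A]
      long_tailed_uniform[OF ql zero_less_one, of A] eventually_ge_at_top[of "B + A"] eventually_gt_at_top[of 0]
  proof eventually_elim
    case (elim x)
    define Q where "Q = x * p x"
    have Q: "0 < Q" using elim(4) by (simp add: Q_def)
    have Qs: "(1 - d) * Q \<le> (x + d) * p (x + d)"
      using elim(4)[THEN conjunct2, rule_format, of d] A(2) d(1) by (simp add: Q_def abs_le_iff algebra_simps)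
    have "ennreal ((1 - d) * s x) = ennreal (s x) * ennreal (1 - d)"
      using d s(2) by (subst ennreal_mult[symmetric]) (auto simp: mult.commute)
    also have "\<dots> \<le> emeasure \<sigma> {x<..x + c} * emeasure M {0..d}"
      unfolding s(1) by (rule mult_left_mono[OF Md0]) simp
    also have "\<dots> = (\<integral>\<^sup>+u. emeasure \<sigma> {x<..x + c} * indicator {0..d} u \<partial>M)"
      by (rule nn_integral_cmult_indicator[symmetric]) measurable
    also have "\<dots> \<le> sigma_conv M (c + d) x"
      unfolding sigma_conv_def
      by (intro nn_integral_mono) (auto simp: indicator_def intro!: emeasure_mono)
    also have "\<dots> = ennreal (enn2real (sigma_conv M (c + d) x))" by (rule sigma_conv_real[OF M])
    also have "\<dots> \<le> ennreal ((c + 2 * d) * Q)"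
      using elim(1) by (intro ennreal_leI) (simp add: Q_def abs_le_iff algebra_simps)
    finally have "(1 - d) * s x \<le> (c + 2 * d) * Q"
      using Q d \<open>0 < c\<close> by (subst (asm) ennreal_le_iff) auto
    then have "s x \<le> (c + 2 * d) / (1 - d) * Q" using d by (simp add: field_simps)
    also have "\<dots> \<le> (c + e) * Q" using d(4) Q by (intro mult_right_mono) auto
    finally have u: "s x \<le> (c + e) * Q" .
    have "ennreal ((c - d - d) * ((1 - d) * Q)) \<le> ennreal ((c - d - d) * ((x + d) * p (x + d)))"
      using Qs d by (intro ennreal_leI mult_left_mono) auto
    also have "\<dots> \<le> ennreal (enn2real (sigma_conv M (c - d) (x + d)))"
      using elim(2) by (intro ennreal_leI) (simp add: abs_le_iff left_diff_distrib)
    also have "\<dots> = sigma_conv M (c - d) (x + d)" by (rule sigma_conv_real[OF M, symmetric])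
    also have "\<dots> \<le> (\<integral>\<^sup>+u. ennreal (s x) + ennreal (2 * K * Q) * indicator {d<..} u
        + emeasure \<sigma> {x - u<..x - u + c} * indicator {A<..} u \<partial>M)"
      unfolding sigma_conv_def
    proof (rule nn_integral_mono_AE, use D(7) in eventually_elim)
      case (elim u)
      consider "u \<le> d" | "d < u" "u \<le> A" | "A < u" by linarith
      then show ?case
      proof cases
        case 1
        have "emeasure \<sigma> {x + d - u<..x + d - u + (c - d)} \<le> emeasure \<sigma> {x<..x + c}"
          by (intro emeasure_mono) (use 1 elim in auto)
        then show ?thesis using 1 A(2) by (simp add: s(1))
      next
        case 2
        have "emeasure \<sigma> {x + d - u<..x + d - u + (c - d)} \<le> emeasure \<sigma> {x - u<..x - u + c}"
          by (intro emeasure_mono) (use d(1) in auto)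
        also have "\<dots> \<le> ennreal (K * ((x - u) * p (x - u)))"
          using \<open>B + A \<le> x\<close> 2 by (intro B) auto
        also have "\<dots> \<le> ennreal (2 * K * Q)"
        proof (rule ennreal_leI)
          have "\<bar>- u\<bar> \<le> A" using 2 elim by simp
          then have "\<bar>(x + - u) * p (x + - u) - x * p x\<bar> \<le> 1 * (x * p x)"
            using \<open>0 < x * p x \<and> (\<forall>t. \<bar>t\<bar> \<le> A \<longrightarrow> \<bar>(x + t) * p (x + t) - x * p x\<bar> \<le> 1 * (x * p x))\<close> by blast
          then have "(x - u) * p (x - u) \<le> 2 * Q" unfolding Q_def by (simp only: abs_le_iff diff_conv_add_uminus) linarith
          then have "K * ((x - u) * p (x - u)) \<le> K * (2 * Q)" using K(1) by (intro mult_left_mono) auto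
          then show "K * ((x - u) * p (x - u)) \<le> 2 * K * Q" by simp
        qed
        finally show ?thesis using 2 by (simp add: add_increasing)
      next
        case 3
        have "emeasure \<sigma> {x + d - u<..x + d - u + (c - d)} \<le> emeasure \<sigma> {x - u<..x - u + c}"
          by (intro emeasure_mono) (use d(1) in auto)
        then show ?thesis using 3 by (simp add: add_increasing)
      qed
    qed
    also have "\<dots> = (\<integral>\<^sup>+u. ennreal (s x) + ennreal (2 * K * Q) * indicator {d<..} u \<partial>M)
        + (\<integral>\<^sup>+u\<in>{A<..}. emeasure \<sigma> {x - u<..x - u + c} \<partial>M)"
      by (rule nn_integral_add) measurable
    also have "(\<integral>\<^sup>+u. ennreal (s x) + ennreal (2 * K * Q) * indicator {d<..} u \<partial>M)
        = ennreal (s x) + ennreal (2 * K * Q) * emeasure M {d<..}"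
      by (subst nn_integral_add) (auto simp: nn_integral_cmult_indicator M.emeasure_space_1[simplified])
    also have "ennreal (s x) + ennreal (2 * K * Q) * emeasure M {d<..} + (\<integral>\<^sup>+u\<in>{A<..}. emeasure \<sigma> {x - u<..x - u + c} \<partial>M)
        \<le> ennreal (s x) + ennreal (2 * K * Q) * ennreal d + ennreal (d * Q)"
      by (intro add_mono order_refl mult_left_mono Md) (use elim(3) in \<open>auto simp: Q_def\<close>)
    also have "\<dots> = ennreal (s x + 2 * K * Q * d + d * Q)"
      using s(2) K(1) Q d(1) by (simp add: ennreal_mult ennreal_plus)
    finally have "(c - d - d) * ((1 - d) * Q) \<le> s x + 2 * K * Q * d + d * Q"
      using s(2) K(1) Q d(1) by (subst (asm) ennreal_le_iff) (auto intro!: add_nonneg_nonneg)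
    then have "((c - d - d) * (1 - d) - 2 * K * d - d) * Q \<le> s x" by (simp add: algebra_simps)
    moreover have "(c - e) * Q \<le> ((c - d - d) * (1 - d) - 2 * K * d - d) * Q"
      using d(5) Q by (intro mult_right_mono) auto
    ultimately have l: "(c - e) * Q \<le> s x" by linarith
    show ?case
      unfolding Q_def[symmetric] using u l by (simp add: abs_le_iff algebra_simps)
  qed
qed

text \<open>
  On \<open>(x, x + c]\<close> the density \<open>y\<close> of \<open>\<sigma>\<close> is asymptotically \<open>x\<close>.
\<close>

lemma subexp_levy_window:
  assumes S: "p \<in> subexp_densities" and ch: "\<And>t. char \<mu> t = exp (CLINT y:{0<..}|\<nu>. iexp (t * y) - 1)"
    and "0 < c"
  shows "(\<lambda>x. measure \<nu> {x<..x + c}) \<simeq> (\<lambda>x. c * p x)"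
  unfolding asymp_pos_iff
proof (intro conjI allI impI)
  have pl: "p \<in> long_tailed" using S by (auto simp: subexp_densities_def long_tailed_densities_def)
  show "\<forall>\<^sub>F x in at_top. 0 < c * p x"
    using long_tailedD(4)[OF pl] by eventually_elim (use \<open>0 < c\<close> in simp)
  fix e :: real assume "0 < e"
  define d where "d = min (1 / 2) (e / 4)"
  have d: "0 < d" "d \<le> 1 / 2" "4 * d \<le> e" using \<open>0 < e\<close> by (auto simp: d_def)
  have "0 < d * c" using d(1) \<open>0 < c\<close> by simp
  show "\<forall>\<^sub>F x in at_top. \<bar>measure \<nu> {x<..x + c} - c * p x\<bar> \<le> e * (c * p x)"
    using subexp_sigma_window[OF S ch \<open>0 < c\<close> \<open>0 < d * c\<close>] eventually_gt_at_top[of 0] eventually_ge_at_top[of "c / d"]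
      long_tailedD(4)[OF pl]
  proof eventually_elim
    case (elim x)
    define n where "n = measure \<nu> {x<..x + c}"
    define s where "s = enn2real (emeasure \<sigma> {x<..x + c})"
    have n: "emeasure \<nu> {x<..x + c} = ennreal n" "0 \<le> n"
      unfolding n_def using elim(2) by (auto intro: nu_window)
    have s: "emeasure \<sigma> {x<..x + c} = ennreal s" "0 \<le> s"
      using sigma_window_real by (auto simp: s_def)
    have cx: "c \<le> d * x" using elim(3) d(1) by (simp add: field_simps)
    have "ennreal (x * n) \<le> ennreal s"
      using sigma_window_lower[of x c] elim(2) n by (simp add: s(1) ennreal_mult)
    then have 1: "x * n \<le> s" using s(2) by (simp add: ennreal_le_iff)
    have "ennreal s \<le> ennreal ((x + c) * n)"
      using sigma_window_upper[of x c] elim(2) \<open>0 < c\<close> n by (simp add: s(1) ennreal_mult)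
    then have 2: "s \<le> (x + c) * n" using n(2) elim(2) \<open>0 < c\<close> by (subst (asm) ennreal_le_iff) auto
    have 3: "s \<le> (1 + d) * c * (x * p x)" "(1 - d) * c * (x * p x) \<le> s"
      using elim(1) unfolding s_def[symmetric] by (auto simp: abs_le_iff algebra_simps)
    have "x * n \<le> x * ((1 + d) * (c * p x))" using 1 3(1) by (simp add: mult_ac)
    then have u: "n \<le> (1 + d) * (c * p x)" using elim(2) by simp
    have "(x + c) * n \<le> (x + d * x) * n" using cx n(2) by (intro mult_right_mono) auto
    then have "x * ((1 - d) * (c * p x)) \<le> x * ((1 + d) * n)"
      using 2 3(2) by (simp add: algebra_simps)
    then have l: "(1 - d) * (c * p x) \<le> (1 + d) * n" using elim(2) by simp
    define Y where "Y = c * p x"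
    have Y: "0 < Y" using \<open>0 < c\<close> elim(4) by (simp add: Y_def)
    have "d * n \<le> d * ((1 + d) * Y)" using u d(1) by (intro mult_left_mono) (auto simp: Y_def)
    also have "\<dots> \<le> d * (2 * Y)" using d Y by (intro mult_left_mono mult_right_mono) auto
    finally have "(1 - 3 * d) * Y \<le> n" using l by (simp add: Y_def[symmetric] algebra_simps)
    moreover have "4 * d * Y \<le> e * Y" "0 \<le> d * Y" using d Y by (auto intro!: mult_right_mono)
    ultimately show ?case
      using u unfolding n_def[symmetric] Y_def[symmetric] by (auto simp: abs_le_iff algebra_simps)
  qed
qed

lemma subexp_imp_asymp_window:
  assumes S: "p \<in> subexp_densities" and ch: "\<And>t. char \<mu> t = exp (CLINT y:{0<..}|\<nu>. iexp (t * y) - 1)"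
  shows "\<rho> \<in> loc_long_tailed" and "p \<simeq> win"
proof -
  have pl: "p \<in> long_tailed" using S by (auto simp: subexp_densities_def long_tailed_densities_def)
  interpret rho: real_distribution \<rho> by (rule rho_distribution)
  show "p \<simeq> win"
    using asymp_pos_sym[OF subexp_levy_window[OF S ch zero_less_one]] by (simp add: win_def[abs_def])
  have "(\<lambda>x. measure \<rho> {x<..x + c}) \<in> long_tailed" if "0 < c" for c
  proof (rule long_tailed_asymp[OF long_tailed_cmult[OF pl]])
    show "0 < c / tail_mass" using that lambda_pos by simp
    have "(\<lambda>x. 1 / tail_mass * measure \<nu> {x<..x + c}) \<simeq> (\<lambda>x. 1 / tail_mass * (c * p x))"
      by (rule asymp_pos_cmult[OF subexp_levy_window[OF S ch that]]) (use lambda_pos in simp)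
    then show "(\<lambda>x. measure \<rho> {x<..x + c}) \<simeq> (\<lambda>x. c / tail_mass * p x)"
    proof (rule asymp_pos_cong)
      show "\<forall>\<^sub>F x in at_top. 1 / tail_mass * measure \<nu> {x<..x + c} = measure \<rho> {x<..x + c}"
        using eventually_ge_at_top[of 1] by eventually_elim (use lambda_pos in \<open>simp add: rho_window\<close>)
    qed simp
    show "(\<lambda>x. measure \<rho> {x<..x + c}) \<in> borel_measurable borel"
      by (rule window_function_measurable[OF rho.sigma_finite_measure_axioms sets_rho])
  qed simp
  then show "\<rho> \<in> loc_long_tailed" using rho_distribution by (simp add: loc_long_tailed_def)
qed

end

section \<open>The equivalences\<close>

theorem theorem1p2:
  fixes \<mu> \<nu> :: "real measure" and p :: "real \<Rightarrow> real"
  assumes "inf_div_half_line \<mu> \<nu> 0"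
    and "\<And>c. 0 < c \<Longrightarrow> 0 < emeasure \<nu> {c<..}"
    and "(\<integral>\<^sup>+z. ennreal (cmod (char \<mu> z)) \<partial>lborel) < \<infinity>"
    and "p \<in> prob_densities" and "continuous_on UNIV p"
    and "\<mu> = density lborel (\<lambda>x. ennreal (p x))"
  defines "cond1 \<equiv> p \<in> subexp_densities"
    and "cond2 \<equiv> normalized_levy \<nu> \<in> loc_subexp"
    and "cond3 \<equiv> normalized_levy \<nu> \<in> loc_long_tailed \<and> p \<simeq> (\<lambda>x. measure \<nu> {x<..x + 1})"
    and "cond4 \<equiv> normalized_levy \<nu> \<in> loc_long_tailed \<and>
           (\<exists>C>0. p \<simeq> (\<lambda>x. C * measure \<nu> {x<..x + 1}))"
  shows "(cond1 \<longleftrightarrow> cond2) \<and> (cond2 \<longleftrightarrow> cond3) \<and> (cond3 \<longleftrightarrow> cond4)"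
proof -
  have levy: "levy_measure_half_line \<nu>" and \<mu>: "half_line_distribution \<mu>"
    and ch: "\<And>t. char \<mu> t = exp (CLINT y:{0<..}|\<nu>. iexp (t * y) - 1)"
    using assms(1) by (auto simp: inf_div_half_line_def infinitely_divisible_def half_line_distribution_def on_half_line_def)
  interpret levy_measure \<nu> by unfold_locales (rule levy)
  have p: "continuous_on UNIV p" "\<And>x. 0 \<le> p x" "(\<integral>\<^sup>+x. ennreal (p x) \<partial>lborel) = 1"
    using assms(4,5) by (auto simp: prob_densities_def)
  interpret s: steutel_density \<nu> p
  proof unfold_locales
    show "p x = 0" if "x \<le> 0" for x
      using density_zero_nonpos[OF p(1,2) \<mu>[unfolded assms(6)] that] .
    show "ennreal (x * p x) = (\<integral>\<^sup>+y. ennreal (p (x - y)) * ennreal y \<partial>\<nu>)" for x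
      by (rule steutel_identity[OF \<mu> ch p(1,2) assms(6)])
  qed (use p assms(2) in auto)
  have ch': "char s.\<mu> t = exp (CLINT y:{0<..}|\<nu>. iexp (t * y) - 1)" for t
    using ch[of t] unfolding s.\<mu>_def assms(6) .
  have win: "(\<lambda>x. measure \<nu> {x<..x + 1}) = s.win" by (simp add: s.win_def[abs_def])
  have 13: cond3 if cond1
    using s.subexp_imp_asymp_window[OF _ ch'] that unfolding cond1_def cond3_def win by blast
  have 34: cond4 if cond3
    using that unfolding cond3_def cond4_def by (intro conjI exI[of _ 1]) auto
  have 41: cond1 if cond4
  proof -
    obtain C where L: "normalized_levy \<nu> \<in> loc_long_tailed" and C: "0 < C" "p \<simeq> (\<lambda>x. C * s.win x)"
      using \<open>cond4\<close> unfolding cond4_def s.win_def by blast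
    have "C = 1" by (rule s.asymp_constant_eq_one[OF L C])
    then show ?thesis unfolding cond1_def using C by (intro s.asymp_window_imp_subexp[OF L]) simp
  qed
  have 12: cond2 if cond1
    using s.asymp_window_imp_loc_subexp s.subexp_imp_asymp_window[OF _ ch'] that unfolding cond1_def cond2_def by blast
  have 23: cond3 if cond2
    using s.loc_subexp_middle s.density_asymp_window that unfolding cond2_def cond3_def win by blast
  show ?thesis using 13 34 41 12 23 by blast
qed

end
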